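(* Let $\alpha\ge 1$. For $f\in L^2(\mathbb{R}^d_+)$ let $a_n=\int_{\mathbb{R}^d_+}f(t)\mathcal{L}_n(t)\,dt$, $n\in\mathbb{N}_0^d$. The following conditions are equivalent: (i) There exist $c>0$ and $a>1$ such that $|a_n|\le c\,a^{-|n|^{1/\alpha}}$ for all $n\in\mathbb{N}_0^d$. (ii) $f\in G^\alpha_\alpha(\mathbb{R}^d_+)$. (iii) There exist $C,A>0$ such that $|D^p\mathcal{F}_{\mathbf D}(f)(w)|\le C A^{|p|}p^{\alpha p}$ for all $p\in\mathbb{N}_0^d$ and $w\in\mathbf D$, and $\lim_{w\to\mathbf 1}\mathcal{F}_{\mathbf D}(f)(w)=0$. Conversely, given a sequence $\{a_n\}_{n\in\mathbb{N}_0^d}$ of complex numbers satisfying condition (i) (in which case put $F(w)=(\mathbf 1-w)^{\mathbf 1}\sum_{n}a_nw^n$, $w\in\mathbf D$), or given an analytic function $F$ on $\mathbf D$ of the form $F(w)=(\mathbf 1-w)^{\mathbf 1}\sum_{n\in\mathbb{N}_0^d}a_nw^n$ with $a_n\to0$ as $|n|\to\infty$ for which there exist $C,A>0$ with $|D^pF(w)|\le CA^{|p|}p^{\alpha p}$ for all $p\in\mathbb{N}_0^d$, $w\in\mathbf D$, there exists $f\in G^\alpha_\alpha(\mathbb{R}^d_+)$ such that $a_n=\int_{\mathbb{R}^d_+}f(t)\mathcal{L}_n(t)\,dt$ for all $n$ and $\mathcal{F}_{\mathbf D}(f)(w)=F(w)$ for $w\in\mathbf D$.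
   Context: $\mathbb{R}^d_+=(0,\infty)^d$, $\mathbb{N}_0=\{0,1,2,\dots\}$. Multi-index notation is used: $|n|=n_1+\dots+n_d$, $x^t=\prod_l x_l^{t_l}$, $p^{\alpha p}=\prod_l p_l^{\alpha p_l}$, with $0^0=1$; $\mathbf 1=(1,\dots,1)$, so $(\mathbf 1-w)^{\mathbf 1}=\prod_l(1-w_l)$. $D^p$ denotes the partial derivative of order $p$. $\|\cdot\|_2$ is the norm of $L^2(\mathbb{R}^d_+)$. Laguerre functions: for $j\in\mathbb{N}_0$, $L_j(t)=\frac{e^t}{j!}\frac{d^j}{dt^j}(e^{-t}t^j)$, and for $n\in\mathbb{N}_0^d$, $\mathcal{L}_n(t)=\prod_{l=1}^dL_{n_l}(t_l)e^{-t_l/2}$. $\mathcal{S}(\mathbb{R}^d_+)$ is the space of all $f\in C^\infty(\mathbb{R}^d_+)$ such that all derivatives $D^pf$ extend continuously to $\overline{\mathbb{R}^d_+}=[0,\infty)^d$ and $\sup_{x\in\mathbb{R}^d_+}x^k|D^pf(x)|<\infty$ for all $k,p\in\mathbb{N}_0^d$. $G^\alpha_\alpha(\mathbb{R}^d_+)$ is the space of all $f\in\mathcal{S}(\mathbb{R}^d_+)$ for which there exists $A>0$ with $\sup_{p,k\in\mathbb{N}_0^d}\frac{\|t^{(p+k)/2}D^pf(t)\|_2}{A^{|p+k|}k^{(\alpha/2)k}p^{(\alpha/2)p}}<\infty$. (An element of $L^2$ belongs to this space if it coincides a.e. with such a function.) $\mathbf D=\{w\in\mathbb{C}^d:\ |w_l|<1,\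 l=1,\dots,d\}$. For $f\in L^2(\mathbb{R}^d_+)$, $\mathcal{F}_{\mathbf D}(f)(w)=\int_{\mathbb{R}^d_+}f(t)\prod_{l=1}^de^{-\frac12\frac{1+w_l}{1-w_l}t_l}\,dt$, $w\in\mathbf D$. *)

theory Defs
  imports "HOL-Analysis.Analysis"
begin

text \<open>
  The dimension d is the cardinality of the finite index type \<open>'d\<close>; a multi-index
  is a function \<open>'d \<Rightarrow> nat\<close>.
\<close>

type_synonym 'd mindex = "'d \<Rightarrow> nat"

definition mdeg :: "'d::finite mindex \<Rightarrow> nat"
  where "mdeg n = (\<Sum>l\<in>UNIV. n l)"

definition mpow :: "'a::comm_monoid_mult ^ 'd::finite \<Rightarrow> 'd mindex \<Rightarrow> 'a"
  where "mpow x n = (\<Prod>l\<in>UNIV. (x $ l) ^ n l)"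

text \<open>
  \<open>self_pow \<beta> p\<close> is \<open>p^(\<beta> p)\<close> in multi-index notation. The convention 0^0 = 1 has to be
  made explicit, as \<open>0 powr 0 = 0\<close> in HOL.
\<close>

definition self_pow :: "real \<Rightarrow> 'd::finite mindex \<Rightarrow> real"
  where "self_pow \<beta> p =
    (\<Prod>l\<in>UNIV. if p l = 0 then 1 else real (p l) powr (\<beta> * real (p l)))"

definition pos_orthant :: "(real ^ 'd::finite) set"
  where "pos_orthant = {x. \<forall>l. 0 < x $ l}"

definition closed_orthant :: "(real ^ 'd::finite) set"
  where "closed_orthant = {x. \<forall>l. 0 \<le> x $ l}"

definition polydisc :: "(complex ^ 'd::finite) set"
  where "polydisc = {w. \<forall>l. cmod (w $ l) < 1}"

text \<open>
  Multi-index derivatives are obtained by iterating the partial derivatives along an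
  arbitrary but fixed enumeration of the coordinates. The theory applies them only to
  functions that are smooth (or holomorphic) on an open set, where the order of
  differentiation is irrelevant.
\<close>

definition coords :: "'d::finite list"
  where "coords = (SOME ls. distinct ls \<and> set ls = UNIV)"

lemma distinct_coords: "distinct (coords :: 'd::finite list)"
  and set_coords: "set (coords :: 'd::finite list) = UNIV"
proof -
  have "\<exists>ls :: 'd list. distinct ls \<and> set ls = UNIV"
    using finite_distinct_list[of "UNIV :: 'd set"] by auto
  from someI_ex[OF this]
  show "distinct (coords :: 'd list)" "set (coords :: 'd list) = UNIV"
    unfolding coords_def by blast+
qed

definition multi_iter :: "('d::finite \<Rightarrow> 'f \<Rightarrow> 'f) \<Rightarrow> 'd mindex \<Rightarrow> 'f \<Rightarrow> 'f"
  where "multi_iter P p f = foldr (\<lambda>l. P l ^^ p l) coords f"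

definition rpartial :: "'d::finite \<Rightarrow> (real ^ 'd \<Rightarrow> complex) \<Rightarrow> real ^ 'd \<Rightarrow> complex"
  where "rpartial l f x = vector_derivative (\<lambda>s. f (x + s *\<^sub>R axis l 1)) (at 0)"

definition rD :: "'d::finite mindex \<Rightarrow> (real ^ 'd \<Rightarrow> complex) \<Rightarrow> real ^ 'd \<Rightarrow> complex"
  where "rD = multi_iter rpartial"

definition cpartial :: "'d::finite \<Rightarrow> (complex ^ 'd \<Rightarrow> complex) \<Rightarrow> complex ^ 'd \<Rightarrow> complex"
  where "cpartial l F w = deriv (\<lambda>z. F (w + z *s axis l 1)) 0"

definition cD :: "'d::finite mindex \<Rightarrow> (complex ^ 'd \<Rightarrow> complex) \<Rightarrow> complex ^ 'd \<Rightarrow> complex"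
  where "cD = multi_iter cpartial"

primrec Ck_on :: "nat \<Rightarrow> (real ^ 'd::finite) set \<Rightarrow> (real ^ 'd \<Rightarrow> complex) \<Rightarrow> bool"
  where
    "Ck_on 0 S f \<longleftrightarrow> continuous_on S f"
  | "Ck_on (Suc k) S f \<longleftrightarrow> continuous_on S f \<and>
       (\<forall>l. (\<forall>x\<in>S. (\<lambda>s. f (x + s *\<^sub>R axis l 1)) differentiable (at 0)) \<and>
            Ck_on k S (rpartial l f))"

definition smooth_on :: "(real ^ 'd::finite) set \<Rightarrow> (real ^ 'd \<Rightarrow> complex) \<Rightarrow> bool"
  where "smooth_on S f \<longleftrightarrow> (\<forall>k. Ck_on k S f)"

text \<open>
  Holomorphy in several variables (on an open set): the total derivative exists and is
  complex linear.
\<close>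

definition analytic_multi_on :: "(complex ^ 'd::finite \<Rightarrow> complex) \<Rightarrow> (complex ^ 'd) set \<Rightarrow> bool"
  where "analytic_multi_on F S \<longleftrightarrow>
    (\<forall>w\<in>S. \<exists>F'. (F has_derivative F') (at w) \<and> (\<forall>c v. F' (c *s v) = c * F' v))"

text \<open>
  Functions on the open orthant are represented by total functions whose values elsewhere
  are irrelevant; elements of L^2 are represented by functions rather than classes.
\<close>

definition L2 :: "(real ^ 'd::finite \<Rightarrow> complex) set"
  where "L2 = {f. f \<in> borel_measurable (lebesgue_on pos_orthant) \<and>
                  integrable (lebesgue_on pos_orthant) (\<lambda>t. (cmod (f t))\<^sup>2)}"

definition L2_norm :: "(real ^ 'd::finite \<Rightarrow> complex) \<Rightarrow> real"
  where "L2_norm f = sqrt (\<integral>t. (cmod (f t))\<^sup>2 \<partial>lebesgue_on pos_orthant)"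

definition laguerre_poly :: "nat \<Rightarrow> real \<Rightarrow> real"
  where "laguerre_poly j t = exp t / fact j * (deriv ^^ j) (\<lambda>s. exp (- s) * s ^ j) t"

definition laguerre_fun :: "'d::finite mindex \<Rightarrow> real ^ 'd \<Rightarrow> real"
  where "laguerre_fun n t = (\<Prod>l\<in>UNIV. laguerre_poly (n l) (t $ l) * exp (- (t $ l) / 2))"

definition laguerre_coeff :: "(real ^ 'd::finite \<Rightarrow> complex) \<Rightarrow> 'd mindex \<Rightarrow> complex"
  where "laguerre_coeff f n =
    (\<integral>t. f t * complex_of_real (laguerre_fun n t) \<partial>lebesgue_on pos_orthant)"

definition schwartz_orthant :: "(real ^ 'd::finite \<Rightarrow> complex) set"
  where "schwartz_orthant = {f. smooth_on pos_orthant f \<and>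
    (\<forall>p. \<exists>g. continuous_on closed_orthant g \<and> (\<forall>x\<in>pos_orthant. g x = rD p f x)) \<and>
    (\<forall>k p. bdd_above ((\<lambda>x. mpow x k * cmod (rD p f x)) ` pos_orthant))}"

definition half_weight :: "'d::finite mindex \<Rightarrow> 'd mindex \<Rightarrow> real ^ 'd \<Rightarrow> real"
  where "half_weight p k t = (\<Prod>l\<in>UNIV. (t $ l) powr (real (p l + k l) / 2))"

text \<open>
  In the following definition, membership in \<open>L2\<close> says that the L^2 norm is finite; it cannot
  be read off \<open>L2_norm\<close>, which is 0 for functions that are not square integrable.
\<close>

definition G_space :: "real \<Rightarrow> (real ^ 'd::finite \<Rightarrow> complex) set"
  where "G_space \<alpha> = {f \<in> schwartz_orthant. \<exists>A>0.
    (\<forall>p k. (\<lambda>t. complex_of_real (half_weight p k t) * rD p f t) \<in> L2) \<and>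
    bdd_above (range (\<lambda>(p, k).
      L2_norm (\<lambda>t. complex_of_real (half_weight p k t) * rD p f t) /
      (A ^ (mdeg p + mdeg k) * self_pow (\<alpha> / 2) k * self_pow (\<alpha> / 2) p)))}"

definition F_disc :: "(real ^ 'd::finite \<Rightarrow> complex) \<Rightarrow> complex ^ 'd \<Rightarrow> complex"
  where "F_disc f w =
    (\<integral>t. f t * (\<Prod>l\<in>UNIV. exp (- (1 / 2) * ((1 + w $ l) / (1 - w $ l)) * complex_of_real (t $ l)))
      \<partial>lebesgue_on pos_orthant)"

text \<open>
  The series below is an unconditional sum; on the polydisc it converges absolutely whenever
  the coefficients are bounded.
\<close>

definition disc_series :: "('d::finite mindex \<Rightarrow> complex) \<Rightarrow> complex ^ 'd \<Rightarrow> complex"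
  where "disc_series a w = (\<Prod>l\<in>UNIV. 1 - w $ l) * (\<Sum>\<^sub>\<infinity>n. a n * mpow w n)"

end

theory Submission
  imports Defs "HOL-Complex_Analysis.Complex_Analysis" "HOL-Real_Asymp.Real_Asymp"
begin

text \<open>
  All conditions are compared with one property of the sequence of Laguerre coefficients, the
  predicate \<open>decays\<close>: a bound of the form \<open>|a_n| \<le> C \<Prod>_l exp (-\<delta> n_l^(1/\<alpha>))\<close>.
  As \<open>\<alpha> \<ge> 1\<close>, the quantities \<open>|n|^(1/\<alpha>)\<close> and \<open>\<Sum>_l n_l^(1/\<alpha>)\<close> are comparable, so this is
  condition (i) (\<open>decays_iff\<close>).

  Decay and bounds on derivatives are linked by two estimates. Moments of a subexponential weight
  satisfy \<open>\<Sum>_j j^p exp (-\<delta> j^(1/\<alpha>)) \<le> D A^p p^(\<alpha>p)\<close> (\<open>subexp_sum_power\<close>). In the other direction,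
  if \<open>|a_n| \<le> C B^|p| p^(\<alpha>p) (n-p)!/n!\<close> for every \<open>p \<le> n\<close>, then the choice
  \<open>p_l \<approx> (n_l / (B e^2))^(1/\<alpha>)\<close> yields decay (\<open>decaysI_optimal_order\<close>).

  The disc side. The generating function of the Laguerre polynomials turns \<open>F_disc f\<close> into
  \<open>disc_series\<close> of the coefficients of \<open>f\<close> (\<open>F_disc_eq_disc_series\<close>), a power series whose
  coefficients \<open>c\<close> arise from \<open>a\<close> by taking backward differences in every coordinate. The power
  series of \<open>D^p F\<close> has the coefficients \<open>c_n n!/(n-p)!\<close>. They are bounded by the supremum of
  \<open>D^p F\<close> on the polydisc (Cauchy's estimates), and their absolute sum bounds \<open>D^p F\<close>. Hence the
  derivative bounds in (iii) say that \<open>c\<close> decays. Since \<open>a\<close> vanishes at infinity along every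
  coordinate line, by Bessel's inequality, it is recovered from \<open>c\<close> by telescoping, so that \<open>c\<close>
  decays iff \<open>a\<close> does (\<open>decays_iff_derivative_bound\<close>). The limit at \<open>(1,...,1)\<close> comes from the factor
  \<open>\<Prod>_l (1 - w_l)\<close> and the absolute summability of \<open>a\<close>.

  From decay to the function space. The Laguerre series with coefficients \<open>a\<close> and its termwise
  derivatives are controlled by pointwise bounds for \<open>t^(q/2) e^(-t/2) |L_m^(p)(t)|\<close>, which come from
  Cauchy's estimate for the generating function on a circle whose radius depends on \<open>m\<close> and \<open>q\<close>
  (\<open>lag_weighted_bound\<close>). Summation against the decaying coefficients gives \<open>lser_G_space\<close>.

  From the function space to decay. By Rodrigues' formula, \<open>n! e^(-t) L_n(t)\<close> is the \<open>p\<close>-th derivative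
  of \<open>(n-p)! t^p e^(-t) L_(n-p)^(p)(t)\<close>. Integrating by parts moves the \<open>p\<close> derivatives to
  \<open>f(t) e^(t/2)\<close>; every step yields one term with a derivative of \<open>f\<close> and one with a factor \<open>1/2\<close>.
  Orthogonality with respect to the weight \<open>t^p e^(-t)\<close> gives the exact norm of \<open>L_(n-p)^(p)\<close>, so the
  Cauchy-Schwarz inequality bounds \<open>|a_n|\<close> by \<open>(3/2)^|p|\<close> times a norm \<open>\<parallel>t^(p/2) D^j f\<parallel>\<close> with
  \<open>j \<le> p\<close> times the square root of \<open>(n-p)!/n!\<close>. The squares \<open>|a_n|^2\<close> then satisfy the hypothesis of
  \<open>decaysI_optimal_order\<close> (\<open>decays_laguerre_coeff\<close>).

  Finally, two square integrable functions with the same coefficients agree almost everywhere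
  (\<open>laguerre_coeff_eq_0_imp_AE_eq_0\<close>), because \<open>F_disc\<close> of their difference vanishes, and with it
  all the moments that determine a function by the Stone-Weierstrass theorem.
\<close>

section \<open>Generalized Laguerre polynomials\<close>

text \<open>
  The generalized Laguerre polynomial \<open>L_m^(p)(t)\<close> with integer parameter
  \<open>p\<close>.
\<close>

definition lag :: "nat \<Rightarrow> nat \<Rightarrow> real \<Rightarrow> real"
  where "lag p m t = (\<Sum>i\<le>m. (-1) ^ i * real ((m + p) choose (m - i)) / fact i * t ^ i)"

lemma lag_0 [simp]: "lag p 0 t = 1"
  by (simp add: lag_def)

lemma has_real_derivative_lag:
  "(lag p (Suc m) has_real_derivative - lag (Suc p) m t) (at t)"
proof -
  have "((\<lambda>t. \<Sum>i\<le>Suc m. (-1) ^ i * real ((Suc m + p) choose (Suc m - i)) / fact i * t ^ i)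
      has_real_derivative
      (\<Sum>i\<le>Suc m. (-1) ^ i * real ((Suc m + p) choose (Suc m - i)) / fact i * (real i * t ^ (i - 1)))) (at t)"
    by (intro DERIV_sum DERIV_cmult DERIV_pow[THEN DERIV_cong]) simp
  also have "(\<Sum>i\<le>Suc m. (-1) ^ i * real ((Suc m + p) choose (Suc m - i)) / fact i * (real i * t ^ (i - 1)))
     = - lag (Suc p) m t"
    unfolding lag_def sum.atMost_Suc_shift sum_negf[symmetric]
    by (simp add: field_simps del: of_nat_Suc)
  finally show ?thesis unfolding lag_def [abs_def] .
qed

lemma has_real_derivative_lag_0 [derivative_intros]:
  "(lag p 0 has_real_derivative 0) (at t)"
  by (simp add: lag_def [abs_def])

text \<open>
  The coefficientwise identity behind the weighted derivative formula below: the
  \<open>case\<close> expression is the derivative of \<open>lag (Suc p) m\<close>, which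
  vanishes for \<open>m = 0\<close>.
\<close>

lemma lag_contiguous:
  "(real (Suc p) - t) * lag (Suc p) m t
     + t * (case m of 0 \<Rightarrow> 0 | Suc k \<Rightarrow> - lag (Suc (Suc p)) k t)
   = real (Suc m) * lag p (Suc m) t"
proof -
  let ?c = "\<lambda>i. (-1) ^ i * real ((Suc (m + p)) choose (m - i)) / fact i :: real"
  have D: "t * (case m of 0 \<Rightarrow> 0 | Suc k \<Rightarrow> - lag (Suc (Suc p)) k t) = (\<Sum>i\<le>m. ?c i * real i * t ^ i)"
  proof (cases m)
    case (Suc k)
    show ?thesis unfolding Suc sum.atMost_Suc_shift lag_def
      by (simp add: sum_distrib_left sum_negf[symmetric] field_simps del: of_nat_Suc)
  qed simp
  have L: "lag (Suc p) m t = (\<Sum>i\<le>m. ?c i * t ^ i)"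
    by (simp add: lag_def)
  have "real (Suc p) * lag (Suc p) m t + t * (case m of 0 \<Rightarrow> 0 | Suc k \<Rightarrow> - lag (Suc (Suc p)) k t)
      = (\<Sum>i\<le>m. ?c i * (real (Suc p + i)) * t ^ i)"
    unfolding D L sum_distrib_left sum.distrib[symmetric]
    by (intro sum.cong refl) (simp add: algebra_simps add_divide_distrib)
  also have "\<dots> = (\<Sum>i\<le>Suc m. (if i \<le> m then ?c i else 0) * (real (Suc p + i)) * t ^ i)"
    by (simp)
  finally have 1: "real (Suc p) * lag (Suc p) m t + t * (case m of 0 \<Rightarrow> 0 | Suc k \<Rightarrow> - lag (Suc (Suc p)) k t)
      = (\<Sum>i\<le>Suc m. (if i \<le> m then ?c i else 0) * (real (Suc p + i)) * t ^ i)" .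
  have 2: "t * lag (Suc p) m t = (\<Sum>i\<le>Suc m. (if i = 0 then 0 else ?c (i - 1)) * t ^ i)"
    unfolding sum.atMost_Suc_shift L by (simp add: sum_distrib_left algebra_simps)
  have coeff: "(if i \<le> m then ?c i else 0) * real (Suc p + i) - (if i = 0 then 0 else ?c (i - 1))
      = real (Suc m) * ((-1) ^ i * real ((Suc m + p) choose (Suc m - i)) / fact i)"
    if i: "i \<le> Suc m" for i
  proof -
    let ?N = "Suc (m + p)"
    have a: "(if i \<le> m then real (?N choose (m - i)) else 0) * real (Suc p + i)
        = real (Suc m - i) * real (?N choose (Suc m - i))"
    proof (cases "i \<le> m")
      case True
      have "Suc (m - i) * (?N choose Suc (m - i)) = (?N - (m - i)) * (?N choose (m - i))"
        using binomial_absorb_comp[of ?N "m - i"] binomial_absorption[of "m - i" "?N"] by (simp only:)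
      moreover have "?N - (m - i) = Suc p + i" "Suc (m - i) = Suc m - i" using True by auto
      ultimately have "(?N choose (m - i)) * (Suc p + i) = (Suc m - i) * (?N choose (Suc m - i))"
        by (simp only: mult.commute)
      then show ?thesis using True by (simp only: of_nat_mult[symmetric] if_True)
    next
      case False
      then have "i = Suc m" using i by simp
      then show ?thesis by simp
    qed
    show ?thesis
    proof (cases i)
      case 0
      then show ?thesis using a by (simp add: field_simps del: of_nat_Suc)
    next
      case (Suc j)
      have A: "(if i \<le> m then ?c i else 0) * real (Suc p + i)
         = (-1) ^ i / fact i * (real (Suc m - i) * real (?N choose (Suc m - i)))"
        unfolding a[symmetric] by simp
      have B: "?c j = - ((-1) ^ i / fact i * (real i * real (?N choose (Suc m - i))))"
        unfolding Suc by (simp add: field_simps del: of_nat_Suc)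
      have C: "real (Suc m - i) + real i = real (Suc m)" using i by simp
      have "(if i \<le> m then ?c i else 0) * real (Suc p + i) - (if i = 0 then 0 else ?c (i - 1))
         = (-1) ^ i / fact i * ((real (Suc m - i) + real i) * real (?N choose (Suc m - i)))"
        using A B Suc by (simp add: algebra_simps)
      then show ?thesis unfolding C by simp
    qed
  qed
  have "(real (Suc p) - t) * lag (Suc p) m t + t * (case m of 0 \<Rightarrow> 0 | Suc k \<Rightarrow> - lag (Suc (Suc p)) k t)
    = (\<Sum>i\<le>Suc m. ((if i \<le> m then ?c i else 0) * real (Suc p + i) - (if i = 0 then 0 else ?c (i - 1))) * t ^ i)"
    using 1 2 by (simp only: left_diff_distrib sum_subtractf)
  also have "\<dots> = (\<Sum>i\<le>Suc m. real (Suc m) * ((-1) ^ i * real ((Suc m + p) choose (Suc m - i)) / fact i) * t ^ i)"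
    by (intro sum.cong refl arg_cong2[where f="(*)"] coeff) simp
  also have "\<dots> = real (Suc m) * lag p (Suc m) t"
    unfolding lag_def sum_distrib_left by (intro sum.cong) (auto simp: algebra_simps)
  finally show ?thesis .
qed

text \<open>
  One step of Rodrigues' formula: differentiating lowers the parameter and raises the
  degree, so that \<open>e^(-t) L_n(t)\<close> becomes a higher derivative of a function
  with a zero of high order at \<open>0\<close>.
\<close>

lemma has_real_derivative_lag_weighted:
  "((\<lambda>t. t ^ Suc p * exp (- t) * lag (Suc p) m t) has_real_derivative
     real (Suc m) * (t ^ p * exp (- t) * lag p (Suc m) t)) (at t)"
proof -
  define d where "d = (case m of 0 \<Rightarrow> 0 | Suc k \<Rightarrow> - lag (Suc (Suc p)) k t)"
  have "(lag (Suc p) m has_real_derivative d) (at t)"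
    unfolding d_def by (cases m) (auto intro: has_real_derivative_lag has_real_derivative_lag_0)
  then have "((\<lambda>t. t ^ Suc p * exp (- t) * lag (Suc p) m t) has_real_derivative
      real (Suc p) * t ^ p * exp (- t) * lag (Suc p) m t - t ^ Suc p * exp (- t) * lag (Suc p) m t
       + t ^ Suc p * exp (- t) * d) (at t)"
    by - (rule derivative_eq_intros refl | assumption | simp add: algebra_simps del: of_nat_Suc)+
  moreover have "real (Suc p) * t ^ p * exp (- t) * lag (Suc p) m t - t ^ Suc p * exp (- t) * lag (Suc p) m t
       + t ^ Suc p * exp (- t) * d = t ^ p * exp (- t) * ((real (Suc p) - t) * lag (Suc p) m t + t * d)"
    by (simp add: algebra_simps del: of_nat_Suc)
  ultimately have "((\<lambda>t. t ^ Suc p * exp (- t) * lag (Suc p) m t) has_real_derivative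
      t ^ p * exp (- t) * ((real (Suc p) - t) * lag (Suc p) m t + t * d)) (at t)"
    by (simp only:)
  then show ?thesis unfolding d_def lag_contiguous by (simp only: mult.left_commute)
qed

lemma deriv_iter_exp_power:
  "m \<le> n \<Longrightarrow> (deriv ^^ m) (\<lambda>s::real. exp (- s) * s ^ n)
      = (\<lambda>t. fact m * (t ^ (n - m) * exp (- t) * lag (n - m) m t))"
proof (induction m)
  case 0
  then show ?case by (simp add: mult.commute)
next
  case (Suc m)
  then obtain p where p: "n - m = Suc p" "n - Suc m = p" by (metis Suc_diff_Suc Suc_le_lessD)
  have "(deriv ^^ Suc m) (\<lambda>s::real. exp (- s) * s ^ n)
      = deriv (\<lambda>t. fact m * (t ^ Suc p * exp (- t) * lag (Suc p) m t))"
    using Suc p by simp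
  also have "\<dots> = (\<lambda>t. fact m * (real (Suc m) * (t ^ p * exp (- t) * lag p (Suc m) t)))"
    by (intro ext DERIV_imp_deriv DERIV_cmult has_real_derivative_lag_weighted)
  finally show ?case using p by (simp add: algebra_simps)
qed

lemma laguerre_poly_eq_lag: "laguerre_poly n t = lag 0 n t"
  unfolding laguerre_poly_def by (subst deriv_iter_exp_power) (auto simp flip: exp_add)

section \<open>Generating function and pointwise bounds\<close>

lemma sums_inverse_power_one_minus:
  fixes w :: complex
  assumes "norm w < 1"
  shows "(\<lambda>k. of_nat ((p + k) choose k) * w ^ k) sums (1 / (1 - w) ^ Suc p)"
proof -
  have "(\<lambda>k. ((- of_nat (Suc p)) gchoose k) * (- w) ^ k) sums ((1 + (- w)) powr (- of_nat (Suc p)))"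
    using assms by (intro gen_binomial_complex) auto
  moreover have "((- of_nat (Suc p)) gchoose k) * (- w) ^ k = of_nat ((p + k) choose k) * w ^ k" for k
  proof -
    have "((- of_nat (Suc p)) gchoose k) = (- 1) ^ k * (of_nat ((p + k) choose k) :: complex)"
      by (subst gbinomial_minus) (simp add: binomial_gbinomial add.commute)
    then show ?thesis by (cases "even k") auto
  qed
  ultimately have "(\<lambda>k. of_nat ((p + k) choose k) * w ^ k) sums ((1 + (- w)) powr (- of_nat (Suc p)))"
    by (simp only:)
  moreover have "1 + - w \<noteq> 0" using assms by (auto simp: add_eq_0_iff)
  then have "(1 + (- w)) powr (- of_nat (Suc p)) = 1 / (1 - w) ^ Suc p"
    by (simp add: powr_minus powr_nat' inverse_eq_divide del: of_nat_Suc)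
  ultimately show ?thesis by (simp only:)
qed

lemma sums_inverse_power_one_minus_real:
  fixes x :: real
  assumes "\<bar>x\<bar> < 1"
  shows "(\<lambda>k. real ((p + k) choose k) * x ^ k) sums (1 / (1 - x) ^ Suc p)"
proof -
  have "(\<lambda>k. complex_of_real (real ((p + k) choose k) * x ^ k)) sums complex_of_real (1 / (1 - x) ^ Suc p)"
    using sums_inverse_power_one_minus[of "of_real x" p] assms by simp
  then show ?thesis by (simp only: sums_of_real_iff)
qed

text \<open>
  Expand \<open>exp (-tw/(1-w)) / (1-w)^(p+1)\<close> in powers of \<open>t\<close>, and
  each \<open>w^i / (1-w)^(p+i+1)\<close> in powers of \<open>w\<close>; collecting the
  terms of total degree \<open>m\<close> in the absolutely convergent double series gives
  the coefficients of \<open>L_m^(p)\<close>.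
\<close>

lemma sums_lag_generating_function:
  fixes w :: complex
  assumes w: "norm w < 1"
  shows "(\<lambda>m. complex_of_real (lag p m t) * w ^ m) sums
           (exp (- (of_real t * w / (1 - w))) / (1 - w) ^ Suc p)"
proof -
  define f :: "nat \<times> nat \<Rightarrow> complex" where "f = (\<lambda>(i, k).
     ((- of_real t * w) ^ i / fact i) * (of_nat ((p + i + k) choose k) * w ^ k))"
  have w1: "1 - w \<noteq> 0" using w by auto
  have nf: "norm (f (i, k)) = (\<bar>t\<bar> * norm w) ^ i / fact i * (real ((p + i + k) choose k) * norm w ^ k)" for i k
    by (simp add: f_def norm_mult norm_divide norm_power)
  have inner_norm: "((\<lambda>k. norm (f (i, k))) has_sum
      ((\<bar>t\<bar> * norm w) ^ i / fact i * (1 / (1 - norm w) ^ Suc (p + i)))) UNIV" for i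
    unfolding nf using w
    by (intro sums_nonneg_imp_has_sum sums_mult sums_inverse_power_one_minus_real) auto
  have abs: "(\<lambda>x. norm (f x)) summable_on (UNIV \<times> UNIV)"
    unfolding Infinite_Sum.abs_summable_on_Sigma_iff
  proof (intro conjI ballI)
    fix i show "(\<lambda>y. norm (f (i, y))) summable_on UNIV"
      using inner_norm[of i] by (auto simp: summable_on_def)
  next
    have "infsum (\<lambda>y. norm (f (i, y))) UNIV =
        1 / (1 - norm w) ^ Suc p * (inverse (fact i) * (\<bar>t\<bar> * norm w / (1 - norm w)) ^ i)" for i
      using infsumI[OF inner_norm[of i]]
      by (simp add: power_add power_divide field_simps)
    moreover have "(\<lambda>i. 1 / (1 - norm w) ^ Suc p * (inverse (fact i) * (\<bar>t\<bar> * norm w / (1 - norm w)) ^ i)) summable_on UNIV"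
      using w by (intro summable_nonneg_imp_summable_on summable_mult summable_exp) auto
    ultimately show "(\<lambda>i. norm (infsum (\<lambda>y. norm (f (i, y))) UNIV)) summable_on UNIV"
      using w by simp
  qed
  then obtain S where S: "(f has_sum S) (UNIV \<times> UNIV)"
    using abs_summable_summable[OF abs] unfolding summable_on_def by blast
  have "((\<lambda>k. f (i, k)) has_sum ((- of_real t * w) ^ i / fact i * (1 / (1 - w) ^ Suc (p + i)))) UNIV" for i
  proof (rule norm_summable_imp_has_sum)
    show "summable (\<lambda>k. norm (f (i, k)))"
      using inner_norm[of i] by (auto dest: has_sum_imp_sums simp: sums_iff)
    show "(\<lambda>k. f (i, k)) sums ((- of_real t * w) ^ i / fact i * (1 / (1 - w) ^ Suc (p + i)))"
      unfolding f_def prod.case by (intro sums_mult sums_inverse_power_one_minus w)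
  qed
  from has_sum_SigmaD[OF S this]
  have "(\<lambda>i. (- of_real t * w) ^ i / fact i * (1 / (1 - w) ^ Suc (p + i))) sums S"
    by (rule has_sum_imp_sums)
  moreover have "(\<lambda>i. (1 / (1 - w) ^ Suc p) * ((- (of_real t * w / (1 - w))) ^ i /\<^sub>R fact i))
     sums ((1 / (1 - w) ^ Suc p) * exp (- (of_real t * w / (1 - w))))"
    by (intro sums_mult exp_converges)
  moreover have "(- of_real t * w) ^ i / fact i * (1 / (1 - w) ^ Suc (p + i))
     = (1 / (1 - w) ^ Suc p) * ((- (of_real t * w / (1 - w))) ^ i /\<^sub>R fact i)" for i
  proof -
    have "(- (of_real t * w / (1 - w))) ^ i = (- of_real t * w) ^ i / (1 - w) ^ i"
      by (simp add: power_divide[symmetric])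
    then show ?thesis by (simp add: power_add scaleR_conv_of_real field_simps)
  qed
  ultimately have S_eq: "S = exp (- (of_real t * w / (1 - w))) / (1 - w) ^ Suc p"
    by (metis (no_types, lifting) sums_cong sums_unique2 mult.commute times_divide_eq_right mult_1_right)
  (* Reordering of the double series by the total degree m. *)
  have bij: "bij_betw (\<lambda>(m, i). (i, m - i)) (SIGMA m:UNIV. {..m}) (UNIV \<times> (UNIV :: nat set))"
    by (rule bij_betwI[where g = "\<lambda>(i, k). (i + k, i)"]) auto
  have "((\<lambda>(m, i). f (i, m - i)) has_sum S) (SIGMA m:UNIV. {..m})"
    using S has_sum_reindex_bij_betw[OF bij, of f S] by (simp add: case_prod_unfold)
  from has_sum_SigmaD[OF this, of "\<lambda>m. \<Sum>i\<le>m. f (i, m - i)"]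
  have "(\<lambda>m. \<Sum>i\<le>m. f (i, m - i)) sums S"
    by (auto intro!: has_sum_imp_sums)
  moreover have "(\<Sum>i\<le>m. f (i, m - i)) = complex_of_real (lag p m t) * w ^ m" for m
  proof -
    have "f (i, m - i) = complex_of_real ((-1) ^ i * real ((m + p) choose (m - i)) / fact i * t ^ i) * w ^ m"
      if "i \<le> m" for i
    proof -
      have "(- complex_of_real t) ^ i = complex_of_real ((-1) ^ i * t ^ i)"
        unfolding power_minus[of t i, symmetric] by simp
      moreover have "w ^ i * w ^ (m - i) = w ^ m" using that by (simp flip: power_add)
      ultimately have "(- of_real t * w) ^ i * w ^ (m - i) = complex_of_real ((-1) ^ i * t ^ i) * w ^ m"
        unfolding power_mult_distrib mult.assoc by (simp only:)
      moreover have "p + i + (m - i) = m + p" using that by simp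
      ultimately show ?thesis by (simp add: f_def field_simps)
    qed
    then show ?thesis by (simp add: lag_def sum_distrib_right)
  qed
  ultimately show ?thesis by (simp add: S_eq)
qed

text \<open>
  Cauchy's estimate on the circle of radius \<open>r\<close>.
\<close>

lemma power_series_coeff_bound:
  fixes a :: "nat \<Rightarrow> complex"
  assumes sums: "\<And>w. norm w < 1 \<Longrightarrow> (\<lambda>m. a m * w ^ m) sums h w"
    and r: "0 < r" "r < 1" and B: "\<And>w. norm w = r \<Longrightarrow> norm (h w) \<le> B"
  shows "norm (a m) * r ^ m \<le> B"
proof -
  have hol: "h holomorphic_on ball 0 1"
    by (rule power_series_holomorphic[of _ _ a]) (use sums in auto)
  have "h has_fps_expansion Abs_fps a"
    by (intro has_fps_expansionI eventually_mono[OF eventually_nhds_in_open[of "ball 0 1"]])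
       (auto intro: sums)
  from fps_nth_fps_expansion[OF this, of m] have a: "(deriv ^^ m) h 0 = fact m * a m"
    by (simp add: field_simps)
  have "norm ((deriv ^^ m) h 0) \<le> fact m * B / r ^ m"
    using r by (intro Cauchy_inequality holomorphic_on_subset[OF hol]
      holomorphic_on_imp_continuous_on[OF holomorphic_on_subset[OF hol]] B) auto
  then show ?thesis using r by (simp add: a norm_mult field_simps)
qed

lemma sqrt_power_exp_le:
  assumes "0 \<le> u" "0 < s"
  shows "sqrt u ^ q * exp (- (s * u / 2)) \<le> sqrt (real q / s) ^ q"
proof (cases "q = 0")
  case False
  have "s * u / real q \<le> exp (s * u / real q)"
    using exp_ge_add_one_self[of "s * u / real q"] by linarith
  then have "(s * u / real q) ^ q \<le> exp (s * u / real q) ^ q"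
    using assms by (intro power_mono) auto
  also have "\<dots> = exp (s * u)" using False by (simp flip: exp_of_nat_mult)
  finally have "u ^ q * exp (- (s * u)) \<le> (real q / s) ^ q"
    using assms False by (simp add: power_divide power_mult_distrib exp_minus field_simps)
  then have "sqrt (u ^ q * exp (- (s * u))) \<le> sqrt ((real q / s) ^ q)" by simp
  moreover have "sqrt (exp (- (s * u))) = exp (- (s * u / 2))"
    using exp_double[of "- (s * u / 2)"] by (intro real_sqrt_unique) auto
  ultimately show ?thesis by (simp add: real_sqrt_mult real_sqrt_power)
qed (use assms in auto)

text \<open>
  The factor \<open>e^(-t/2)\<close> of the Laguerre function completes
  \<open>w/(1-w)\<close> to \<open>(1+w)/(2(1-w))\<close>, whose real part \<open>(1-|w|^2)
  / (2|1-w|^2)\<close> is positive on the unit disc.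
\<close>

lemma norm_lag_generating_function:
  fixes w :: complex
  assumes "w \<noteq> 1"
  shows "norm (exp (- (of_real t * w / (1 - w))) / (1 - w) ^ Suc p) * exp (- t / 2)
    = exp (- ((1 - (norm w)\<^sup>2) * (t / (norm (1 - w))\<^sup>2) / 2)) / norm (1 - w) ^ Suc p"
proof -
  have nz: "1 - w \<noteq> 0" "(norm (1 - w))\<^sup>2 \<noteq> 0" using assms by auto
  have "w / (1 - w) + 1 / 2 = (1 + w) / (1 - w) / 2" using nz by (simp add: field_simps)
  moreover have "Re ((1 + w) / (1 - w)) = (1 - (norm w)\<^sup>2) / (norm (1 - w))\<^sup>2"
    by (simp add: Re_divide cmod_power2) (simp add: power2_eq_square algebra_simps)
  ultimately have "Re (w / (1 - w)) + 1 / 2 = (1 - (norm w)\<^sup>2) / (norm (1 - w))\<^sup>2 / 2"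
    by (metis Re_divide_numeral plus_complex.sel(1) one_complex.sel(1))
  then have R: "Re (w / (1 - w)) = (1 - (norm w)\<^sup>2) / (norm (1 - w))\<^sup>2 / 2 - 1 / 2" by simp
  have "norm (exp (- (of_real t * w / (1 - w)))) = exp (- (t * Re (w / (1 - w))))"
    by (simp add: norm_exp_eq_Re flip: times_divide_eq_right del: Re_divide)
  also have "\<dots> * exp (- t / 2) = exp (- ((1 - (norm w)\<^sup>2) * (t / (norm (1 - w))\<^sup>2) / 2))"
    unfolding R exp_add[symmetric] by (rule arg_cong[of _ _ exp]) (simp add: algebra_simps)
  finally show ?thesis by (simp add: norm_divide norm_power norm_mult)
qed

lemma lag_coeff_bound:
  assumes "0 < r" "r < 1"
    and "\<And>w::complex. norm w = r \<Longrightarrow> c * (exp (- ((1 - r\<^sup>2) * (t / (norm (1 - w))\<^sup>2) / 2)) / norm (1 - w) ^ Suc p) \<le> B"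
    and c: "c \<ge> 0"
  shows "c * (exp (- t / 2) * \<bar>lag p m t\<bar>) * r ^ m \<le> B"
proof -
  have "norm (complex_of_real (c * exp (- t / 2)) * complex_of_real (lag p m t)) * r ^ m \<le> B"
  proof (rule power_series_coeff_bound)
    fix w :: complex assume "norm w < 1"
    then show "(\<lambda>m. complex_of_real (c * exp (- t / 2)) * complex_of_real (lag p m t) * w ^ m)
      sums (complex_of_real (c * exp (- t / 2)) * (exp (- (of_real t * w / (1 - w))) / (1 - w) ^ Suc p))"
      unfolding mult.assoc by (intro sums_mult sums_lag_generating_function)
  next
    fix w :: complex assume w: "norm w = r"
    then have "w \<noteq> 1" using assms by auto
    have "norm (complex_of_real (c * exp (- t / 2)) * (exp (- (of_real t * w / (1 - w))) / (1 - w) ^ Suc p))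
       = c * (norm (exp (- (of_real t * w / (1 - w))) / (1 - w) ^ Suc p) * exp (- t / 2))"
      using c by (simp only: norm_mult norm_of_real) (simp add: algebra_simps)
    also have "\<dots> \<le> B"
      unfolding norm_lag_generating_function[OF \<open>w \<noteq> 1\<close>] w using assms(3)[OF w] .
    finally show "norm (complex_of_real (c * exp (- t / 2)) * (exp (- (of_real t * w / (1 - w))) / (1 - w) ^ Suc p)) \<le> B" .
  qed (use assms in auto)
  then show ?thesis using c by (simp add: norm_mult abs_mult algebra_simps)
qed

text \<open>
  For the radius \<open>r = (m+1)/(m+q+2)\<close> the factor \<open>r^(-m)\<close> from
  Cauchy's estimate stays bounded in \<open>m\<close>.
\<close>

lemma inverse_ratio_power_le_exp:
  "1 \<le> exp (real (q + 1)) * (real (m + 1) / real (m + q + 2)) ^ m"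
proof -
  have "(1 + real (q + 1) / real (m + 1)) ^ m \<le> exp (real (q + 1) / real (m + 1)) ^ m"
    by (intro power_mono exp_ge_add_one_self) auto
  also have "\<dots> = exp (real m * (real (q + 1) / real (m + 1)))" by (simp flip: exp_of_nat_mult)
  also have "\<dots> \<le> exp (real (q + 1))"
    by (subst exp_le_cancel_iff) (simp add: field_simps)
  finally have "(1 + real (q + 1) / real (m + 1)) ^ m \<le> exp (real (q + 1))" .
  moreover have "1 + real (q + 1) / real (m + 1) = inverse (real (m + 1) / real (m + q + 2))"
    by (simp add: field_simps)
  ultimately have "inverse ((real (m + 1) / real (m + q + 2)) ^ m) \<le> exp (real (q + 1))"
    by (simp only: power_inverse)
  moreover have "(real (m + 1) / real (m + q + 2)) ^ m > 0" by simp
  ultimately show ?thesis by (simp add: field_simps)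
qed

text \<open>
  Cauchy's estimate for the generating function at radius \<open>r =
  (m+1)/(m+p+k+2)\<close>. With \<open>\<rho> = |1-w|\<close> and \<open>u =
  t/\<rho>^2\<close> the weight is \<open>\<rho>^(p+k) u^((p+k)/2)\<close>: the power
  \<open>\<rho>^p\<close> cancels the denominator of the generating function up to
  \<open>1/\<rho> \<le> 1/(1-r)\<close>, the power \<open>\<rho>^k\<close> is at most
  \<open>2^k\<close>, and the power of \<open>u\<close> is absorbed by the exponential decay
  in \<open>u\<close>. The resulting growth in \<open>m\<close>, with exponent
  \<open>(p+k)/2 + 1\<close>, is what the space \<open>G_space\<close> with its exponents
  \<open>\<alpha>/2\<close> requires.
\<close>

lemma lag_weighted_bound:
  assumes t: "0 \<le> t"
  shows "sqrt t ^ (p + k) * (exp (- t / 2) * \<bar>lag p m t\<bar>)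
     \<le> 2 ^ k * exp (real (p + k + 1)) * sqrt (real (m + p + k + 2)) ^ (p + k + 2)"
proof -
  define q where "q = p + k"
  define N where "N = real (m + q + 2)"
  define r where "r = real (m + 1) / N"
  have N: "N > 0" by (simp add: N_def)
  have r: "0 < r" "r < 1" by (auto simp: r_def N_def)
  have r1: "1 - r = real (q + 1) / N" using N by (simp add: r_def N_def field_simps)
  have "sqrt t ^ q * (exp (- t / 2) * \<bar>lag p m t\<bar>) * r ^ m \<le> 2 ^ k * sqrt N ^ (q + 2)"
  proof (rule lag_coeff_bound)
    fix w :: complex assume w: "norm w = r"
    define \<rho> where "\<rho> = norm (1 - w)"
    define u where "u = t / \<rho>\<^sup>2"
    have \<rho>: "1 - r \<le> \<rho>" "\<rho> \<le> 2"
      using norm_triangle_ineq2[of 1 w] norm_triangle_ineq4[of 1 w] w r by (auto simp: \<rho>_def)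
    have \<rho>0: "\<rho> > 0" using \<rho> r by linarith
    have u: "u \<ge> 0" using t by (simp add: u_def)
    have "sqrt t = \<rho> * sqrt u" using \<rho>0 by (simp add: u_def real_sqrt_divide)
    then have tq: "sqrt t ^ q = \<rho> ^ p * \<rho> ^ k * sqrt u ^ q" by (simp add: power_mult_distrib q_def power_add)
    have s: "1 - r \<le> 1 - r\<^sup>2" using r by (simp add: power2_eq_square mult_left_le)
    have "sqrt u ^ q * exp (- ((1 - r\<^sup>2) * u / 2)) \<le> sqrt u ^ q * exp (- ((1 - r) * u / 2))"
      using s u by (intro mult_left_mono) (auto intro: mult_right_mono)
    also have "\<dots> \<le> sqrt (real q / (1 - r)) ^ q" using u r by (intro sqrt_power_exp_le) auto
    also have "\<dots> \<le> sqrt N ^ q"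
    proof (intro power_mono real_sqrt_le_mono)
      show "real q / (1 - r) \<le> N" unfolding r1 using N by (simp add: field_simps)
    qed (use r in auto)
    finally have 1: "sqrt u ^ q * exp (- ((1 - r\<^sup>2) * u / 2)) \<le> sqrt N ^ q" .
    have "1 / \<rho> \<le> 1 / (1 - r)" using \<rho> r by (intro divide_left_mono) auto
    also have "\<dots> \<le> N" unfolding r1 using N by (simp add: field_simps)
    finally have 2: "1 / \<rho> \<le> sqrt N ^ 2" using N by simp
    have 3: "\<rho> ^ k \<le> 2 ^ k" using \<rho> \<rho>0 by (intro power_mono) auto
    have "sqrt t ^ q * (exp (- ((1 - r\<^sup>2) * u / 2)) / \<rho> ^ Suc p)
      = \<rho> ^ k * ((sqrt u ^ q * exp (- ((1 - r\<^sup>2) * u / 2))) * (1 / \<rho>))"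
      unfolding tq using \<rho>0 by (simp add: field_simps)
    also have "\<dots> \<le> 2 ^ k * (sqrt N ^ q * sqrt N ^ 2)"
      using 1 2 3 \<rho>0 u N by (intro mult_mono) auto
    finally show "sqrt t ^ q * (exp (- ((1 - r\<^sup>2) * (t / (norm (1 - w))\<^sup>2) / 2)) / norm (1 - w) ^ Suc p)
        \<le> 2 ^ k * sqrt N ^ (q + 2)"
      by (simp only: \<rho>_def u_def power_add)
  qed (use r t in auto)
  moreover have "0 \<le> sqrt t ^ q * (exp (- t / 2) * \<bar>lag p m t\<bar>)" (is "0 \<le> ?X") using t by simp
  moreover have "1 \<le> exp (real (q + 1)) * r ^ m"
    using inverse_ratio_power_le_exp[of q m] by (simp add: r_def N_def)
  ultimately have "?X * 1 \<le> ?X * (exp (real (q + 1)) * r ^ m)" "?X * r ^ m \<le> 2 ^ k * sqrt N ^ (q + 2)"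
    by (blast intro: mult_left_mono)+
  then have "?X \<le> exp (real (q + 1)) * (?X * r ^ m)" by (simp add: algebra_simps)
  also have "\<dots> \<le> exp (real (q + 1)) * (2 ^ k * sqrt N ^ (q + 2))"
    using \<open>?X * r ^ m \<le> _\<close> by (intro mult_left_mono) auto
  finally show ?thesis by (simp add: q_def N_def algebra_simps)
qed

text \<open>
  The same argument with the radius \<open>(m+1)/(m+2)\<close>, for the case without a
  weight.
\<close>

lemma lag_exp_bound:
  assumes t: "0 \<le> t"
  shows "exp (- t / 2) * \<bar>lag p m t\<bar> \<le> exp 1 * real (m + 2) ^ Suc p"
proof -
  define r where "r = real (m + 1) / real (m + 2)"
  have r: "0 < r" "r < 1" "1 - r = 1 / real (m + 2)" by (auto simp: r_def field_simps)
  have "1 * (exp (- t / 2) * \<bar>lag p m t\<bar>) * r ^ m \<le> real (m + 2) ^ Suc p"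
  proof (rule lag_coeff_bound)
    fix w :: complex assume w: "norm w = r"
    define \<rho> where "\<rho> = norm (1 - w)"
    have \<rho>: "1 - r \<le> \<rho>" using norm_triangle_ineq2[of 1 w] w by (auto simp: \<rho>_def)
    have \<rho>0: "\<rho> > 0" using \<rho> r by linarith
    have "1 / \<rho> \<le> 1 / (1 - r)" using \<rho> r by (intro divide_left_mono) auto
    then have "(1 / \<rho>) ^ Suc p \<le> real (m + 2) ^ Suc p"
      using \<rho>0 r by (intro power_mono) auto
    moreover have "exp (- ((1 - r\<^sup>2) * (t / \<rho>\<^sup>2) / 2)) \<le> 1"
      using t r by (simp add: power_le_one)
    ultimately have "exp (- ((1 - r\<^sup>2) * (t / \<rho>\<^sup>2) / 2)) * (1 / \<rho>) ^ Suc p \<le> 1 * real (m + 2) ^ Suc p"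
      using \<rho>0 by (intro mult_mono) auto
    then show "1 * (exp (- ((1 - r\<^sup>2) * (t / (norm (1 - w))\<^sup>2) / 2)) / norm (1 - w) ^ Suc p) \<le> real (m + 2) ^ Suc p"
      by (simp only: \<rho>_def power_one_over mult_1 divide_inverse power_inverse)
  qed (use r in auto)
  moreover have "1 \<le> exp 1 * r ^ m"
    using inverse_ratio_power_le_exp[of 0 m] by (simp add: r_def)
  ultimately have "(exp (- t / 2) * \<bar>lag p m t\<bar>) * 1 \<le> (exp (- t / 2) * \<bar>lag p m t\<bar>) * (exp 1 * r ^ m)"
    "exp 1 * ((exp (- t / 2) * \<bar>lag p m t\<bar>) * r ^ m) \<le> exp 1 * real (m + 2) ^ Suc p"
    by (intro mult_left_mono; simp)+
  then show ?thesis by (simp add: algebra_simps)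
qed

section \<open>Derivatives of the Laguerre functions\<close>

text \<open>
  \<open>lagd p j n\<close> is the \<open>p\<close>-th derivative of \<open>(-1)^j
  L_(n-j)^(j)(t) e^(-t/2)\<close>; that function is \<open>D^j L_n(t)\<close> times
  \<open>e^(-t/2)\<close>. In particular \<open>lagd p 0 n\<close> is the
  \<open>p\<close>-th derivative of the Laguerre function. The parameter \<open>j\<close>
  makes the recursion on \<open>p\<close> close.
\<close>

primrec lagd :: "nat \<Rightarrow> nat \<Rightarrow> nat \<Rightarrow> real \<Rightarrow> real" where
  "lagd 0 j n t = (if j \<le> n then (-1) ^ j * lag j (n - j) t * exp (- t / 2) else 0)"
| "lagd (Suc p) j n t = lagd p (Suc j) n t - lagd p j n t / 2"

lemma has_real_derivative_lagd:
  "(lagd p j n has_real_derivative lagd (Suc p) j n t) (at t)"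
proof (induction p arbitrary: j)
  case 0
  show ?case
  proof (cases "j < n")
    case True
    then obtain m where m: "n - j = Suc m" "n - Suc j = m" by (metis Suc_diff_Suc)
    have "((\<lambda>t. (-1) ^ j * lag j (Suc m) t * exp (- t / 2)) has_real_derivative
        (-1) ^ j * (- lag (Suc j) m t) * exp (- t / 2) + (-1) ^ j * lag j (Suc m) t * (exp (- t / 2) * (- 1 / 2))) (at t)"
      by (rule derivative_eq_intros has_real_derivative_lag refl | simp)+
    moreover have "lagd 0 j n = (\<lambda>t. (-1) ^ j * lag j (Suc m) t * exp (- t / 2))"
      using True m by (auto simp: fun_eq_iff)
    ultimately show ?thesis using True m by (simp add: algebra_simps)
  next
    case False
    have "((\<lambda>t. (-1) ^ j * exp (- t / 2)) has_real_derivative (-1) ^ j * (exp (- t / 2) * (- 1 / 2))) (at t)"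
      by (rule derivative_eq_intros refl | simp)+
    moreover have "lagd 0 j n = (if j = n then (\<lambda>t. (-1) ^ j * exp (- t / 2)) else (\<lambda>t. 0))"
      using False by (auto simp: fun_eq_iff)
    ultimately show ?thesis using False by auto
  qed
next
  case (Suc p)
  have "lagd (Suc p) j n = (\<lambda>t. lagd p (Suc j) n t - lagd p j n t / 2)" by (simp add: fun_eq_iff)
  moreover have "((\<lambda>t. lagd p (Suc j) n t - lagd p j n t / 2) has_real_derivative
     lagd (Suc p) (Suc j) n t - lagd (Suc p) j n t / 2) (at t)"
    by (intro DERIV_diff DERIV_cdivide Suc)
  ultimately show ?case by (simp only: lagd.simps(2)[of "Suc p"])
qed

lemma three_halves: "x * b + x * b / 2 = 3 / 2 * x * (b :: real)"
  by simp

text \<open>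
  Each differentiation produces two terms with coefficients \<open>1\<close> and
  \<open>1/2\<close>, whence the factor \<open>(3/2)^p\<close>.
\<close>

lemma lagd_weighted_bound:
  assumes t: "0 \<le> t" and "p + j \<le> q"
  shows "sqrt t ^ q * \<bar>lagd p j n t\<bar>
     \<le> (3 / 2) ^ p * (2 ^ q * exp (real (q + 1)) * sqrt (real (n + q + 2)) ^ (q + 2))"
  using assms(2)
proof (induction p arbitrary: j)
  case 0
  show ?case
  proof (cases "j \<le> n")
    case True
    define k where "k = q - j"
    have q: "q = j + k" using 0 by (simp add: k_def)
    have "sqrt t ^ q * \<bar>lagd 0 j n t\<bar> = sqrt t ^ (j + k) * (exp (- t / 2) * \<bar>lag j (n - j) t\<bar>)"
      using True by (simp add: abs_mult q)
    also have "\<dots> \<le> 2 ^ k * exp (real (j + k + 1)) * sqrt (real (n - j + j + k + 2)) ^ (j + k + 2)"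
      by (rule lag_weighted_bound[OF t])
    also have "\<dots> \<le> 2 ^ q * exp (real (j + k + 1)) * sqrt (real (n + q + 2)) ^ (j + k + 2)"
      using True q by (intro mult_mono power_mono power_increasing real_sqrt_le_mono) auto
    finally show ?thesis by (simp add: q)
  qed simp
next
  case (Suc p)
  let ?B = "2 ^ q * exp (real (q + 1)) * sqrt (real (n + q + 2)) ^ (q + 2)"
  have "\<bar>lagd (Suc p) j n t\<bar> \<le> \<bar>lagd p (Suc j) n t\<bar> + \<bar>lagd p j n t\<bar> / 2" by simp
  then have "sqrt t ^ q * \<bar>lagd (Suc p) j n t\<bar> \<le> sqrt t ^ q * (\<bar>lagd p (Suc j) n t\<bar> + \<bar>lagd p j n t\<bar> / 2)"
    using t by (intro mult_left_mono) auto
  also have "\<dots> = sqrt t ^ q * \<bar>lagd p (Suc j) n t\<bar> + sqrt t ^ q * \<bar>lagd p j n t\<bar> / 2"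
    by (simp add: algebra_simps)
  also have "\<dots> \<le> (3 / 2) ^ p * ?B + (3 / 2) ^ p * ?B / 2"
    using Suc.prems by (intro add_mono divide_right_mono Suc.IH) auto
  also have "\<dots> = (3 / 2) ^ Suc p * ?B" by (simp only: power_Suc three_halves)
  finally show ?case .
qed

lemma lagd_bound:
  assumes t: "0 \<le> t"
  shows "\<bar>lagd p j n t\<bar> \<le> (3 / 2) ^ p * (exp 1 * real (n + 2) ^ Suc (p + j))"
proof (induction p arbitrary: j)
  case 0
  show ?case
  proof (cases "j \<le> n")
    case True
    have "\<bar>lagd 0 j n t\<bar> = exp (- t / 2) * \<bar>lag j (n - j) t\<bar>"
      using True by (simp add: abs_mult)
    also have "\<dots> \<le> exp 1 * real (n - j + 2) ^ Suc j" by (rule lag_exp_bound[OF t])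
    also have "\<dots> \<le> exp 1 * real (n + 2) ^ Suc j" by (intro mult_left_mono power_mono) auto
    finally show ?thesis by simp
  qed simp
next
  case (Suc p)
  let ?B = "exp 1 * real (n + 2) ^ Suc (Suc p + j)"
  have "\<bar>lagd (Suc p) j n t\<bar> \<le> \<bar>lagd p (Suc j) n t\<bar> + \<bar>lagd p j n t\<bar> / 2" by simp
  also have "\<dots> \<le> (3 / 2) ^ p * (exp 1 * real (n + 2) ^ Suc (p + Suc j)) + (3 / 2) ^ p * (exp 1 * real (n + 2) ^ Suc (p + j)) / 2"
    by (intro add_mono divide_right_mono Suc.IH) auto
  also have "\<dots> \<le> (3 / 2) ^ p * ?B + (3 / 2) ^ p * ?B / 2"
    by (intro add_mono divide_right_mono mult_left_mono power_increasing) auto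
  also have "\<dots> = (3 / 2) ^ Suc p * ?B" by (simp only: power_Suc three_halves)
  finally show ?case .
qed

section \<open>Orthogonality of the Laguerre polynomials\<close>

lemma power_exp_bounded:
  fixes c :: real assumes "c > 0"
  shows "\<exists>C\<ge>0. \<forall>t\<ge>0. (1 + t) ^ N * exp (- c * t) \<le> C"
proof (intro exI conjI allI impI)
  show "0 \<le> fact N * exp c / c ^ N" using assms by simp
  fix t :: real assume t: "t \<ge> 0"
  have "(c * (1 + t)) ^ N / fact N \<le> exp (c * (1 + t))"
  proof -
    have "(\<lambda>n. (c * (1 + t)) ^ n /\<^sub>R fact n) sums exp (c * (1 + t))" by (rule exp_converges)
    then have "(\<Sum>n\<in>{N}. (c * (1 + t)) ^ n /\<^sub>R fact n) \<le> exp (c * (1 + t))"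
      using sum_le_suminf[of "\<lambda>n. (c * (1 + t)) ^ n /\<^sub>R fact n" "{N}"] assms t
      by (simp add: sums_iff)
    then show ?thesis by (simp add: divide_inverse mult.commute)
  qed
  moreover have "exp (c * (1 + t)) = exp c * exp (c * t)" by (simp add: distrib_left exp_add)
  ultimately have "(1 + t) ^ N * c ^ N \<le> fact N * (exp c * exp (c * t))"
    unfolding power_mult_distrib[of c] by (simp add: field_simps)
  then show "(1 + t) ^ N * exp (- c * t) \<le> fact N * exp c / c ^ N"
    using assms by (simp add: exp_minus field_simps)
qed

lemma poly_exp_bounded:
  fixes P :: "real poly" and c :: real
  assumes "c > 0"
  shows "\<exists>C\<ge>0. \<forall>t\<ge>0. \<bar>poly P t\<bar> * exp (- c * t) \<le> C"
proof -
  obtain C where C: "C \<ge> 0" "\<And>t. t \<ge> 0 \<Longrightarrow> (1 + t) ^ degree P * exp (- c * t) \<le> C"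
    using power_exp_bounded[OF assms] by blast
  define M where "M = (\<Sum>i\<le>degree P. \<bar>coeff P i\<bar>)"
  have M: "\<bar>poly P t\<bar> \<le> M * (1 + t) ^ degree P" if "t \<ge> 0" for t
  proof -
    have "\<bar>poly P t\<bar> \<le> (\<Sum>i\<le>degree P. \<bar>coeff P i * t ^ i\<bar>)"
      unfolding poly_altdef by (rule sum_abs)
    also have "\<dots> \<le> (\<Sum>i\<le>degree P. \<bar>coeff P i\<bar> * (1 + t) ^ degree P)"
    proof (intro sum_mono)
      fix i assume "i \<in> {..degree P}"
      then have "t ^ i \<le> (1 + t) ^ degree P"
        using that by (intro order_trans[OF power_mono[of t "1 + t"] power_increasing]) auto
      then show "\<bar>coeff P i * t ^ i\<bar> \<le> \<bar>coeff P i\<bar> * (1 + t) ^ degree P"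
        using that by (simp add: abs_mult mult_left_mono)
    qed
    finally show ?thesis by (simp add: M_def sum_distrib_right)
  qed
  have "\<bar>poly P t\<bar> * exp (- c * t) \<le> M * C" if "t \<ge> 0" for t
  proof -
    have "\<bar>poly P t\<bar> * exp (- c * t) \<le> M * ((1 + t) ^ degree P * exp (- c * t))"
      using M[OF that] by (simp flip: mult.assoc)
    also have "\<dots> \<le> M * C" by (intro mult_left_mono C that) (auto simp: M_def sum_nonneg)
    finally show ?thesis .
  qed
  moreover have "M * C \<ge> 0" using C by (auto simp: M_def intro!: mult_nonneg_nonneg sum_nonneg)
  ultimately show ?thesis by blast
qed

lemma set_integrable_exp_minus:
  fixes c :: real assumes "c > 0"
  shows "set_integrable lborel {0<..} (\<lambda>t. exp (- c * t))"
proof -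
  have "(\<lambda>x. exp (- c * x)) absolutely_integrable_on {0..}"
    using assms by (intro nonnegative_absolutely_integrable_1 integrable_on_exp_minus_to_infinity) auto
  then have "set_integrable lborel {0..} (\<lambda>t. exp (- c * t))"
    unfolding set_integrable_def by (subst (asm) integrable_completion) auto
  then show ?thesis by (rule set_integrable_subset) auto
qed

lemma poly_exp_le_exp:
  fixes P :: "real poly" and c :: real
  assumes "c > 0"
  shows "\<exists>C\<ge>0. \<forall>t\<ge>0. \<bar>poly P t * exp (- c * t)\<bar> \<le> C * exp (- (c / 2) * t)"
proof -
  obtain C where C: "C \<ge> 0" "\<And>t. t \<ge> 0 \<Longrightarrow> \<bar>poly P t\<bar> * exp (- (c / 2) * t) \<le> C"
    using poly_exp_bounded[of "c / 2" P] assms by auto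
  have "\<bar>poly P t * exp (- c * t)\<bar> \<le> C * exp (- (c / 2) * t)" if "t \<ge> 0" for t
  proof -
    have "\<bar>poly P t * exp (- c * t)\<bar> = (\<bar>poly P t\<bar> * exp (- (c / 2) * t)) * exp (- (c / 2) * t)"
      by (simp add: abs_mult mult.assoc flip: exp_add)
    also have "\<dots> \<le> C * exp (- (c / 2) * t)" by (intro mult_right_mono C that) auto
    finally show ?thesis .
  qed
  then show ?thesis using C by blast
qed

lemma set_integrable_poly_exp:
  fixes P :: "real poly" and c :: real
  assumes "c > 0"
  shows "set_integrable lborel {0<..} (\<lambda>t. poly P t * exp (- c * t))"
proof -
  obtain C where C: "C \<ge> 0" "\<And>t. t \<ge> 0 \<Longrightarrow> \<bar>poly P t * exp (- c * t)\<bar> \<le> C * exp (- (c / 2) * t)"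
    using poly_exp_le_exp[OF assms] by blast
  have "set_integrable lborel {0<..} (\<lambda>t. C * exp (- (c / 2) * t))"
    using set_integrable_exp_minus[of "c / 2"] assms by (intro set_integrable_mult_right) auto
  then show ?thesis
  proof (rule set_integrable_bound)
    show "set_borel_measurable lborel {0<..} (\<lambda>t. poly P t * exp (- c * t))"
      unfolding set_borel_measurable_def
      by (intro borel_measurable_scaleR borel_measurable_indicator)
         (auto intro!: borel_measurable_continuous_onI continuous_intros)
    show "AE x in lborel. x \<in> {0<..} \<longrightarrow> norm (poly P x * exp (- c * x)) \<le> norm (C * exp (- (c / 2) * x))"
      using C by (auto intro!: AE_I2)
  qed
qed

text \<open>
  The fundamental theorem of calculus: an antiderivative that decays at infinity contributes
  only its value at \<open>0\<close>.
\<close>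

lemma integral_deriv_poly_exp:
  fixes P Q :: "real poly"
  assumes D: "\<And>t. ((\<lambda>t. poly P t * exp (- t)) has_real_derivative poly Q t * exp (- t)) (at t)"
  shows "set_lebesgue_integral lborel {0<..} (\<lambda>t. poly Q t * exp (- t)) = - poly P 0"
proof -
  have E: "einterval 0 \<infinity> = {0<..}" by (auto simp: einterval_def zero_ereal_def)
  have "(LBINT x=0..\<infinity>. poly Q x * exp (- x)) = 0 - poly P 0"
  proof (rule interval_integral_FTC_integrable)
    show "((\<lambda>t. poly P t * exp (- t)) has_vector_derivative poly Q x * exp (- x)) (at x)" for x
      using D[of x] by (simp add: has_real_derivative_iff_has_vector_derivative)
    show "isCont (\<lambda>x. poly Q x * exp (- x)) x" for x by (intro continuous_intros)
    show "set_integrable lborel (einterval 0 \<infinity>) (\<lambda>x. poly Q x * exp (- x))"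
      using set_integrable_poly_exp[of 1 Q] by (simp add: E)
    have "isCont (\<lambda>t. poly P t * exp (- t)) 0" by (intro continuous_intros)
    then have "((\<lambda>t. poly P t * exp (- t)) \<longlongrightarrow> poly P 0) (at_right 0)"
      by (simp add: isCont_def filterlim_at_split)
    then show "(((\<lambda>t. poly P t * exp (- t)) \<circ> real_of_ereal) \<longlongrightarrow> poly P 0) (at_right 0)"
      by (simp add: zero_ereal_def ereal_tendsto_simps)
    obtain C where C: "\<And>t. t \<ge> 0 \<Longrightarrow> \<bar>poly P t * exp (- t)\<bar> \<le> C * exp (- (1 / 2) * t)"
      using poly_exp_le_exp[of 1 P] by auto
    have "((\<lambda>t. poly P t * exp (- t)) \<longlongrightarrow> 0) at_top"
    proof (rule Lim_null_comparison)
      show "\<forall>\<^sub>F x in at_top. norm (poly P x * exp (- x)) \<le> C * exp (- (1 / 2) * x)"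
        using eventually_ge_at_top[of 0] by eventually_elim (use C in auto)
      show "((\<lambda>t. C * exp (- (1 / 2) * t)) \<longlongrightarrow> 0) at_top" by real_asymp
    qed
    then show "(((\<lambda>t. poly P t * exp (- t)) \<circ> real_of_ereal) \<longlongrightarrow> 0) (at_left \<infinity>)"
      by (simp add: ereal_tendsto_simps)
  qed auto
  then show ?thesis by (simp add: interval_lebesgue_integral_def E)
qed

definition lag_inner :: "nat \<Rightarrow> nat \<Rightarrow> nat \<Rightarrow> real"
  where "lag_inner p m n = set_lebesgue_integral lborel {0<..} (\<lambda>t. t ^ p * exp (- t) * lag p m t * lag p n t)"

definition lag_poly :: "nat \<Rightarrow> nat \<Rightarrow> real poly"
  where "lag_poly p m = (\<Sum>i\<le>m. monom ((-1) ^ i * real ((m + p) choose (m - i)) / fact i) i)"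

lemma poly_lag_poly: "poly (lag_poly p m) t = lag p m t"
  by (simp add: lag_poly_def lag_def poly_sum poly_monom)

lemma lag_inner_poly:
  "(\<lambda>t. t ^ p * exp (- t) * lag p m t * lag p n t)
     = (\<lambda>t. poly (monom 1 p * lag_poly p m * lag_poly p n) t * exp (- t))"
  by (simp add: poly_lag_poly poly_monom algebra_simps)

lemma lag_inner_integrable:
  "set_integrable lborel {0<..} (\<lambda>t. t ^ p * exp (- t) * lag p m t * lag p n t)"
  unfolding lag_inner_poly using set_integrable_poly_exp[of 1, simplified] .

lemma lag_inner_commute: "lag_inner p m n = lag_inner p n m"
  by (simp add: lag_inner_def mult_ac)

lemma lag_inner_Suc_0: "lag_inner p (Suc m) 0 = 0"
proof -
  have "set_lebesgue_integral lborel {0<..}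
    (\<lambda>t. poly (smult (real (Suc m)) (monom 1 p * lag_poly p (Suc m))) t * exp (- t))
    = - poly (monom 1 (Suc p) * lag_poly (Suc p) m) 0"
  proof (rule integral_deriv_poly_exp)
    fix t
    show "((\<lambda>t. poly (monom 1 (Suc p) * lag_poly (Suc p) m) t * exp (- t)) has_real_derivative
         poly (smult (real (Suc m)) (monom 1 p * lag_poly p (Suc m))) t * exp (- t)) (at t)"
      using has_real_derivative_lag_weighted[of p m t]
      by (simp add: poly_lag_poly poly_monom mult_ac del: of_nat_Suc)
  qed
  then have "real (Suc m) * lag_inner p (Suc m) 0 = 0"
    by (simp add: lag_inner_def poly_lag_poly poly_monom mult_ac flip: set_integral_mult_right del: of_nat_Suc)
  then show ?thesis by simp
qed

text \<open>
  Integration by parts: the weighted derivative formula on one factor and the derivative of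
  the Laguerre polynomial on the other lower both degrees and raise the parameter.
\<close>

lemma lag_inner_Suc_Suc: "real (Suc m) * lag_inner p (Suc m) (Suc n) = lag_inner (Suc p) m n"
proof -
  let ?f = "\<lambda>t. t ^ p * exp (- t) * lag p (Suc m) t * lag p (Suc n) t"
  let ?g = "\<lambda>t. t ^ Suc p * exp (- t) * lag (Suc p) m t * lag (Suc p) n t"
  have "set_lebesgue_integral lborel {0<..}
    (\<lambda>t. poly (smult (real (Suc m)) (monom 1 p * lag_poly p (Suc m) * lag_poly p (Suc n))
            - monom 1 (Suc p) * lag_poly (Suc p) m * lag_poly (Suc p) n) t * exp (- t))
    = - poly (monom 1 (Suc p) * lag_poly (Suc p) m * lag_poly p (Suc n)) 0"
  proof (rule integral_deriv_poly_exp)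
    fix t
    show "((\<lambda>t. poly (monom 1 (Suc p) * lag_poly (Suc p) m * lag_poly p (Suc n)) t * exp (- t)) has_real_derivative
         poly (smult (real (Suc m)) (monom 1 p * lag_poly p (Suc m) * lag_poly p (Suc n))
            - monom 1 (Suc p) * lag_poly (Suc p) m * lag_poly (Suc p) n) t * exp (- t)) (at t)"
      using DERIV_mult[OF has_real_derivative_lag_weighted[of p m t] has_real_derivative_lag[of p n t]]
      by (simp add: poly_lag_poly poly_monom mult_ac algebra_simps del: of_nat_Suc)
  qed
  then have "set_lebesgue_integral lborel {0<..} (\<lambda>t. real (Suc m) * ?f t - ?g t) = 0"
    by (simp add: poly_lag_poly poly_monom algebra_simps del: of_nat_Suc)
  moreover have "set_lebesgue_integral lborel {0<..} (\<lambda>t. real (Suc m) * ?f t - ?g t)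
     = real (Suc m) * lag_inner p (Suc m) (Suc n) - lag_inner (Suc p) m n"
    unfolding lag_inner_def
    by (subst set_integral_diff(2)) (intro set_integrable_mult_right lag_inner_integrable | simp only: set_integral_mult_right)+
  ultimately show ?thesis by simp
qed

lemma lag_inner_0_0: "lag_inner p 0 0 = fact p"
proof (induction p)
  case 0
  have "set_lebesgue_integral lborel {0<..} (\<lambda>t. poly 1 t * exp (- t)) = - poly (- 1) (0::real)"
    by (rule integral_deriv_poly_exp[of "- 1" 1]) (auto intro!: derivative_eq_intros)
  then show ?case by (simp add: lag_inner_def)
next
  case (Suc p)
  have "set_lebesgue_integral lborel {0<..} (\<lambda>t. poly (monom (real (Suc p)) p - monom 1 (Suc p)) t * exp (- t))
     = - poly (monom 1 (Suc p)) 0"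
  proof (rule integral_deriv_poly_exp)
    fix t :: real
    have 1: "((\<lambda>t. t ^ Suc p) has_real_derivative real (Suc p) * t ^ p) (at t)"
      using DERIV_pow[of "Suc p" t] by simp
    have 2: "((\<lambda>t. exp (- t)) has_real_derivative - exp (- t)) (at t)"
      by (auto intro!: derivative_eq_intros)
    show "((\<lambda>t. poly (monom 1 (Suc p)) t * exp (- t)) has_real_derivative
        poly (monom (real (Suc p)) p - monom 1 (Suc p)) t * exp (- t)) (at t)"
      using DERIV_mult[OF 1 2] by (simp add: poly_monom algebra_simps del: of_nat_Suc)
  qed
  then have "set_lebesgue_integral lborel {0<..} (\<lambda>t. real (Suc p) * (t ^ p * exp (- t) * lag p 0 t * lag p 0 t)
      - t ^ Suc p * exp (- t) * lag (Suc p) 0 t * lag (Suc p) 0 t) = 0"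
    by (simp add: poly_monom algebra_simps del: of_nat_Suc)
  then have "real (Suc p) * lag_inner p 0 0 - lag_inner (Suc p) 0 0 = 0"
    unfolding lag_inner_def
    by (subst (asm) set_integral_diff(2)) (intro set_integrable_mult_right lag_inner_integrable | simp only: set_integral_mult_right)+
  then show ?case using Suc by simp
qed

lemma lag_inner_eq: "lag_inner p m n = (if m = n then fact (m + p) / fact m else 0)"
proof (induction m arbitrary: p n)
  case 0
  then show ?case by (cases n) (auto simp: lag_inner_0_0 lag_inner_commute[of p 0] lag_inner_Suc_0)
next
  case (Suc m)
  show ?case
  proof (cases n)
    case (Suc k)
    have "lag_inner p (Suc m) (Suc k) = lag_inner (Suc p) m k / real (Suc m)"
      using lag_inner_Suc_Suc[of m p k] by (simp add: field_simps del: of_nat_Suc)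
    then show ?thesis using Suc by (simp add: Suc.IH)
  qed (simp add: lag_inner_Suc_0)
qed

section \<open>Integration over the orthant\<close>

lemma prod_axis:
  fixes F :: "real ^ 'd::finite \<Rightarrow> 'b::comm_monoid_mult"
  shows "(\<Prod>b\<in>Basis. F b) = (\<Prod>l\<in>UNIV. F (axis l 1))"
proof -
  have "bij_betw (\<lambda>l. axis l 1) (UNIV :: 'd set) (Basis :: (real ^ 'd) set)"
    by (auto simp: bij_betw_def Basis_vec_def axis_eq_axis intro!: injI)
  from prod.reindex_bij_betw[OF this, of F] show ?thesis by simp
qed

lemma lborel_integral_prod:
  fixes h :: "'d::finite \<Rightarrow> real \<Rightarrow> real"
  assumes int: "\<And>l. integrable lborel (h l)"
  shows "integrable lborel (\<lambda>t :: real ^ 'd. \<Prod>l\<in>UNIV. h l (t $ l))"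
    and "(\<integral>t. (\<Prod>l\<in>UNIV. h l (t $ l)) \<partial>(lborel :: (real ^ 'd) measure)) = (\<Prod>l\<in>UNIV. \<integral>x. h l x \<partial>lborel)"
proof -
  interpret product_sigma_finite "\<lambda>_ :: real ^ 'd. lborel :: real measure"
    by standard
  define h' :: "real ^ 'd \<Rightarrow> real \<Rightarrow> real" where "h' b = h (axis_index b)" for b
  let ?S = "\<lambda>f. \<Sum>b\<in>(Basis :: (real ^ 'd) set). f b *\<^sub>R b"
  have [measurable]: "h l \<in> borel_measurable borel" for l using int[of l] by simp
  have ax: "axis_index (axis l (1::real) :: real ^ 'd) = l" for l
    unfolding axis_index_def by (rule some_equality) (auto simp: axis_eq_axis)
  have S: "?S f $ l = f (axis l 1)" for f l
    using inner_sum_left_Basis[of "axis l 1 :: real ^ 'd" f] by (simp add: inner_axis)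
  have eq: "(\<Prod>l\<in>UNIV. h l (?S f $ l)) = (\<Prod>b\<in>(Basis :: (real ^ 'd) set). h' b (f b))" for f
    unfolding S prod_axis h'_def ax ..
  have [measurable]: "?S \<in> measurable (Pi\<^sub>M Basis (\<lambda>_. lborel)) borel"
    by measurable
  have 1: "integrable (Pi\<^sub>M Basis (\<lambda>_. lborel)) (\<lambda>f. \<Prod>b\<in>(Basis :: (real ^ 'd) set). h' b (f b))"
    by (intro product_integrable_prod) (auto simp: h'_def int)
  have 2: "(\<integral>f. (\<Prod>b\<in>(Basis :: (real ^ 'd) set). h' b (f b)) \<partial>Pi\<^sub>M Basis (\<lambda>_. lborel))
      = (\<Prod>b\<in>Basis. \<integral>x. h' b x \<partial>lborel)"
    by (intro product_integral_prod) (auto simp: h'_def int)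
  show "integrable lborel (\<lambda>t :: real ^ 'd. \<Prod>l\<in>UNIV. h l (t $ l))"
    by (subst lborel_eq, subst integrable_distr_eq) (use 1 in \<open>simp_all only: eq, measurable\<close>)
  show "(\<integral>t. (\<Prod>l\<in>UNIV. h l (t $ l)) \<partial>(lborel :: (real ^ 'd) measure)) = (\<Prod>l\<in>UNIV. \<integral>x. h l x \<partial>lborel)"
    by (subst lborel_eq, subst integral_distr) (use 2 in \<open>simp_all only: eq prod_axis h'_def ax, measurable\<close>)
qed

abbreviation orthant_measure :: "(real ^ 'd::finite) measure"
  where "orthant_measure \<equiv> lebesgue_on pos_orthant"

lemma open_pos_orthant: "open (pos_orthant :: (real ^ 'd::finite) set)"
  unfolding pos_orthant_def Collect_all_eq
  by (intro open_INT ballI open_Collect_less continuous_intros) auto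

lemma pos_orthant_sets [measurable, simp]: "pos_orthant \<in> sets borel" "pos_orthant \<in> sets lebesgue"
  using borel_open[OF open_pos_orthant] by (auto intro: sets_completionI_sets)

lemma borel_measurable_continuous_pos_orthant:
  fixes f :: "real ^ 'd::finite \<Rightarrow> 'b::{second_countable_topology,real_normed_vector}"
  assumes "continuous_on pos_orthant f"
  shows "f \<in> borel_measurable orthant_measure"
  using continuous_imp_measurable_on_sets_lebesgue[OF assms] by simp

lemma integrable_orthant_iff:
  fixes f :: "real ^ 'd::finite \<Rightarrow> 'b::{banach, second_countable_topology}"
  assumes "(\<lambda>x. indicator pos_orthant x *\<^sub>R f x) \<in> borel_measurable borel"
  shows "integrable orthant_measure f \<longleftrightarrow> integrable lborel (\<lambda>x. indicator pos_orthant x *\<^sub>R f x)"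
    and "integral\<^sup>L orthant_measure f = integral\<^sup>L lborel (\<lambda>x. indicator pos_orthant x *\<^sub>R f x)"
  using assms by (simp_all add: integrable_restrict_space integral_restrict_space integrable_completion integral_completion)

lemma integral_prod_orthant:
  fixes h :: "'d::finite \<Rightarrow> real \<Rightarrow> real"
  assumes int: "\<And>l. set_integrable lborel {0<..} (h l)"
  shows "integrable orthant_measure (\<lambda>t :: real ^ 'd. \<Prod>l\<in>UNIV. h l (t $ l))"
    and "(\<integral>t. (\<Prod>l\<in>UNIV. h l (t $ l)) \<partial>(orthant_measure :: (real ^ 'd) measure))
      = (\<Prod>l\<in>UNIV. set_lebesgue_integral lborel {0<..} (h l))"
proof -
  let ?g = "\<lambda>l x. indicator {0<..} x *\<^sub>R h l x"
  have eq: "(\<lambda>t :: real ^ 'd. indicator pos_orthant t *\<^sub>R (\<Prod>l\<in>UNIV. h l (t $ l))) = (\<lambda>t. \<Prod>l\<in>UNIV. ?g l (t $ l))"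
    by (auto simp: fun_eq_iff indicator_def pos_orthant_def intro!: prod_zero)
  have i: "integrable lborel (?g l)" for l using int[of l] by (simp add: set_integrable_def)
  have [measurable]: "?g l \<in> borel_measurable borel" for l using i[of l] by simp
  have m: "(\<lambda>t :: real ^ 'd. indicator pos_orthant t *\<^sub>R (\<Prod>l\<in>UNIV. h l (t $ l))) \<in> borel_measurable borel"
    unfolding eq by measurable
  show "integrable orthant_measure (\<lambda>t :: real ^ 'd. \<Prod>l\<in>UNIV. h l (t $ l))"
    unfolding integrable_orthant_iff(1)[OF m] eq by (rule lborel_integral_prod(1)[OF i])
  show "(\<integral>t. (\<Prod>l\<in>UNIV. h l (t $ l)) \<partial>(orthant_measure :: (real ^ 'd) measure))
      = (\<Prod>l\<in>UNIV. set_lebesgue_integral lborel {0<..} (h l))"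
    unfolding integrable_orthant_iff(2)[OF m] eq lborel_integral_prod(2)[OF i] set_lebesgue_integral_def ..
qed

lemma Cauchy_Schwarz_integral:
  fixes f h :: "'a \<Rightarrow> complex"
  assumes [measurable]: "f \<in> borel_measurable M" "h \<in> borel_measurable M"
    and f: "integrable M (\<lambda>x. (cmod (f x))\<^sup>2)" and h: "integrable M (\<lambda>x. (cmod (h x))\<^sup>2)"
  shows "integrable M (\<lambda>x. f x * h x)"
    and "(\<integral>x. cmod (f x * h x) \<partial>M) \<le> sqrt (\<integral>x. (cmod (f x))\<^sup>2 \<partial>M) * sqrt (\<integral>x. (cmod (h x))\<^sup>2 \<partial>M)"
proof -
  show int: "integrable M (\<lambda>x. f x * h x)"
  proof (rule Bochner_Integration.integrable_bound)
    show "integrable M (\<lambda>x. (cmod (f x))\<^sup>2 + (cmod (h x))\<^sup>2)" using f h by simp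
    have "a * b \<le> \<bar>a\<^sup>2 + b\<^sup>2\<bar>" if "a \<ge> 0" "b \<ge> 0" for a b :: real
      using sum_squares_bound[of a b] mult_nonneg_nonneg[OF that] by linarith
    then show "AE x in M. norm (f x * h x) \<le> norm ((cmod (f x))\<^sup>2 + (cmod (h x))\<^sup>2)"
      by (auto simp: norm_mult)
  qed simp
  define A B I where "A = (\<integral>x. (cmod (f x))\<^sup>2 \<partial>M)" and "B = (\<integral>x. (cmod (h x))\<^sup>2 \<partial>M)"
    and "I = (\<integral>x. cmod (f x * h x) \<partial>M)"
  have nn: "A \<ge> 0" "B \<ge> 0" "I \<ge> 0" by (auto simp: A_def B_def I_def)
  have int': "integrable M (\<lambda>x. cmod (f x) * cmod (h x))" using integrable_norm[OF int] by (simp add: norm_mult)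
  have quad: "c\<^sup>2 * A - 2 * c * I + B \<ge> 0" for c
  proof -
    have "0 \<le> (\<integral>x. (c * cmod (f x) - cmod (h x))\<^sup>2 \<partial>M)" by simp
    also have "(\<lambda>x. (c * cmod (f x) - cmod (h x))\<^sup>2)
        = (\<lambda>x. c\<^sup>2 * (cmod (f x))\<^sup>2 - 2 * c * (cmod (f x) * cmod (h x)) + (cmod (h x))\<^sup>2)"
      by (auto simp: power2_eq_square algebra_simps)
    also have "(\<integral>x. c\<^sup>2 * (cmod (f x))\<^sup>2 - 2 * c * (cmod (f x) * cmod (h x)) + (cmod (h x))\<^sup>2 \<partial>M) = c\<^sup>2 * A - 2 * c * I + B"
      using f h int' by (simp add: A_def B_def I_def norm_mult)
    finally show ?thesis .
  qed
  have "I\<^sup>2 \<le> A * B"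
  proof (cases "A = 0")
    case True
    have "I = 0"
    proof (rule ccontr)
      assume "I \<noteq> 0"
      then show False using quad[of "(B + 1) / (2 * I)"] True nn by simp
    qed
    then show ?thesis using nn by simp
  next
    case False
    then show ?thesis using quad[of "I / A"] nn by (simp add: power2_eq_square field_simps)
  qed
  then show "I \<le> sqrt A * sqrt B"
    using nn by (metis real_le_rsqrt real_sqrt_mult)
qed

section \<open>Integrals of partial derivatives\<close>

lemma exp_abs_integrable:
  assumes "c > 0" shows "integrable lborel (\<lambda>x::real. exp (- c * \<bar>x\<bar>))"
proof -
  have 1: "set_integrable lborel {0<..} (\<lambda>x. exp (- c * \<bar>x\<bar>))"
    using set_integrable_exp_minus[OF assms] by (rule set_integrable_cong[THEN iffD1, rotated -1]) auto
  have "integrable lborel (\<lambda>x. indicator {0<..} x *\<^sub>R exp (- c * \<bar>x\<bar>))" using 1 by (simp add: set_integrable_def)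
  from lborel_integrable_real_affine[OF this, of "-1" 0]
  have 2: "set_integrable lborel {..<0} (\<lambda>x. exp (- c * \<bar>x\<bar>))"
    by (simp add: set_integrable_def indicator_def)
  have "set_integrable lborel ({0<..} \<union> {..<0}) (\<lambda>x. exp (- c * \<bar>x\<bar>))"
    using set_integrable_Un[OF 1 2] by simp
  moreover have "AE x in lborel. x \<noteq> (0::real)" by (rule AE_lborel_singleton)
  ultimately show ?thesis
    unfolding set_integrable_def
    by (rule_tac integrable_cong_AE_imp[rotated -1]) (auto elim!: eventually_mono simp: indicator_def)
qed

lemma AE_component_nonzero: "AE x in (lborel :: (real ^ 'd::finite) measure). x $ l \<noteq> 0"
proof -
  have "negligible {x :: real ^ 'd. x $ l = 0}"
    using negligible_standard_hyperplane[of "axis l (1::real) :: real ^ 'd" 0] by (simp add: inner_axis)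
  moreover have "{x :: real ^ 'd. x $ l = 0} \<in> sets borel" by (intro borel_closed closed_Collect_eq continuous_intros)
  ultimately have "{x :: real ^ 'd. x $ l = 0} \<in> null_sets lborel"
    by (auto simp: negligible_iff_null_sets null_sets_completion_iff)
  then show ?thesis by (rule AE_I') auto
qed

lemma integral_translation:
  fixes h :: "real ^ 'd::finite \<Rightarrow> complex"
  assumes h: "integrable lborel h"
  shows "integrable lborel (\<lambda>x. h (x + v))" "(\<integral>x. h (x + v) \<partial>lborel) = (\<integral>x. h x \<partial>lborel)"
proof -
  have [measurable]: "h \<in> borel_measurable borel" using h by simp
  have eq: "(\<lambda>x. h (x + v)) = (\<lambda>x. h (v + x))" by (simp add: add.commute)
  show "integrable lborel (\<lambda>x. h (x + v))"
    using h unfolding eq by (subst (asm) lborel_distr_plus[of v, symmetric]) (simp add: integrable_distr_eq)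
  show "(\<integral>x. h (x + v) \<partial>lborel) = (\<integral>x. h x \<partial>lborel)"
    unfolding eq by (subst (2) lborel_distr_plus[of v, symmetric]) (simp add: integral_distr)
qed

text \<open>
  The integral of the difference quotient \<open>(h (x + s e_l) - h x) / s\<close> vanishes
  by translation invariance, and dominated convergence lets \<open>s\<close> tend to
  \<open>0\<close> from above. The bound by \<open>x_l\<close>, which says that
  \<open>h\<close> vanishes on the face \<open>x_l = 0\<close>, dominates the quotient where
  the segment from \<open>x\<close> to \<open>x + s e_l\<close> enters the orthant.
\<close>

lemma integral_partial_derivative_eq_0:
  fixes h h' :: "real ^ 'd::finite \<Rightarrow> complex" and c C :: real
  defines "W \<equiv> \<lambda>x :: real ^ 'd. \<Prod>k\<in>UNIV. exp (- c * \<bar>x $ k\<bar>)"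
  assumes c: "c > 0" and C: "C \<ge> 0"
    and [measurable]: "h \<in> borel_measurable borel" "h' \<in> borel_measurable borel"
    and zero: "\<And>x. x \<notin> pos_orthant \<Longrightarrow> h x = 0" "\<And>x. x \<notin> pos_orthant \<Longrightarrow> h' x = 0"
    and deriv: "\<And>x. x \<in> pos_orthant \<Longrightarrow> ((\<lambda>s. h (x + s *\<^sub>R axis l 1)) has_vector_derivative h' x) (at 0)"
    and bound_h: "\<And>x. x \<in> pos_orthant \<Longrightarrow> cmod (h x) \<le> C * W x"
    and bound_hl: "\<And>x. x \<in> pos_orthant \<Longrightarrow> cmod (h x) \<le> x $ l * (C * W x)"
    and bound_h': "\<And>x. x \<in> pos_orthant \<Longrightarrow> cmod (h' x) \<le> C * W x"
  shows "integrable lborel h'" "(\<integral>x. h' x \<partial>lborel) = 0"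
proof -
  define e where "e = (axis l 1 :: real ^ 'd)"
  have W_int: "integrable lborel W" unfolding W_def using exp_abs_integrable[OF c] by (rule lborel_integral_prod)
  have W_pos: "W x > 0" for x by (auto simp: W_def intro!: prod_pos)
  have e_k [simp]: "e $ k = (if k = l then 1 else 0)" for k by (auto simp: e_def axis_def)
  have e_nth: "(x + s *\<^sub>R e) $ k = (if k = l then x $ l + s else x $ k)" for x s k
    by (auto simp: e_def axis_def)
  have W_e: "W (x + s *\<^sub>R e) \<le> exp (c * \<sigma>) * W x" if "\<bar>s\<bar> \<le> \<sigma>" "\<bar>x $ l\<bar> \<le> \<bar>x $ l + s\<bar> + \<sigma>" for x s \<sigma>
  proof -
    have "W (x + s *\<^sub>R e) = exp (- c * \<bar>x $ l + s\<bar>) * (\<Prod>k\<in>UNIV-{l}. exp (- c * \<bar>x $ k\<bar>))"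
      unfolding W_def by (subst prod.remove[of _ l]) (auto simp: e_def axis_def intro!: prod.cong)
    also have "\<dots> \<le> (exp (c * \<sigma>) * exp (- c * \<bar>x $ l\<bar>)) * (\<Prod>k\<in>UNIV-{l}. exp (- c * \<bar>x $ k\<bar>))"
    proof (intro mult_right_mono prod_nonneg)
      have "c * \<bar>x $ l\<bar> \<le> c * (\<bar>x $ l + s\<bar> + \<sigma>)" using that(2) c by (intro mult_left_mono) auto
      then show "exp (- c * \<bar>x $ l + s\<bar>) \<le> exp (c * \<sigma>) * exp (- c * \<bar>x $ l\<bar>)"
        by (simp add: algebra_simps flip: exp_add)
    qed auto
    also have "\<dots> = exp (c * \<sigma>) * W x" unfolding W_def by (subst (2) prod.remove[of _ l]) auto
    finally show ?thesis .
  qed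
  have h_int: "integrable lborel h"
  proof (rule Bochner_Integration.integrable_bound[OF integrable_mult_right[OF W_int, of C]])
    have "cmod (h x) \<le> norm (C * W x)" for x
      using bound_h[of x] zero(1)[of x] C W_pos[of x] by (cases "x \<in> pos_orthant") (auto simp: abs_mult)
    then show "AE x in lborel. cmod (h x) \<le> norm (C * W x)" by simp
  qed simp
  define s where "s n = 1 / real (Suc n)" for n
  have s: "0 < s n" "s n \<le> 1" for n by (auto simp: s_def)
  define q where "q n x = (h (x + s n *\<^sub>R e) - h x) /\<^sub>R s n" for n x
  have s0: "s \<longlonglongrightarrow> 0" unfolding s_def using LIMSEQ_inverse_real_of_nat by (simp add: inverse_eq_divide)
  have orth_plus: "x + r *\<^sub>R e \<in> pos_orthant" if "x \<in> pos_orthant" "r \<ge> 0" for x r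
    using that by (auto simp: pos_orthant_def e_nth add_pos_nonneg)
  have deriv': "((\<lambda>s. h (x + s *\<^sub>R e)) has_vector_derivative h' (x + r *\<^sub>R e)) (at r)"
    if "x \<in> pos_orthant" "r \<ge> 0" for x r
  proof -
    have "((\<lambda>s. h ((x + r *\<^sub>R e) + s *\<^sub>R e)) has_vector_derivative h' (x + r *\<^sub>R e)) (at 0)"
      using deriv[OF orth_plus[OF that]] by (simp add: e_def)
    then have "((\<lambda>s. h ((x + r *\<^sub>R e) + s *\<^sub>R e)) has_vector_derivative h' (x + r *\<^sub>R e)) (at (r - r))" by simp
    then have "(((\<lambda>s. h ((x + r *\<^sub>R e) + s *\<^sub>R e)) \<circ> (\<lambda>s. s - r)) has_vector_derivative 1 *\<^sub>R h' (x + r *\<^sub>R e)) (at r)"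
      by (intro vector_diff_chain_at) (auto intro!: derivative_eq_intros)
    then show ?thesis by (simp add: o_def algebra_simps)
  qed
  have q_lim: "AE x in lborel. (\<lambda>n. q n x) \<longlonglongrightarrow> h' x"
    using AE_component_nonzero[of l]
  proof eventually_elim
    case (elim x)
    show ?case
    proof (cases "x \<in> pos_orthant")
      case True
      have "(\<lambda>r. norm (h (x + (0 + r) *\<^sub>R e) - h (x + 0 *\<^sub>R e) - r *\<^sub>R h' x) / norm r) \<midarrow>0\<rightarrow> 0"
        using deriv[OF True] by (simp add: has_vector_derivative_def has_derivative_at e_def)
      moreover have "norm (h (x + (0 + r) *\<^sub>R e) - h (x + 0 *\<^sub>R e) - r *\<^sub>R h' x) / norm r
          = norm ((h (x + r *\<^sub>R e) - h x) /\<^sub>R r - h' x)" if "r \<noteq> 0" for r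
      proof -
        have "(h (x + r *\<^sub>R e) - h x) /\<^sub>R r - h' x = (h (x + r *\<^sub>R e) - h x - r *\<^sub>R h' x) /\<^sub>R r"
          using that by (simp add: scaleR_diff_right)
        then show ?thesis by (simp add: divide_inverse mult.commute)
      qed
      ultimately have "(\<lambda>r. norm ((h (x + r *\<^sub>R e) - h x) /\<^sub>R r - h' x)) \<midarrow>0\<rightarrow> 0"
        by - (erule Lim_transform_eventually, rule eventually_at_filter[THEN iffD2], rule always_eventually, blast)
      then have "(\<lambda>r. (h (x + r *\<^sub>R e) - h x) /\<^sub>R r) \<midarrow>0\<rightarrow> h' x"
        by - (rule LIM_zero_cancel, rule tendsto_norm_zero_cancel)
      moreover have "filterlim s (at 0) sequentially"
        using s0 by (rule filterlim_atI) (simp add: s_def)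
      ultimately show ?thesis unfolding q_def by (rule filterlim_compose)
    next
      case False
      have "\<forall>\<^sub>F n in sequentially. x + s n *\<^sub>R e \<notin> pos_orthant"
      proof (cases "x $ l < 0")
        case True
        then have "\<forall>\<^sub>F n in sequentially. s n < - x $ l" using s0 by (intro order_tendstoD) auto
        then show ?thesis
          by eventually_elim (auto simp: pos_orthant_def e_nth intro!: exI[of _ l])
      next
        case nn: False
        then obtain k where "\<not> 0 < x $ k" "k \<noteq> l" using elim False by (auto simp: pos_orthant_def) (metis linorder_cases)
        then show ?thesis by (intro always_eventually) (auto simp: pos_orthant_def e_nth intro!: exI[of _ k])
      qed
      then have "\<forall>\<^sub>F n in sequentially. q n x = 0"
        by eventually_elim (simp add: q_def zero False)
      then show ?thesis by (simp add: tendsto_eventually zero False)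
    qed
  qed
  (* Inside the orthant the mean value theorem applies; a segment that enters the orthant
     through the face x_l = 0 ends at distance at most s n from it; all other quotients are
     0. *)
  have q_bound: "cmod (q n x) \<le> C * exp c * W x" for n x
  proof -
    have "cmod (h (x + s n *\<^sub>R e) - h x) \<le> (C * exp c * W x) * s n"
    proof (cases "x \<in> pos_orthant")
      case True
      have "norm (h (x + s n *\<^sub>R e) - h (x + 0 *\<^sub>R e)) \<le> (C * exp c * W x) * norm (s n - 0)"
      proof (rule differentiable_bound)
        fix r assume r: "r \<in> {0..s n}"
        then show "((\<lambda>s. h (x + s *\<^sub>R e)) has_derivative (\<lambda>t. t *\<^sub>R h' (x + r *\<^sub>R e))) (at r within {0..s n})"
          using deriv'[OF True, of r] by (simp add: has_vector_derivative_def has_derivative_at_withinI)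
        have "W (x + r *\<^sub>R e) \<le> exp (c * 1) * W x"
          using r s[of n] True by (intro W_e) (auto simp: pos_orthant_def abs_if)
        then have "cmod (h' (x + r *\<^sub>R e)) \<le> C * exp c * W x"
          using bound_h'[OF orth_plus[OF True, of r]] r C
          by (smt (verit) atLeastAtMost_iff mult.assoc mult_left_mono mult_1_right)
        then show "onorm (\<lambda>t. t *\<^sub>R h' (x + r *\<^sub>R e)) \<le> C * exp c * W x"
          by (intro onorm_le) (auto simp: mult.commute[of _ "norm _"] intro: mult_right_mono)
      qed (use s[of n] in auto)
      then show ?thesis using s[of n] by simp
    next
      case False
      show ?thesis
      proof (cases "x + s n *\<^sub>R e \<in> pos_orthant")
        case True
        then have pos: "x $ l + s n > 0" by (auto simp: pos_orthant_def e_nth dest: spec[of _ l])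
        have "x $ k > 0" if "k \<noteq> l" for k
          using True that by (auto simp: pos_orthant_def dest!: spec[of _ k])
        then have "\<forall>k. x $ k > 0" if "x $ l > 0" using that by metis
        then have "\<not> x $ l > 0" using False unfolding pos_orthant_def by blast
        then have le: "x $ l + s n \<le> s n" by simp
        have "cmod (h (x + s n *\<^sub>R e)) \<le> (x $ l + s n) * (C * W (x + s n *\<^sub>R e))"
          using bound_hl[OF True] by (simp add: e_nth)
        also have "\<dots> \<le> s n * (C * (exp (c * 1) * W x))"
          using pos le s[of n] C by (intro mult_mono W_e mult_nonneg_nonneg less_imp_le[OF W_pos]) auto
        finally show ?thesis using False by (simp add: zero algebra_simps)
      qed (use False zero C W_pos[of x] s[of n] in \<open>auto\<close>)
    qed
    then show ?thesis using s[of n] unfolding q_def norm_scaleR by (simp add: field_simps)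
  qed
  have q_meas: "q n \<in> borel_measurable lborel" for n unfolding q_def by measurable
  have h'_meas: "h' \<in> borel_measurable lborel" by simp
  have dom: "integrable lborel (\<lambda>x. C * exp c * W x)" using W_int by simp
  have bnd: "AE x in lborel. cmod (q n x) \<le> C * exp c * W x" for n using q_bound by simp
  note lim = integral_dominated_convergence[OF h'_meas q_meas dom q_lim bnd]
    integrable_dominated_convergence[OF h'_meas q_meas dom q_lim bnd]
  show "integrable lborel h'" by (rule lim(2))
  have "integral\<^sup>L lborel (q n) = 0" for n
    unfolding q_def using integral_translation[OF h_int, of "s n *\<^sub>R e"] h_int by simp
  with lim(1) show "(\<integral>x. h' x \<partial>lborel) = 0" by (simp add: LIMSEQ_const_iff)
qed

section \<open>Sums over multi-indices\<close>

lemma summable_on_prod_mindex: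
  fixes b :: "'d::finite \<Rightarrow> nat \<Rightarrow> real"
  assumes b: "\<And>l. b l summable_on UNIV" and nn: "\<And>l j. b l j \<ge> 0"
  shows "(\<lambda>n. \<Prod>l\<in>UNIV. b l (n l)) summable_on UNIV"
    and "infsum (\<lambda>n. \<Prod>l\<in>UNIV. b l (n l)) UNIV = (\<Prod>l\<in>UNIV. infsum (b l) UNIV)"
proof -
  show "(\<lambda>n. \<Prod>l\<in>UNIV. b l (n l)) summable_on UNIV"
  proof (rule nonneg_bdd_above_summable_on)
    show "bdd_above (sum (\<lambda>n. \<Prod>l\<in>UNIV. b l (n l)) ` {F. F \<subseteq> UNIV \<and> finite F})"
    proof (rule bdd_aboveI2)
      fix F :: "('d \<Rightarrow> nat) set" assume "F \<in> {F. F \<subseteq> UNIV \<and> finite F}"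
      then have F: "finite F" by simp
      have fin: "finite (PiE UNIV (\<lambda>l. (\<lambda>n. n l) ` F))" by (intro finite_PiE) (auto intro: F)
      have "sum (\<lambda>n. \<Prod>l\<in>UNIV. b l (n l)) F \<le> sum (\<lambda>n. \<Prod>l\<in>UNIV. b l (n l)) (PiE UNIV (\<lambda>l. (\<lambda>n. n l) ` F))"
        by (rule sum_mono2[OF fin]) (auto intro!: prod_nonneg nn)
      also have "\<dots> = (\<Prod>l\<in>UNIV. \<Sum>j\<in>(\<lambda>n. n l) ` F. b l j)"
        by (rule prod_sum_PiE[symmetric]) (auto intro: F)
      also have "\<dots> \<le> (\<Prod>l\<in>UNIV. infsum (b l) UNIV)"
        by (intro prod_mono conjI sum_nonneg nn finite_sum_le_infsum b) (auto intro: F nn)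
      finally show "sum (\<lambda>n. \<Prod>l\<in>UNIV. b l (n l)) F \<le> (\<Prod>l\<in>UNIV. infsum (b l) UNIV)" .
    qed
  qed (auto intro!: prod_nonneg nn)
  show "infsum (\<lambda>n. \<Prod>l\<in>UNIV. b l (n l)) UNIV = (\<Prod>l\<in>UNIV. infsum (b l) UNIV)"
    using infsum_prod_PiE_abs[of "UNIV :: 'd set" b "\<lambda>_. UNIV"] b nn by simp
qed

lemma has_sum_prod_mindex:
  fixes a :: "'d::finite \<Rightarrow> nat \<Rightarrow> complex"
  assumes "\<And>l. (\<lambda>j. cmod (a l j)) summable_on UNIV" and s: "\<And>l. a l sums s l"
  shows "(\<lambda>n. cmod (\<Prod>l\<in>UNIV. a l (n l))) summable_on UNIV"
    and "((\<lambda>n. \<Prod>l\<in>UNIV. a l (n l)) has_sum (\<Prod>l\<in>UNIV. s l)) UNIV"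
proof -
  show 1: "(\<lambda>n. cmod (\<Prod>l\<in>UNIV. a l (n l))) summable_on UNIV"
    using summable_on_prod_mindex(1)[of "\<lambda>l j. cmod (a l j)"] assms by (simp add: prod_norm)
  have "(a l has_sum s l) UNIV" for l
    using norm_summable_imp_has_sum[OF summable_on_imp_summable[OF assms(1)] s] .
  then have "infsum (a l) UNIV = s l" for l by (rule infsumI)
  then have "infsum (\<lambda>n. \<Prod>l\<in>UNIV. a l (n l)) UNIV = (\<Prod>l\<in>UNIV. s l)"
    using infsum_prod_PiE_abs[of "UNIV :: 'd set" a "\<lambda>_. UNIV"] assms by simp
  then show "((\<lambda>n. \<Prod>l\<in>UNIV. a l (n l)) has_sum (\<Prod>l\<in>UNIV. s l)) UNIV"
    using has_sum_infsum[OF abs_summable_summable[OF 1]] by simp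
qed

lemma ex_mindex_enumeration: "\<exists>e :: nat \<Rightarrow> ('d::finite \<Rightarrow> nat). bij e"
proof -
  have "inj (\<lambda>k :: nat. (\<lambda>_ :: 'd. k))" by (auto intro!: injI dest: fun_cong)
  then have "infinite (UNIV :: ('d \<Rightarrow> nat) set)"
    using finite_subset[OF subset_UNIV] range_inj_infinite by blast
  then show ?thesis using bij_betw_from_nat_into[of "UNIV :: ('d \<Rightarrow> nat) set"] by auto
qed

text \<open>
  Fubini's theorem for a sum over multi-indices and an integral, reduced to sequences by an
  enumeration.
\<close>

lemma integral_has_sum_mindex:
  fixes f :: "('d::finite \<Rightarrow> nat) \<Rightarrow> 'a \<Rightarrow> complex"
  assumes int: "\<And>n. integrable M (f n)"
    and sum: "\<And>x. x \<in> space M \<Longrightarrow> ((\<lambda>n. f n x) has_sum g x) UNIV"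
    and summable: "(\<lambda>n. \<integral>x. cmod (f n x) \<partial>M) summable_on UNIV"
  shows "integrable M g" "((\<lambda>n. integral\<^sup>L M (f n)) has_sum integral\<^sup>L M g) UNIV"
proof -
  obtain e :: "nat \<Rightarrow> ('d \<Rightarrow> nat)" where e: "bij e" using ex_mindex_enumeration by blast
  have s1: "summable (\<lambda>i. \<integral>x. cmod (f (e i) x) \<partial>M)"
    using summable_on_reindex_bij_betw[OF e, of "\<lambda>n. \<integral>x. cmod (f n x) \<partial>M"] summable
    by (intro summable_on_imp_summable) blast
  have fe: "((\<lambda>i. f (e i) x) has_sum g x) UNIV" if "x \<in> space M" for x
    using sum[OF that] has_sum_reindex_bij_betw[OF e, of "\<lambda>n. f n x"] by blast
  have s2: "AE x in M. summable (\<lambda>i. cmod (f (e i) x))"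
  proof (rule AE_I2)
    fix x assume "x \<in> space M"
    then have "(\<lambda>i. f (e i) x) summable_on UNIV" using fe by (auto simp: summable_on_def)
    then show "summable (\<lambda>i. cmod (f (e i) x))"
      by (simp add: summable_on_iff_abs_summable_on_complex summable_on_imp_summable)
  qed
  have g: "(\<Sum>i. f (e i) x) = g x" if "x \<in> space M" for x
    using has_sum_imp_sums[OF fe[OF that]] by (simp add: sums_iff)
  have "integrable M (\<lambda>x. \<Sum>i. f (e i) x)" by (rule integrable_suminf[OF int s2 s1])
  then show "integrable M g"
    by (subst (asm) Bochner_Integration.integrable_cong[OF refl g])
  have "(\<lambda>i. integral\<^sup>L M (f (e i))) sums (\<integral>x. (\<Sum>i. f (e i) x) \<partial>M)" by (rule sums_integral[OF int s2 s1])
  then have "(\<lambda>i. integral\<^sup>L M (f (e i))) sums integral\<^sup>L M g"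
    by (subst (asm) Bochner_Integration.integral_cong[OF refl g])
  moreover have "summable (\<lambda>i. norm (integral\<^sup>L M (f (e i))))"
    by (rule summable_comparison_test'[OF s1, of 0]) simp
  ultimately have "((\<lambda>i. integral\<^sup>L M (f (e i))) has_sum integral\<^sup>L M g) UNIV"
    by (rule norm_summable_imp_has_sum[rotated])
  then show "((\<lambda>n. integral\<^sup>L M (f n)) has_sum integral\<^sup>L M g) UNIV"
    using has_sum_reindex_bij_betw[OF e, of "\<lambda>n. integral\<^sup>L M (f n)"] by blast
qed

section \<open>Products of polynomials with exponential decay\<close>

text \<open>
  A product of one-dimensional functions of the form \<open>polynomial * e^(-t/2)\<close>.
  This class contains the Laguerre functions as well as the intermediate functions that
  appear when Rodrigues' formula is integrated by parts.
\<close>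

definition pexp :: "('d::finite \<Rightarrow> real poly) \<Rightarrow> real ^ 'd \<Rightarrow> real"
  where "pexp P x = (\<Prod>k\<in>UNIV. poly (P k) (x $ k) * exp (- (x $ k) / 2))"

lemma laguerre_fun_eq_pexp: "laguerre_fun n = pexp (\<lambda>l. lag_poly 0 (n l))"
  by (simp add: fun_eq_iff laguerre_fun_def pexp_def laguerre_poly_eq_lag poly_lag_poly)

lemma continuous_pexp [continuous_intros]: "continuous_on S (pexp P)"
  unfolding pexp_def by (intro continuous_intros) auto

lemma measurable_pexp [measurable]: "pexp P \<in> borel_measurable borel" "pexp P \<in> borel_measurable orthant_measure"
  using borel_measurable_continuous_pos_orthant[OF continuous_pexp]
  by (auto intro!: borel_measurable_continuous_onI continuous_pexp)

text \<open>
  Half of the exponent absorbs the polynomials.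
\<close>

lemma pexp_bound:
  fixes P :: "'d::finite \<Rightarrow> real poly"
  shows "\<exists>C\<ge>0. \<forall>x\<in>pos_orthant. \<bar>pexp P x\<bar> \<le> C * (\<Prod>k\<in>UNIV. exp (- (1 / 4) * \<bar>x $ k\<bar>))"
proof -
  have "\<exists>C. \<forall>l. C l \<ge> 0 \<and> (\<forall>t\<ge>0. \<bar>poly (P l) t * exp (- (1 / 2) * t)\<bar> \<le> C l * exp (- (1 / 4) * t))"
    using poly_exp_le_exp[of "1 / 2"] by (intro choice) auto
  then obtain C where C: "\<And>l. C l \<ge> 0"
    "\<And>l t. t \<ge> 0 \<Longrightarrow> \<bar>poly (P l) t * exp (- (1 / 2) * t)\<bar> \<le> C l * exp (- (1 / 4) * t)" by blast
  show ?thesis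
  proof (intro exI conjI ballI)
    show "0 \<le> (\<Prod>l\<in>UNIV. C l)" by (intro prod_nonneg C ballI)
    fix x :: "real ^ 'd" assume x: "x \<in> pos_orthant"
    have "\<bar>pexp P x\<bar> = (\<Prod>l\<in>UNIV. \<bar>poly (P l) (x $ l) * exp (- (1 / 2) * (x $ l))\<bar>)"
      by (simp add: pexp_def abs_prod)
    also have "\<dots> \<le> (\<Prod>l\<in>UNIV. C l * exp (- (1 / 4) * \<bar>x $ l\<bar>))"
      using x C(2) by (intro prod_mono) (auto simp: pos_orthant_def less_imp_le)
    finally show "\<bar>pexp P x\<bar> \<le> (\<Prod>l\<in>UNIV. C l) * (\<Prod>k\<in>UNIV. exp (- (1 / 4) * \<bar>x $ k\<bar>))"
      by (simp add: prod.distrib)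
  qed
qed

lemma integral_pexp_mult:
  "integrable orthant_measure (\<lambda>x. pexp P x * pexp Q x)"
  "(\<integral>x. pexp P x * pexp Q x \<partial>orthant_measure)
     = (\<Prod>k\<in>UNIV. set_lebesgue_integral lborel {0<..} (\<lambda>t. poly (P k * Q k) t * exp (- t)))"
proof -
  have eq: "(\<lambda>x. pexp P x * pexp Q x) = (\<lambda>x. \<Prod>k\<in>UNIV. poly (P k * Q k) (x $ k) * exp (- (x $ k)))"
    unfolding pexp_def prod.distrib[symmetric]
    by (auto simp: fun_eq_iff mult_ac simp flip: exp_add intro!: prod.cong)
  have i: "set_integrable lborel {0<..} (\<lambda>t. poly R t * exp (- t))" for R :: "real poly"
    using set_integrable_poly_exp[of 1 R] by simp
  show "integrable orthant_measure (\<lambda>x. pexp P x * pexp Q x)"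
    unfolding eq by (rule integral_prod_orthant(1)[OF i])
  show "(\<integral>x. pexp P x * pexp Q x \<partial>orthant_measure)
     = (\<Prod>k\<in>UNIV. set_lebesgue_integral lborel {0<..} (\<lambda>t. poly (P k * Q k) t * exp (- t)))"
    unfolding eq by (rule integral_prod_orthant(2)[OF i])
qed

lemma integrable_L2_pexp:
  assumes "f \<in> L2"
  shows "integrable orthant_measure (\<lambda>x. f x * complex_of_real (pexp P x))"
    and "(\<integral>x. cmod (f x * complex_of_real (pexp P x)) \<partial>orthant_measure)
      \<le> L2_norm f * sqrt (\<integral>x. pexp P x * pexp P x \<partial>orthant_measure)"
proof -
  have m: "f \<in> borel_measurable orthant_measure" "(\<lambda>x. complex_of_real (pexp P x)) \<in> borel_measurable orthant_measure"
    using assms by (auto simp: L2_def)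
  have i: "integrable orthant_measure (\<lambda>x. (cmod (f x))\<^sup>2)"
    "integrable orthant_measure (\<lambda>x. (cmod (complex_of_real (pexp P x)))\<^sup>2)"
    using assms integral_pexp_mult(1)[of P P] by (auto simp: L2_def power2_eq_square)
  show "integrable orthant_measure (\<lambda>x. f x * complex_of_real (pexp P x))"
    by (rule Cauchy_Schwarz_integral(1)[OF m i])
  show "(\<integral>x. cmod (f x * complex_of_real (pexp P x)) \<partial>orthant_measure)
      \<le> L2_norm f * sqrt (\<integral>x. pexp P x * pexp P x \<partial>orthant_measure)"
    using Cauchy_Schwarz_integral(2)[OF m i] by (simp add: L2_norm_def power2_eq_square)
qed

lemma laguerre_fun_orthonormal:
  "integrable orthant_measure (\<lambda>x. laguerre_fun m x * laguerre_fun n x)"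
  "(\<integral>x. laguerre_fun m x * laguerre_fun n x \<partial>orthant_measure) = (if m = n then 1 else 0)"
proof -
  show "integrable orthant_measure (\<lambda>x. laguerre_fun m x * laguerre_fun n x)"
    unfolding laguerre_fun_eq_pexp by (rule integral_pexp_mult)
  have "(\<integral>x. laguerre_fun m x * laguerre_fun n x \<partial>orthant_measure)
      = (\<Prod>k\<in>UNIV. lag_inner 0 (m k) (n k))"
    unfolding laguerre_fun_eq_pexp integral_pexp_mult(2) lag_inner_def
    by (simp add: poly_lag_poly mult_ac)
  also have "\<dots> = (if m = n then 1 else 0)"
    by (auto simp: lag_inner_eq fun_eq_iff intro!: prod_zero)
  finally show "(\<integral>x. laguerre_fun m x * laguerre_fun n x \<partial>orthant_measure) = (if m = n then 1 else 0)" .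
qed

lemma integrable_laguerre_coeff:
  assumes "f \<in> L2"
  shows "integrable orthant_measure (\<lambda>t. f t * complex_of_real (laguerre_fun n t))"
    and "(\<integral>t. cmod (f t * complex_of_real (laguerre_fun n t)) \<partial>orthant_measure) \<le> L2_norm f"
  using integrable_L2_pexp[OF assms, of "\<lambda>l. lag_poly 0 (n l)"] laguerre_fun_orthonormal(2)[of n n]
  by (simp_all add: laguerre_fun_eq_pexp)

lemma norm_laguerre_coeff_le:
  assumes "f \<in> L2" shows "cmod (laguerre_coeff f n) \<le> L2_norm f"
  unfolding laguerre_coeff_def using integrable_laguerre_coeff(2)[OF assms, of n] integral_norm_bound
  by (rule order_trans[rotated])

section \<open>The Laguerre series on the polydisc\<close>

lemma summable_norm_power_series:
  fixes a :: "nat \<Rightarrow> complex"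
  assumes "\<And>w. norm w < 1 \<Longrightarrow> (\<lambda>m. a m * w ^ m) sums h w" and w: "norm w < 1"
  shows "(\<lambda>m. cmod (a m * w ^ m)) summable_on UNIV"
proof -
  define v where "v = complex_of_real ((1 + norm w) / 2)"
  have v: "norm v < 1" "norm w < norm v" using w by (auto simp: v_def norm_divide simp flip: of_real_add) 
  have "summable (\<lambda>m. cmod (a m * w ^ m))"
    using assms(1)[OF v(1)] v(2) by (intro powser_insidea[of a v w]) (auto simp: sums_iff)
  then show ?thesis by (simp add: summable_nonneg_imp_summable_on)
qed

text \<open>
  Since \<open>1/2 + w/(1-w) = (1+w)/(2(1-w))\<close>, the one-dimensional generating
  function with \<open>p = 0\<close> becomes the kernel of \<open>F_disc\<close>.
\<close>

lemma laguerre_fun_generating_function: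
  fixes w :: "complex ^ 'd::finite"
  assumes w: "w \<in> polydisc"
  shows "((\<lambda>n. complex_of_real (laguerre_fun n t) * mpow w n) has_sum
      ((\<Prod>l\<in>UNIV. exp (- (1 / 2) * ((1 + w $ l) / (1 - w $ l)) * complex_of_real (t $ l))) /
       (\<Prod>l\<in>UNIV. 1 - w $ l))) UNIV"
proof -
  have w1: "norm (w $ l) < 1" for l using w by (auto simp: polydisc_def)
  have s: "(\<lambda>m. complex_of_real (lag 0 m (t $ l) * exp (- (t $ l) / 2)) * v ^ m) sums
      (exp (- (of_real (t $ l) * v / (1 - v))) / (1 - v) * complex_of_real (exp (- (t $ l) / 2)))"
    if "norm v < 1" for l v
    using sums_mult[OF sums_lag_generating_function[OF that, of 0 "t $ l"], of "complex_of_real (exp (- (t $ l) / 2))"]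
    by (simp add: mult_ac)
  have e: "exp (- (of_real (t $ l) * w $ l / (1 - w $ l))) / (1 - w $ l) * complex_of_real (exp (- (t $ l) / 2))
     = exp (- (1 / 2) * ((1 + w $ l) / (1 - w $ l)) * complex_of_real (t $ l)) / (1 - w $ l)" for l
  proof -
    have "1 - w $ l \<noteq> 0" using w1[of l] by auto
    then have "- (of_real (t $ l) * w $ l / (1 - w $ l)) + complex_of_real (- (t $ l) / 2)
        = - (1 / 2) * ((1 + w $ l) / (1 - w $ l)) * complex_of_real (t $ l)"
      by (simp add: field_simps)
    then show ?thesis by (simp add: exp_of_real[symmetric] flip: exp_add)
  qed
  have "((\<lambda>n. \<Prod>l\<in>UNIV. complex_of_real (lag 0 (n l) (t $ l) * exp (- (t $ l) / 2)) * (w $ l) ^ n l) has_sum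
      (\<Prod>l\<in>UNIV. exp (- (of_real (t $ l) * w $ l / (1 - w $ l))) / (1 - w $ l) * complex_of_real (exp (- (t $ l) / 2)))) UNIV"
    by (rule has_sum_prod_mindex(2)[OF summable_norm_power_series[OF s w1] s[OF w1]])
  then show ?thesis
    unfolding e by (simp add: prod_dividef laguerre_fun_def mpow_def laguerre_poly_eq_lag prod.distrib)
qed

lemma summable_mpow:
  fixes w :: "complex ^ 'd::finite"
  assumes w: "w \<in> polydisc"
  shows "(\<lambda>n. cmod (mpow w n)) summable_on UNIV"
proof -
  have "(\<lambda>n. \<Prod>l\<in>UNIV. cmod (w $ l) ^ n l) summable_on UNIV"
    using w by (intro summable_on_prod_mindex(1) summable_nonneg_imp_summable_on summable_geometric)
      (auto simp: polydisc_def)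
  then show ?thesis by (simp add: mpow_def norm_power flip: prod_norm)
qed

text \<open>
  Integrate the generating function termwise; the integrals of \<open>|f|\<close> times a
  Laguerre function are at most the norm of \<open>f\<close>, so the series converges
  absolutely.
\<close>

lemma F_disc_eq_disc_series:
  assumes f: "f \<in> L2" and w: "w \<in> polydisc"
  shows "F_disc f w = disc_series (laguerre_coeff f) w"
proof -
  let ?K = "\<lambda>t :: real ^ 'a. \<Prod>l\<in>UNIV. exp (- (1 / 2) * ((1 + w $ l) / (1 - w $ l)) * complex_of_real (t $ l))"
  let ?p = "\<Prod>l\<in>UNIV. 1 - w $ l"
  have "w $ l \<noteq> 1" for l using w unfolding polydisc_def by (metis mem_Collect_eq norm_one less_irrefl)
  then have p: "?p \<noteq> 0" by simp
  have "((\<lambda>n. \<integral>t. f t * complex_of_real (laguerre_fun n t) * mpow w n \<partial>orthant_measure) has_sum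
      (\<integral>t. f t * (?K t / ?p) \<partial>orthant_measure)) UNIV"
  proof (rule integral_has_sum_mindex(2))
    show "integrable orthant_measure (\<lambda>t. f t * complex_of_real (laguerre_fun n t) * mpow w n)" for n
      using integrable_laguerre_coeff(1)[OF f] by simp
    show "((\<lambda>n. f t * complex_of_real (laguerre_fun n t) * mpow w n) has_sum f t * (?K t / ?p)) UNIV" for t
      unfolding mult.assoc[of "f t"] by (intro has_sum_cmult_right laguerre_fun_generating_function w)
    have "(\<lambda>n. L2_norm f * cmod (mpow w n)) summable_on UNIV"
      using summable_mpow[OF w] by (rule summable_on_cmult_right)
    then show "(\<lambda>n. \<integral>t. cmod (f t * complex_of_real (laguerre_fun n t) * mpow w n) \<partial>orthant_measure) summable_on UNIV"
      by (rule summable_on_comparison_test)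
        (use mult_right_mono[OF integrable_laguerre_coeff(2)[OF f]] in \<open>auto simp: norm_mult\<close>)
  qed
  then have "((\<lambda>n. laguerre_coeff f n * mpow w n) has_sum (F_disc f w / ?p)) UNIV"
    by (simp add: laguerre_coeff_def F_disc_def)
  then show ?thesis using p by (simp add: disc_series_def infsumI)
qed

section \<open>Bessel's inequality\<close>

text \<open>
  The squared norm of \<open>f\<close> minus a finite Laguerre sum is nonnegative.
\<close>

lemma Bessel_inequality:
  assumes f: "f \<in> L2" and F: "finite F"
  shows "(\<Sum>n\<in>F. (cmod (laguerre_coeff f n))\<^sup>2) \<le> (\<integral>t. (cmod (f t))\<^sup>2 \<partial>orthant_measure)"
proof -
  let ?a = "laguerre_coeff f" and ?L = "\<lambda>n t. complex_of_real (laguerre_fun n t)"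
  let ?A = "\<Sum>n\<in>F. ?a n * cnj (?a n)"
  define g where "g t = (\<Sum>n\<in>F. ?a n * ?L n t)" for t
  have i1: "integrable orthant_measure (\<lambda>t. f t * cnj (f t))"
    using f by (simp add: L2_def complex_norm_square[symmetric] integrable_of_real del: of_real_power)
  have i2: "integrable orthant_measure (\<lambda>t. f t * ?L n t)" for n
    using integrable_laguerre_coeff(1)[OF f] .
  have i3: "integrable orthant_measure (\<lambda>t. cnj (f t) * ?L n t)" for n
    using integrable_cnj[OF i2[of n]] by simp
  have i4: "integrable orthant_measure (\<lambda>t. ?L m t * ?L n t)" for m n
    using laguerre_fun_orthonormal(1)[of m n] by (simp flip: of_real_mult add: integrable_of_real)
  have v2: "(\<integral>t. f t * ?L n t \<partial>orthant_measure) = ?a n" for n by (simp add: laguerre_coeff_def)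
  have v3: "(\<integral>t. cnj (f t) * ?L n t \<partial>orthant_measure) = cnj (?a n)" for n
    unfolding laguerre_coeff_def Bochner_Integration.integral_cnj[symmetric] by (simp del: Bochner_Integration.integral_cnj)
  have v4: "(\<integral>t. ?L m t * ?L n t \<partial>orthant_measure) = (if m = n then 1 else 0)" for m n
    using laguerre_fun_orthonormal(2)[of m n] by (simp flip: of_real_mult)
  define S1 S2 S3 where "S1 t = (\<Sum>n\<in>F. cnj (?a n) * (f t * ?L n t))"
    and "S2 t = (\<Sum>n\<in>F. ?a n * (cnj (f t) * ?L n t))"
    and "S3 t = (\<Sum>m\<in>F. \<Sum>n\<in>F. ?a m * cnj (?a n) * (?L m t * ?L n t))" for t
  have int: "integrable orthant_measure S1" "integrable orthant_measure S2" "integrable orthant_measure S3"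
    unfolding S1_def S2_def S3_def by (intro Bochner_Integration.integrable_sum integrable_mult_right i2 i3 i4)+
  have vals: "integral\<^sup>L orthant_measure S1 = (\<Sum>n\<in>F. cnj (?a n) * ?a n)"
    "integral\<^sup>L orthant_measure S2 = (\<Sum>n\<in>F. ?a n * cnj (?a n))"
    "integral\<^sup>L orthant_measure S3 = (\<Sum>m\<in>F. \<Sum>n\<in>F. ?a m * cnj (?a n) * (if m = n then 1 else 0))"
    unfolding S1_def S2_def S3_def
    by (subst Bochner_Integration.integral_sum Bochner_Integration.integral_mult_right_zero
        | intro Bochner_Integration.integrable_sum integrable_mult_right i2 i3 i4 sum.cong refl
        | simp only: v2 v3 v4)+
  have "complex_of_real ((cmod (f t - g t))\<^sup>2) = f t * cnj (f t) - S1 t - S2 t + S3 t" for t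
  proof -
    have "complex_of_real ((cmod (f t - g t))\<^sup>2) = f t * cnj (f t) - f t * cnj (g t) - g t * cnj (f t) + g t * cnj (g t)"
      unfolding complex_norm_square by (simp add: algebra_simps)
    moreover have "f t * cnj (g t) = S1 t" by (simp add: S1_def g_def sum_distrib_left mult_ac)
    moreover have "g t * cnj (f t) = S2 t" by (simp add: S2_def g_def sum_distrib_left mult_ac)
    moreover have "g t * cnj (g t) = S3 t" by (simp add: S3_def g_def sum_product mult_ac)
    ultimately show ?thesis by simp
  qed
  then have "(\<integral>t. complex_of_real ((cmod (f t - g t))\<^sup>2) \<partial>orthant_measure)
     = (\<integral>t. f t * cnj (f t) \<partial>orthant_measure)
      - (\<Sum>n\<in>F. cnj (?a n) * ?a n) - (\<Sum>n\<in>F. ?a n * cnj (?a n))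
      + (\<Sum>m\<in>F. \<Sum>n\<in>F. ?a m * cnj (?a n) * (if m = n then 1 else 0))"
    unfolding vals[symmetric] using i1 int by simp
  also have "\<dots> = (\<integral>t. f t * cnj (f t) \<partial>orthant_measure) - ?A"
    using F by (simp add: mult.commute if_distrib sum.delta cong: if_cong)
  also have "\<dots> = complex_of_real ((\<integral>t. (cmod (f t))\<^sup>2 \<partial>orthant_measure) - (\<Sum>n\<in>F. (cmod (?a n))\<^sup>2))"
    by (simp only: complex_norm_square[symmetric] of_real_sum[symmetric] integral_complex_of_real of_real_diff)
  finally have "(\<integral>t. (cmod (f t - g t))\<^sup>2 \<partial>orthant_measure)
     = (\<integral>t. (cmod (f t))\<^sup>2 \<partial>orthant_measure) - (\<Sum>n\<in>F. (cmod (?a n))\<^sup>2)"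
    by (simp only: integral_complex_of_real of_real_eq_iff)
  moreover have "(\<integral>t. (cmod (f t - g t))\<^sup>2 \<partial>orthant_measure) \<ge> 0" by simp
  ultimately show ?thesis by linarith
qed

text \<open>
  Along a line of multi-indices in coordinate direction the squares of the coefficients are
  summable.
\<close>

lemma laguerre_coeff_tendsto_0:
  assumes f: "f \<in> L2"
  shows "(\<lambda>j. laguerre_coeff f (n(l := j))) \<longlonglongrightarrow> 0"
proof -
  have inj: "inj_on (\<lambda>j. n(l := j)) S" for S by (auto intro!: inj_onI dest: fun_upd_eqD)
  have "summable (\<lambda>j. (cmod (laguerre_coeff f (n(l := j))))\<^sup>2)"
  proof (rule summableI_nonneg_bounded)
    fix N
    have "(\<Sum>j<N. (cmod (laguerre_coeff f (n(l := j))))\<^sup>2) = (\<Sum>m\<in>(\<lambda>j. n(l := j)) ` {..<N}. (cmod (laguerre_coeff f m))\<^sup>2)"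
      by (simp add: sum.reindex[OF inj])
    also have "\<dots> \<le> (\<integral>t. (cmod (f t))\<^sup>2 \<partial>orthant_measure)" by (rule Bessel_inequality[OF f]) simp
    finally show "(\<Sum>j<N. (cmod (laguerre_coeff f (n(l := j))))\<^sup>2) \<le> (\<integral>t. (cmod (f t))\<^sup>2 \<partial>orthant_measure)" .
  qed simp
  then have "(\<lambda>j. (cmod (laguerre_coeff f (n(l := j))))\<^sup>2) \<longlonglongrightarrow> 0" by (rule summable_LIMSEQ_zero)
  then have "(\<lambda>j. sqrt ((cmod (laguerre_coeff f (n(l := j))))\<^sup>2)) \<longlonglongrightarrow> sqrt 0" by (rule tendsto_real_sqrt)
  then show ?thesis by (simp add: tendsto_norm_zero_iff)
qed

section \<open>Integration by parts against Laguerre-type functions\<close>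

lemma integrable_bounded_mult_pexp:
  fixes G :: "real ^ 'd::finite \<Rightarrow> complex"
  assumes m: "G \<in> borel_measurable orthant_measure" and b: "\<And>x. x \<in> pos_orthant \<Longrightarrow> cmod (G x) \<le> M"
  shows "integrable orthant_measure (\<lambda>x. G x * complex_of_real (pexp P x))"
proof -
  have M: "M \<ge> 0"
  proof -
    have "(\<chi> i. 1) \<in> (pos_orthant :: (real ^ 'd) set)" by (simp add: pos_orthant_def)
    from b[OF this] show ?thesis using norm_ge_zero by (rule order_trans[rotated])
  qed
  obtain C where C: "C \<ge> 0" "\<And>x. x \<in> pos_orthant \<Longrightarrow> \<bar>pexp P x\<bar> \<le> C * (\<Prod>k\<in>UNIV. exp (- (1 / 4) * \<bar>x $ k\<bar>))"
    using pexp_bound[of P] by blast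
  have W: "integrable orthant_measure (\<lambda>x :: real ^ 'd. \<Prod>k\<in>UNIV. exp (- (1 / 4) * \<bar>x $ k\<bar>))"
    using exp_abs_integrable[of "1 / 4"]
    by (intro integral_prod_orthant(1)) (unfold set_integrable_def, intro integrable_mult_indicator, auto)
  show ?thesis
  proof (rule Bochner_Integration.integrable_bound)
    show "integrable orthant_measure (\<lambda>x :: real ^ 'd. M * (C * (\<Prod>k\<in>UNIV. exp (- (1 / 4) * \<bar>x $ k\<bar>))))"
      using W by (intro integrable_mult_right)
    show "(\<lambda>x. G x * complex_of_real (pexp P x)) \<in> borel_measurable orthant_measure"
      using m by measurable
    have "norm (G x * complex_of_real (pexp P x)) \<le> norm (M * (C * (\<Prod>k\<in>UNIV. exp (- (1 / 4) * \<bar>x $ k\<bar>))))"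
      if "x \<in> pos_orthant" for x
    proof -
      have "norm (G x * complex_of_real (pexp P x)) \<le> M * (C * (\<Prod>k\<in>UNIV. exp (- (1 / 4) * \<bar>x $ k\<bar>)))"
        unfolding norm_mult norm_of_real by (intro mult_mono b C that M) auto
      then show ?thesis by (simp only: real_norm_def)
    qed
    then show "AE x in orthant_measure. norm (G x * complex_of_real (pexp P x)) \<le> norm (M * (C * (\<Prod>k\<in>UNIV. exp (- (1 / 4) * \<bar>x $ k\<bar>))))"
      by (intro AE_I2) simp
  qed
qed

lemma pexp_update: "pexp (P(l := Q)) x = poly Q (x $ l) * exp (- (x $ l) / 2) * (\<Prod>k\<in>UNIV-{l}. poly (P k) (x $ k) * exp (- (x $ k) / 2))"
  unfolding pexp_def by (subst prod.remove[of _ l]) auto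

text \<open>
  Differentiation in direction \<open>l\<close> changes only the factor \<open>l\<close>. If
  \<open>Q e^(-t)\<close> is the derivative of \<open>P_l e^(-t)\<close>, then that of
  \<open>P_l e^(-t/2)\<close> is \<open>(Q + P_l/2) e^(-t/2)\<close>.
\<close>

lemma has_derivative_pexp:
  fixes P :: "'d::finite \<Rightarrow> real poly"
  assumes D: "\<And>t. ((\<lambda>t. poly (P l) t * exp (- t)) has_real_derivative poly Q t * exp (- t)) (at t)"
  shows "((\<lambda>s. pexp P (x + s *\<^sub>R axis l 1)) has_real_derivative (pexp (P(l := Q)) x + pexp P x / 2)) (at 0)"
proof -
  let ?R = "\<Prod>k\<in>UNIV-{l}. poly (P k) (x $ k) * exp (- (x $ k) / 2)"
  have ax: "(x + s *\<^sub>R axis l 1) $ k = (if k = l then x $ l + s else x $ k)" for s k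
    by (simp add: axis_def)
  have "pexp P (x + s *\<^sub>R axis l 1) = exp ((x $ l + s) / 2) * (poly (P l) (x $ l + s) * exp (- (x $ l + s))) * ?R" for s
  proof -
    have "exp (- (x $ l + s) / 2) = exp ((x $ l + s) / 2) * exp (- (x $ l + s))"
      by (simp flip: exp_add)
    moreover have "pexp P (x + s *\<^sub>R axis l 1) = poly (P l) (x $ l + s) * exp (- (x $ l + s) / 2) * ?R"
      unfolding pexp_def ax by (subst prod.remove[of _ l]) auto
    ultimately show ?thesis by (simp only: mult_ac)
  qed
  moreover have "((\<lambda>s. exp ((x $ l + s) / 2) * (poly (P l) (x $ l + s) * exp (- (x $ l + s))) * ?R) has_real_derivative
     (exp (x $ l / 2) / 2 * (poly (P l) (x $ l) * exp (- (x $ l))) + poly Q (x $ l) * exp (- (x $ l)) * exp (x $ l / 2)) * ?R) (at 0)"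
  proof -
    have 1: "((\<lambda>s. poly (P l) (x $ l + s) * exp (- (x $ l + s))) has_real_derivative poly Q (x $ l) * exp (- (x $ l))) (at 0)"
      using D[of "x $ l"] DERIV_shift[of "\<lambda>t. poly (P l) t * exp (- t)" "poly Q (x $ l) * exp (- (x $ l))" 0 "x $ l"]
      by (simp add: add.commute)
    have 2: "((\<lambda>s. exp ((x $ l + s) / 2)) has_real_derivative exp (x $ l / 2) / 2) (at 0)"
      by (auto intro!: derivative_eq_intros)
    show ?thesis using DERIV_cmult_right[OF DERIV_mult[OF 2 1], of ?R] by simp
  qed
  moreover have "(exp (x $ l / 2) / 2 * (poly (P l) (x $ l) * exp (- (x $ l))) + poly Q (x $ l) * exp (- (x $ l)) * exp (x $ l / 2)) * ?R
     = pexp (P(l := Q)) x + pexp P x / 2"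
  proof -
    have e: "exp (- (x $ l) / 2) = exp (x $ l / 2) * exp (- (x $ l))" by (simp flip: exp_add)
    have "pexp P x = poly (P l) (x $ l) * exp (- (x $ l) / 2) * ?R"
      using pexp_update[of P l "P l" x] by simp
    then show ?thesis unfolding pexp_update e by (simp add: algebra_simps)
  qed
  ultimately show ?thesis by (simp only:)
qed

text \<open>
  The boundary term vanishes as \<open>P_l\<close> has a zero at \<open>0\<close>. The last
  term arises because the derivative formula is for \<open>P_l e^(-t)\<close>, whereas the
  integrand contains \<open>P_l e^(-t/2)\<close>.
\<close>

lemma integral_by_parts_pexp:
  fixes G G' :: "real ^ 'd::finite \<Rightarrow> complex"
  assumes G: "continuous_on pos_orthant G" "continuous_on pos_orthant G'"
    and deriv: "\<And>x. x \<in> pos_orthant \<Longrightarrow> ((\<lambda>s. G (x + s *\<^sub>R axis l 1)) has_vector_derivative G' x) (at 0)"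
    and bound: "\<And>x. x \<in> pos_orthant \<Longrightarrow> cmod (G x) \<le> M" "\<And>x. x \<in> pos_orthant \<Longrightarrow> cmod (G' x) \<le> M"
    and P0: "poly (P l) 0 = 0"
    and D: "\<And>t. ((\<lambda>t. poly (P l) t * exp (- t)) has_real_derivative poly Q t * exp (- t)) (at t)"
  shows "(\<integral>x. G x * complex_of_real (pexp (P(l := Q)) x) \<partial>orthant_measure)
      = - (\<integral>x. G' x * complex_of_real (pexp P x) \<partial>orthant_measure)
        - (\<integral>x. G x * complex_of_real (pexp P x) \<partial>orthant_measure) / 2"
proof -
  let ?W = "\<lambda>x :: real ^ 'd. \<Prod>k\<in>UNIV. exp (- (1 / 4) * \<bar>x $ k\<bar>)"
  let ?e = "axis l 1 :: real ^ 'd"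
  define k where "k x = G x * complex_of_real (pexp P x)" for x
  define k' where "k' x = G' x * complex_of_real (pexp P x) + G x * complex_of_real (pexp (P(l := Q)) x)
      + G x * complex_of_real (pexp P x) / 2" for x
  define h where "h x = indicator pos_orthant x *\<^sub>R k x" for x
  define h' where "h' x = indicator pos_orthant x *\<^sub>R k' x" for x
  obtain R where R: "P l = [:0, 1:] * R" using P0 by (metis poly_eq_0_iff_dvd minus_zero dvd_def)
  obtain C1 where C1: "C1 \<ge> 0" "\<And>x. x \<in> pos_orthant \<Longrightarrow> \<bar>pexp P x\<bar> \<le> C1 * ?W x"
    using pexp_bound[of P] by blast
  obtain C2 where C2: "C2 \<ge> 0" "\<And>x. x \<in> pos_orthant \<Longrightarrow> \<bar>pexp (P(l := Q)) x\<bar> \<le> C2 * ?W x"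
    using pexp_bound[of "P(l := Q)"] by blast
  obtain C3 where C3: "C3 \<ge> 0" "\<And>x. x \<in> pos_orthant \<Longrightarrow> \<bar>pexp (P(l := R)) x\<bar> \<le> C3 * ?W x"
    using pexp_bound[of "P(l := R)"] by blast
  have M: "M \<ge> 0"
  proof -
    have "(\<chi> i. 1) \<in> (pos_orthant :: (real ^ 'd) set)" by (simp add: pos_orthant_def)
    from bound(1)[OF this] show ?thesis using norm_ge_zero by (rule order_trans[rotated])
  qed
  define C where "C = M * (2 * C1 + C2 + C3)"
  have MC: "M * C1 \<ge> 0" "M * C2 \<ge> 0" "M * C3 \<ge> 0" using M C1(1) C2(1) C3(1) by auto
  have C: "C \<ge> 0" "M * C1 \<le> C" "M * C3 \<le> C" "M * C1 + M * C2 + M * C1 / 2 \<le> C"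
    using MC by (auto simp: C_def algebra_simps)
  have W: "?W x \<ge> 0" for x by (intro prod_nonneg) auto
  have px: "pexp P x = x $ l * pexp (P(l := R)) x" for x
    using pexp_update[of P l "P l" x] unfolding pexp_update[of P l R] fun_upd_triv by (simp add: R)
  have kb: "cmod (k x) \<le> M * C1 * ?W x" if "x \<in> pos_orthant" for x
  proof -
    have "cmod (G x) * \<bar>pexp P x\<bar> \<le> M * (C1 * ?W x)"
      using bound(1)[OF that] C1(2)[OF that] M by (intro mult_mono) auto
    then show ?thesis by (simp add: k_def norm_mult mult.assoc)
  qed
  have cont: "continuous_on pos_orthant k" "continuous_on pos_orthant k'"
    unfolding k_def k'_def by (intro continuous_intros G; simp)+
  have eq0: "(\<integral>x. h' x \<partial>lborel) = 0"
  proof (rule integral_partial_derivative_eq_0(2)[where c = "1 / 4" and C = C and h = h and l = l])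
    show "h \<in> borel_measurable borel" "h' \<in> borel_measurable borel"
      unfolding h_def h'_def by (intro borel_measurable_continuous_on_indicator cont; simp)+
    show "((\<lambda>s. h (x + s *\<^sub>R ?e)) has_vector_derivative h' x) (at 0)" if x: "x \<in> pos_orthant" for x
    proof -
      have "((\<lambda>s. complex_of_real (pexp P (x + s *\<^sub>R ?e))) has_vector_derivative
          complex_of_real (pexp (P(l := Q)) x + pexp P x / 2)) (at 0)"
        using has_derivative_pexp[where P = P and l = l and Q = Q and x = x, OF D]
        by (intro has_vector_derivative_of_real) (simp add: has_real_derivative_iff_has_vector_derivative)
      from has_vector_derivative_mult[OF deriv[OF x] this]
      have "((\<lambda>s. k (x + s *\<^sub>R ?e)) has_vector_derivative h' x) (at 0)"
        using x by (simp add: k_def h'_def k'_def algebra_simps)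
      moreover have "open ((\<lambda>s::real. x + s *\<^sub>R ?e) -` pos_orthant)"
        by (intro open_vimage open_pos_orthant continuous_intros)
      ultimately show ?thesis
        by (rule has_vector_derivative_transform_within_open) (use x in \<open>auto simp: h_def\<close>)
    qed
    fix x :: "real ^ 'd" assume x: "x \<in> pos_orthant"
    have "cmod (h x) = cmod (k x)" using x by (simp add: h_def)
    also have "\<dots> \<le> M * C1 * ?W x" by (rule kb[OF x])
    also have "\<dots> \<le> C * ?W x" using C(2) W by (rule mult_right_mono)
    finally show "cmod (h x) \<le> C * ?W x" .
    have xl: "x $ l > 0" using x by (simp add: pos_orthant_def)
    have "cmod (h x) = cmod (G x) * (x $ l * \<bar>pexp (P(l := R)) x\<bar>)"
      using x xl by (simp add: h_def k_def px norm_mult)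
    also have "\<dots> \<le> M * (x $ l * (C3 * ?W x))"
      using bound(1)[OF x] C3(2)[OF x] M xl by (intro mult_mono) auto
    also have "\<dots> = x $ l * (M * C3 * ?W x)" by simp
    also have "\<dots> \<le> x $ l * (C * ?W x)" using C(3) W xl by (intro mult_left_mono mult_right_mono) auto
    finally show "cmod (h x) \<le> x $ l * (C * ?W x)" .
    have 1: "cmod (G' x * complex_of_real (pexp P x)) \<le> M * C1 * ?W x"
      using bound(2)[OF x] C1(2)[OF x] M by (simp add: norm_mult mult.assoc mult_mono)
    have 2: "cmod (G x * complex_of_real (pexp (P(l := Q)) x)) \<le> M * C2 * ?W x"
      using bound(1)[OF x] C2(2)[OF x] M by (simp add: norm_mult mult.assoc mult_mono)
    have "h' x = G' x * complex_of_real (pexp P x) + G x * complex_of_real (pexp (P(l := Q)) x) + k x / 2"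
      using x by (simp add: h'_def k'_def k_def)
    then have "cmod (h' x) \<le> cmod (G' x * complex_of_real (pexp P x))
        + cmod (G x * complex_of_real (pexp (P(l := Q)) x)) + cmod (k x / 2)"
      by (metis norm_triangle_le norm_triangle_ineq add_right_mono)
    also have "\<dots> \<le> M * C1 * ?W x + M * C2 * ?W x + M * C1 * ?W x / 2"
      using 1 2 kb[OF x] by (intro add_mono) (auto simp: norm_divide)
    also have "\<dots> = (M * C1 + M * C2 + M * C1 / 2) * ?W x" by (simp add: algebra_simps)
    also have "\<dots> \<le> C * ?W x" using C(4) W by (rule mult_right_mono)
    finally show "cmod (h' x) \<le> C * ?W x" .
  qed (use C in \<open>auto simp: h_def h'_def\<close>)
  have i: "integrable orthant_measure (\<lambda>x. G' x * complex_of_real (pexp P x))"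
    "integrable orthant_measure (\<lambda>x. G x * complex_of_real (pexp (P(l := Q)) x))"
    "integrable orthant_measure (\<lambda>x. G x * complex_of_real (pexp P x))"
    using G bound by (auto intro!: integrable_bounded_mult_pexp borel_measurable_continuous_pos_orthant)
  have "integral\<^sup>L orthant_measure k' = 0"
    using eq0 unfolding h'_def
    by (subst integrable_orthant_iff(2)) (auto intro!: borel_measurable_continuous_on_indicator cont)
  moreover have "integral\<^sup>L orthant_measure k' = (\<integral>x. G' x * complex_of_real (pexp P x) \<partial>orthant_measure)
      + (\<integral>x. G x * complex_of_real (pexp (P(l := Q)) x) \<partial>orthant_measure)
      + (\<integral>x. G x * complex_of_real (pexp P x) \<partial>orthant_measure) / 2"
    unfolding k'_def using i by simp
  ultimately show ?thesis by (simp add: eq_diff_eq eq_neg_iff_add_eq_0 add_ac)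
qed

section \<open>Completeness of the Laguerre functions\<close>

lemma mpow_remove: "mpow x k = (x $ l) ^ k l * (\<Prod>i\<in>UNIV-{l}. (x $ i) ^ k i)"
  unfolding mpow_def by (rule prod.remove) auto

text \<open>
  The coordinates \<open>x_l = e^(-t_l)\<close> map the orthant into a compact cube, where
  the Stone-Weierstrass theorem is available.
\<close>

definition expm :: "real ^ 'd::finite \<Rightarrow> real ^ 'd" where "expm t = (\<chi> l. exp (- (t $ l)))"

lemma expm_nth [simp]: "expm t $ l = exp (- (t $ l))" by (simp add: expm_def)

lemma continuous_expm: "continuous_on S expm"
  unfolding expm_def by (intro continuous_intros)

lemma integrable_L2_exp:
  fixes f :: "real ^ 'd::finite \<Rightarrow> complex"
  assumes f: "f \<in> L2"
  shows "integrable orthant_measure (\<lambda>t. f t * complex_of_real (\<Prod>l\<in>UNIV. exp (- (t $ l))))"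
proof (rule Bochner_Integration.integrable_bound)
  show "integrable orthant_measure (\<lambda>t. f t * complex_of_real (pexp (\<lambda>_. 1) t))"
    by (rule integrable_L2_pexp(1)[OF f])
  show "(\<lambda>t. f t * complex_of_real (\<Prod>l\<in>UNIV. exp (- (t $ l)))) \<in> borel_measurable orthant_measure"
  proof (rule borel_measurable_times)
    show "f \<in> borel_measurable orthant_measure" using f by (simp add: L2_def)
    show "(\<lambda>t. complex_of_real (\<Prod>l\<in>UNIV. exp (- (t $ l)))) \<in> borel_measurable (orthant_measure :: (real ^ 'd) measure)"
      by (intro borel_measurable_continuous_pos_orthant continuous_intros)
  qed
  have "norm (f t * complex_of_real (\<Prod>l\<in>UNIV. exp (- (t $ l)))) \<le> norm (f t * complex_of_real (pexp (\<lambda>_. 1) t))"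
    if "t \<in> pos_orthant" for t
  proof -
    have "(\<Prod>l\<in>UNIV. exp (- (t $ l))) \<le> pexp (\<lambda>_. 1) t"
      unfolding pexp_def using that by (intro prod_mono) (auto simp: pos_orthant_def less_imp_le)
    moreover have "0 \<le> (\<Prod>l\<in>UNIV. exp (- (t $ l)))" by (intro prod_nonneg) simp
    ultimately show ?thesis unfolding norm_mult norm_of_real by (intro mult_left_mono) auto
  qed
  then show "AE t in orthant_measure. norm (f t * complex_of_real (\<Prod>l\<in>UNIV. exp (- (t $ l)))) \<le> norm (f t * complex_of_real (pexp (\<lambda>_. 1) t))"
    by (intro AE_I2) simp
qed

lemma sigma_finite_orthant_measure: "sigma_finite_measure (orthant_measure :: (real ^ 'd::finite) measure)"
proof -
  obtain A :: "(real ^ 'd) set set" where A: "countable A" "A \<subseteq> sets lborel" "\<Union>A = space lborel"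
    "\<forall>a\<in>A. emeasure lborel a \<noteq> \<infinity>"
    using sigma_finite_measure.sigma_finite_countable[OF sigma_finite_lborel] by blast
  have "a \<in> sets lebesgue" if "a \<in> A" for a
    using A(2) that by (intro sets_completionI_sets) auto
  then have "sigma_finite_measure (lebesgue :: (real ^ 'd) measure)"
    using A by (intro sigma_finite_measure.intro exI[of _ A]) auto
  then show ?thesis by (rule sigma_finite_measure_restrict_space) simp
qed

text \<open>
  In the coordinates \<open>x = e^(-t)\<close> the hypothesis says that \<open>g\<close> is
  orthogonal to all monomials, hence to all polynomials, hence by the Stone-Weierstrass
  theorem to all continuous functions on the cube. Indicators of sets are limits of such
  functions, so the integral of \<open>g\<close> over every measurable set vanishes.
\<close>

lemma AE_eq_0_if_Laplace_moments_eq_0: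
  fixes g :: "real ^ 'd::finite \<Rightarrow> complex"
  assumes g: "integrable orthant_measure g"
    and moments: "\<And>k. (\<integral>t. g t * complex_of_real (mpow (expm t) k) \<partial>orthant_measure) = 0"
  shows "AE t in orthant_measure. g t = 0"
proof -
  define K where "K = cbox (0 :: real ^ 'd) (\<chi> i. 1)"
  have K: "compact K" by (simp add: K_def)
  have inK: "expm t \<in> K" if "t \<in> pos_orthant" for t
    using that by (auto simp: K_def mem_box_cart pos_orthant_def less_imp_le)
  have meas: "(\<lambda>t. complex_of_real (h (expm t))) \<in> borel_measurable orthant_measure" if "continuous_on K h" for h
    by (intro borel_measurable_continuous_pos_orthant continuous_intros continuous_on_compose2[OF that continuous_expm])
       (use inK in auto)
  have int: "integrable orthant_measure (\<lambda>t. g t * complex_of_real (h (expm t)))" if h: "continuous_on K h" for h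
  proof -
    have "bounded (h ` K)" using compact_continuous_image[OF h K] by (rule compact_imp_bounded)
    then obtain B where B: "\<And>x. x \<in> K \<Longrightarrow> \<bar>h x\<bar> \<le> B" by (auto simp: bounded_iff)
    show ?thesis
    proof (rule Bochner_Integration.integrable_bound)
      show "integrable orthant_measure (\<lambda>t. B * cmod (g t))" using g by simp
      show "(\<lambda>t. g t * complex_of_real (h (expm t))) \<in> borel_measurable orthant_measure"
        using g meas[OF h] by auto
      have "norm (g t * complex_of_real (h (expm t))) \<le> norm (B * cmod (g t))" if "t \<in> pos_orthant" for t
      proof -
        have "cmod (g t) * \<bar>h (expm t)\<bar> \<le> cmod (g t) * \<bar>B\<bar>"
          using B[OF inK[OF that]] by (intro mult_left_mono) auto
        then show ?thesis by (simp add: norm_mult abs_mult mult.commute)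
      qed
      then show "AE t in orthant_measure. norm (g t * complex_of_real (h (expm t))) \<le> norm (B * cmod (g t))"
        by (intro AE_I2) simp
    qed
  qed
  have cont_mpow: "continuous_on K (\<lambda>x. mpow x k)" for k :: "'d \<Rightarrow> nat"
    unfolding mpow_def by (intro continuous_intros)
  (* The set of functions whose products with all monomials are orthogonal to g is stable
     under multiplication by polynomial functions; this is the form in which the induction
     over polynomial functions goes through. *)
  define S where "S h \<longleftrightarrow> continuous_on K h \<and>
      (\<forall>k. (\<integral>t. g t * complex_of_real (h (expm t) * mpow (expm t) k) \<partial>orthant_measure) = 0)" for h
  have poly: "S (\<lambda>x. h x * P x)" if "real_polynomial_function P" "S h" for P h
    using that
  proof (induction P arbitrary: h rule: real_polynomial_function.induct)
    case (linear f)
    have h: "continuous_on K h" using linear by (simp add: S_def)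
    have fx: "f x = (\<Sum>l\<in>UNIV. x $ l * f (axis l 1))" for x
    proof -
      have "f x = f (\<Sum>l\<in>UNIV. x $ l *\<^sub>R axis l 1)"
        using basis_expansion[of x] by (simp add: scalar_mult_eq_scaleR)
      also have "\<dots> = (\<Sum>l\<in>UNIV. x $ l * f (axis l 1))"
        using linear(1) by (simp add: linear_sum bounded_linear.linear linear_scale)
      finally show ?thesis .
    qed
    have step: "x $ l * mpow x k = mpow x (k(l := Suc (k l)))" for x :: "real ^ 'd" and k l
      using mpow_remove[of x _ l] by simp
    have "(\<integral>t. g t * complex_of_real (h (expm t) * f (expm t) * mpow (expm t) k) \<partial>orthant_measure) = 0" for k
    proof -
      have eq: "g t * complex_of_real (h (expm t) * f (expm t) * mpow (expm t) k)
        = (\<Sum>l\<in>UNIV. complex_of_real (f (axis l 1)) * (g t * complex_of_real (h (expm t) * mpow (expm t) (k(l := Suc (k l))))))" for t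
        unfolding fx[of "expm t"] step[symmetric] by (simp add: sum_distrib_left sum_distrib_right mult_ac)
      have "integrable orthant_measure (\<lambda>t. g t * complex_of_real (h (expm t) * mpow (expm t) (k(l := Suc (k l)))))" for l
        by (rule int[of "\<lambda>x. h x * mpow x (k(l := Suc (k l)))"]) (intro continuous_intros h cont_mpow)
      then show ?thesis unfolding eq using linear(2)
        by (subst Bochner_Integration.integral_sum) (auto simp: S_def)
    qed
    moreover have "continuous_on K (\<lambda>x. h x * f x)"
      by (intro continuous_on_mult h linear_continuous_on linear(1))
    ultimately show ?case by (simp add: S_def)
  next
    case (const c)
    have eq: "g t * complex_of_real (h (expm t) * c * mpow (expm t) k)
       = c * (g t * complex_of_real (h (expm t) * mpow (expm t) k))" for t k by simp
    have "(\<integral>t. g t * complex_of_real (h (expm t) * c * mpow (expm t) k) \<partial>orthant_measure)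
       = c * (\<integral>t. g t * complex_of_real (h (expm t) * mpow (expm t) k) \<partial>orthant_measure)" for k
      unfolding eq by (rule integral_mult_right_zero)
    then show ?case using const by (auto simp: S_def intro!: continuous_intros)
  next
    case (add P Q)
    have a: "continuous_on K (\<lambda>x. h x * P x)" "continuous_on K (\<lambda>x. h x * Q x)"
      using add.IH[OF add.prems] by (auto simp: S_def)
    have i: "integrable orthant_measure (\<lambda>t. g t * complex_of_real (h (expm t) * P (expm t) * mpow (expm t) k))"
      "integrable orthant_measure (\<lambda>t. g t * complex_of_real (h (expm t) * Q (expm t) * mpow (expm t) k))" for k
      by (rule int[OF continuous_on_mult[OF a(1) cont_mpow]], rule int[OF continuous_on_mult[OF a(2) cont_mpow]])
    have eq: "g t * complex_of_real (h (expm t) * (P (expm t) + Q (expm t)) * mpow (expm t) k)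
      = g t * complex_of_real (h (expm t) * P (expm t) * mpow (expm t) k)
      + g t * complex_of_real (h (expm t) * Q (expm t) * mpow (expm t) k)" for t k
      by (simp add: algebra_simps)
    have "(\<integral>t. g t * complex_of_real (h (expm t) * (P (expm t) + Q (expm t)) * mpow (expm t) k) \<partial>orthant_measure) = 0" for k
      unfolding eq Bochner_Integration.integral_add[OF i] using add.IH[OF add.prems] by (simp add: S_def)
    moreover have "continuous_on K (\<lambda>x. h x * (P x + Q x))"
      unfolding distrib_left by (intro continuous_on_add a)
    ultimately show ?case by (simp add: S_def)
  next
    case (mult P Q)
    from mult.IH(2)[OF mult.IH(1)[OF mult.prems]] show ?case by (simp add: mult.assoc)
  qed
  have S1: "S (\<lambda>_. 1)" using moments by (simp add: S_def)
  have poly0: "(\<integral>t. g t * complex_of_real (P (expm t)) \<partial>orthant_measure) = 0" "continuous_on K P"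
    if "real_polynomial_function P" for P
  proof -
    have SP: "S P" using poly[OF that S1] by simp
    then have "(\<integral>t. g t * complex_of_real (P (expm t) * mpow (expm t) (\<lambda>_. 0)) \<partial>orthant_measure) = 0"
      unfolding S_def by blast
    then show "(\<integral>t. g t * complex_of_real (P (expm t)) \<partial>orthant_measure) = 0" by (simp add: mpow_def)
    show "continuous_on K P" using SP by (simp add: S_def)
  qed
  have cont0: "(\<integral>t. g t * complex_of_real (\<phi> (expm t)) \<partial>orthant_measure) = 0" if \<phi>: "continuous_on K \<phi>" for \<phi>
  proof -
    let ?I = "\<integral>t. g t * complex_of_real (\<phi> (expm t)) \<partial>orthant_measure"
    have main: "cmod ?I \<le> e * (1 + (\<integral>t. cmod (g t) \<partial>orthant_measure))" if e: "e > 0" for e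
    proof -
      obtain P where P: "real_polynomial_function P" "\<And>x. x \<in> K \<Longrightarrow> \<bar>\<phi> x - P x\<bar> < e"
        using Stone_Weierstrass_real_polynomial_function[OF K \<phi> e] by blast
      have "?I = ?I - (\<integral>t. g t * complex_of_real (P (expm t)) \<partial>orthant_measure)" using poly0(1)[OF P(1)] by simp
      also have "\<dots> = (\<integral>t. g t * complex_of_real (\<phi> (expm t)) - g t * complex_of_real (P (expm t)) \<partial>orthant_measure)"
        by (rule Bochner_Integration.integral_diff[symmetric]) (intro int \<phi> poly0(2)[OF P(1)])+
      also have "\<dots> = (\<integral>t. g t * complex_of_real (\<phi> (expm t) - P (expm t)) \<partial>orthant_measure)"
        by (simp add: algebra_simps)
      also have "cmod \<dots> \<le> (\<integral>t. cmod (g t * complex_of_real (\<phi> (expm t) - P (expm t))) \<partial>orthant_measure)"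
        by (rule integral_norm_bound)
      also have "\<dots> \<le> (\<integral>t. e * cmod (g t) \<partial>orthant_measure)"
      proof (rule integral_mono)
        show "integrable orthant_measure (\<lambda>t. cmod (g t * complex_of_real (\<phi> (expm t) - P (expm t))))"
          by (intro integrable_norm int[of "\<lambda>x. \<phi> x - P x"] continuous_intros \<phi> poly0(2)[OF P(1)])
        show "integrable orthant_measure (\<lambda>t. e * cmod (g t))" using g by simp
        fix t assume "t \<in> space (orthant_measure :: (real ^ 'd) measure)"
        then have "\<bar>\<phi> (expm t) - P (expm t)\<bar> \<le> e" using P(2)[OF inK[of t]] by simp
        then show "cmod (g t * complex_of_real (\<phi> (expm t) - P (expm t))) \<le> e * cmod (g t)"
          unfolding norm_mult norm_of_real by (subst mult.commute) (rule mult_right_mono, auto)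
      qed
      also have "\<dots> \<le> e * (1 + (\<integral>t. cmod (g t) \<partial>orthant_measure))" using e by simp
      finally show ?thesis .
    qed
    define N where "N = 1 + (\<integral>t. cmod (g t) \<partial>orthant_measure)"
    have N: "N > 0" unfolding N_def by (intro add_pos_nonneg Bochner_Integration.integral_nonneg) auto
    have "cmod ?I \<le> 0 + e" if "e > 0" for e
    proof -
      have "e / N > 0" using N that by simp
      from main[OF this, folded N_def] show ?thesis using N by simp
    qed
    then have "cmod ?I \<le> 0" by (rule field_le_epsilon)
    then show ?thesis by simp
  qed
  have total: "integral\<^sup>L orthant_measure g = 0"
    using cont0[of "\<lambda>_. 1"] by simp
  have sets_int: "set_integrable orthant_measure B g" if "B \<in> sets borel" for B
  proof -
    have "integrable orthant_measure (\<lambda>x. indicator (B \<inter> pos_orthant) x *\<^sub>R g x)"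
      using g that by (intro integrable_mult_indicator) (auto simp: sets_restrict_space_iff intro: sets_completionI_sets)
    then show ?thesis unfolding set_integrable_def
      by (rule Bochner_Integration.integrable_cong[THEN iffD1, rotated -1]) (auto simp: indicator_def)
  qed
  have open_int: "set_lebesgue_integral orthant_measure V g = 0" if V: "open V" for V
  proof -
    (* The image of the part of V in the orthant under t |-> e^(-t). *)
    define U where "U = {x :: real ^ 'd. (\<forall>l. 0 < x $ l \<and> x $ l < 1) \<and> (\<chi> l. - ln (x $ l)) \<in> V}"
    have "open U"
    proof -
      define U0 where "U0 = {x :: real ^ 'd. \<forall>l. 0 < x $ l \<and> x $ l < 1}"
      have "open U0" unfolding U0_def Collect_all_eq
        by (intro open_INT ballI open_Collect_conj open_Collect_less continuous_intros) auto
      moreover have nz: "x $ l \<noteq> 0" if "x \<in> U0" for x :: "real ^ 'd" and l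
        using that unfolding U0_def by (metis (mono_tags, lifting) mem_Collect_eq less_irrefl)
      have "continuous_on U0 (\<lambda>x. (\<chi> l. - ln (x $ l)) :: real ^ 'd)"
        by (intro continuous_intros ballI nz)
      ultimately have "open ((\<lambda>x. (\<chi> l. - ln (x $ l)) :: real ^ 'd) -` V \<inter> U0)"
        using V by (simp add: continuous_on_open_vimage)
      moreover have "(\<lambda>x. (\<chi> l. - ln (x $ l)) :: real ^ 'd) -` V \<inter> U0 = U" by (auto simp: U_def U0_def)
      ultimately show ?thesis by simp
    qed
    have mem_U: "expm t \<in> U \<longleftrightarrow> t \<in> V" if "t \<in> pos_orthant" for t
    proof -
      have "(\<chi> l. - ln (expm t $ l)) = t" by (simp add: vec_eq_iff)
      moreover have "0 < expm t $ l \<and> expm t $ l < 1" for l using that by (simp add: pos_orthant_def)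
      ultimately show ?thesis unfolding U_def by (simp only: mem_Collect_eq simp_thms)
    qed
    have "(0 :: real ^ 'd) \<notin> U" by (simp add: U_def)
    then have cl: "closed (- U)" "- U \<noteq> {}" using \<open>open U\<close> by auto
    (* Continuous functions that increase to the indicator of U. *)
    define \<phi> where "\<phi> j x = min 1 (real j * infdist x (- U))" for j :: nat and x
    have \<phi>: "continuous_on K (\<phi> j)" for j unfolding \<phi>_def by (intro continuous_intros)
    have lim: "(\<lambda>j. \<phi> j x) \<longlonglongrightarrow> indicator U x" for x
    proof (cases "x \<in> U")
      case True
      then have d: "infdist x (- U) > 0" using infdist_pos_not_in_closed[OF cl] by simp
      obtain N :: nat where N: "1 / infdist x (- U) < real N" using reals_Archimedean2 by blast
      have "\<phi> j x = 1" if "j \<ge> N" for j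
      proof -
        have "1 / infdist x (- U) < real j" using N that by (meson le_less_trans less_le_trans of_nat_mono)
        then show ?thesis using d by (simp add: \<phi>_def field_simps)
      qed
      then have "\<forall>\<^sub>F j in sequentially. \<phi> j x = 1" by (auto simp: eventually_sequentially)
      then show ?thesis using True by (simp add: tendsto_eventually)
    next
      case False
      then show ?thesis by (simp add: \<phi>_def)
    qed
    have "(\<lambda>j. \<integral>t. g t * complex_of_real (\<phi> j (expm t)) \<partial>orthant_measure) \<longlonglongrightarrow>
        (\<integral>t. indicator V t *\<^sub>R g t \<partial>orthant_measure)"
    proof (rule integral_dominated_convergence[where w = "\<lambda>t. cmod (g t)"])
      show "(\<lambda>t. indicator V t *\<^sub>R g t) \<in> borel_measurable orthant_measure"
        using sets_int[of V] V by (auto simp: set_integrable_def)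
      show "(\<lambda>t. g t * complex_of_real (\<phi> j (expm t))) \<in> borel_measurable orthant_measure" for j
        using int[OF \<phi>[of j]] by auto
      show "integrable orthant_measure (\<lambda>t. cmod (g t))" using g by simp
      have "(\<lambda>j. g t * complex_of_real (\<phi> j (expm t))) \<longlonglongrightarrow> indicator V t *\<^sub>R g t" if t: "t \<in> pos_orthant" for t
      proof -
        have "(\<lambda>j. g t * complex_of_real (\<phi> j (expm t))) \<longlonglongrightarrow> g t * complex_of_real (indicator U (expm t))"
          by (intro tendsto_intros lim)
        moreover have "g t * complex_of_real (indicator U (expm t)) = indicator V t *\<^sub>R g t"
          using mem_U[OF t] by (simp add: indicator_def)
        ultimately show ?thesis by simp
      qed
      then show "AE t in orthant_measure. (\<lambda>j. g t * complex_of_real (\<phi> j (expm t))) \<longlonglongrightarrow> indicator V t *\<^sub>R g t"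
        by (intro AE_I2) simp
      have "\<bar>\<phi> j x\<bar> \<le> 1" for j x by (simp add: \<phi>_def infdist_nonneg)
      then have "norm (g t * complex_of_real (\<phi> j (expm t))) \<le> cmod (g t)" for j t
        by (simp add: norm_mult mult_left_le)
      then show "AE t in orthant_measure. norm (g t * complex_of_real (\<phi> j (expm t))) \<le> cmod (g t)" for j
        by (intro AE_I2)
    qed
    then show ?thesis unfolding cont0[OF \<phi>] by (simp add: LIMSEQ_const_iff set_lebesgue_integral_def)
  qed
  have borel_int: "set_lebesgue_integral orthant_measure B g = 0" if "B \<in> sets borel" for B
  proof -
    have sb: "sets (borel :: (real ^ 'd) measure) = sigma_sets UNIV (Collect open)"
      by (simp add: borel_def)
    have "Int_stable (Collect open :: (real ^ 'd) set set)" by (auto simp: Int_stable_def)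
    moreover have "(Collect open :: (real ^ 'd) set set) \<subseteq> Pow UNIV" by simp
    moreover have "B \<in> sigma_sets UNIV (Collect open)" using that by (simp only: sb)
    ultimately show ?thesis
    (* The sets over which the integral vanishes form a Dynkin system containing the open
       sets. *)
    proof (induction rule: sigma_sets_induct_disjoint)
      case (basic A)
      then show ?case using open_int by simp
    next
      case empty
      show ?case by (simp add: set_lebesgue_integral_def)
    next
      case (compl A)
      have A: "A \<in> sets borel" using compl by (simp only: sb)
      have "integral\<^sup>L orthant_measure g = set_lebesgue_integral orthant_measure (A \<union> (UNIV - A)) g"
        unfolding set_lebesgue_integral_def by (rule Bochner_Integration.integral_cong) auto
      also have "\<dots> = set_lebesgue_integral orthant_measure A g + set_lebesgue_integral orthant_measure (UNIV - A) g"
        using A by (intro set_integral_Un sets_int) auto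
      finally show ?case using compl total by simp
    next
      case (union A)
      have A: "A i \<in> sets borel" for i using union(2) unfolding sb by blast
      have "set_lebesgue_integral orthant_measure (\<Union>i. A i \<inter> pos_orthant) g
         = (\<Sum>i. set_lebesgue_integral orthant_measure (A i \<inter> pos_orthant) g)"
      proof (rule lebesgue_integral_countable_add)
        show "A i \<inter> pos_orthant \<in> sets orthant_measure" for i
          using A[of i] by (auto simp: sets_restrict_space_iff intro: sets_completionI_sets)
        show "(A i \<inter> pos_orthant) \<inter> (A j \<inter> pos_orthant) = {}" if "i \<noteq> j" for i j
          using union(1) that by (auto simp: disjoint_family_on_def)
        show "set_integrable orthant_measure (\<Union>i. A i \<inter> pos_orthant) g"
          using A by (intro sets_int) auto
      qed
      moreover have "set_lebesgue_integral orthant_measure (C \<inter> pos_orthant) g = set_lebesgue_integral orthant_measure C g" for C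
        unfolding set_lebesgue_integral_def by (intro Bochner_Integration.integral_cong) (auto simp: indicator_def)
      ultimately show ?case using union(3) by (simp flip: UN_extend_simps(4))
    qed
  qed
  show ?thesis
  proof (rule sigma_finite_measure.density_zero[OF sigma_finite_orthant_measure g])
    fix A assume "A \<in> sets (orthant_measure :: (real ^ 'd) measure)"
    then have A: "A \<in> sets lebesgue" "A \<subseteq> pos_orthant" by (auto simp: sets_restrict_space_iff)
    obtain B N N' where B: "A = B \<union> N" "N \<subseteq> N'" "N' \<in> null_sets lborel" "B \<in> sets lborel"
      using sets_completionE[OF A(1)] by blast
    have "N' \<in> null_sets lebesgue" using B(3) by (simp add: null_sets_completionI)
    then have "AE t in lebesgue. t \<notin> N'" by (rule AE_not_in)
    then have ae: "AE t in orthant_measure. t \<notin> N'"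
      by (auto simp: AE_restrict_space_iff elim: eventually_mono)
    have "set_lebesgue_integral orthant_measure A g = set_lebesgue_integral orthant_measure B g"
      unfolding set_lebesgue_integral_def
    proof (rule integral_cong_AE)
      show "(\<lambda>t. indicator A t *\<^sub>R g t) \<in> borel_measurable orthant_measure"
        using \<open>A \<in> sets orthant_measure\<close> g by measurable
      show "(\<lambda>t. indicator B t *\<^sub>R g t) \<in> borel_measurable orthant_measure"
        using sets_int[of B] B(4) by (auto simp: set_integrable_def)
      show "AE t in orthant_measure. indicator A t *\<^sub>R g t = indicator B t *\<^sub>R g t"
        using ae by eventually_elim (use B in \<open>auto simp: indicator_def\<close>)
    qed
    also have "\<dots> = 0" using borel_int B(4) by simp
    finally show "set_lebesgue_integral orthant_measure A g = 0" .
  qed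
qed

text \<open>
  All values of \<open>F_disc f\<close> vanish. At a suitable real point of the polydisc the
  kernel of \<open>F_disc\<close> is \<open>\<Prod>_l e^(-(k_l+1) t_l)\<close>, so all
  moments of \<open>f(t) e^(-(t_1+...+t_d))\<close> vanish; the extra exponential makes this
  function integrable.
\<close>

lemma laguerre_coeff_eq_0_imp_AE_eq_0:
  fixes f :: "real ^ 'd::finite \<Rightarrow> complex"
  assumes f: "f \<in> L2" and coeff: "\<And>n. laguerre_coeff f n = 0"
  shows "AE t in orthant_measure. f t = 0"
proof -
  define g where "g t = f t * complex_of_real (\<Prod>l\<in>UNIV. exp (- (t $ l)))" for t
  have "AE t in orthant_measure. g t = 0"
  proof (rule AE_eq_0_if_Laplace_moments_eq_0)
    show "integrable orthant_measure g" unfolding g_def by (rule integrable_L2_exp[OF f])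
    fix k :: "'d \<Rightarrow> nat"
    define z where "z l = real (k l) + 1" for l
    (* w solves (1 + w) / (2 (1 - w)) = z = k + 1 in every coordinate. *)
    define w :: "complex ^ 'd" where "w = (\<chi> l. complex_of_real ((2 * z l - 1) / (2 * z l + 1)))"
    have w: "w \<in> polydisc"
    proof -
      have "cmod (w $ l) = (2 * z l - 1) / (2 * z l + 1)" for l
        unfolding w_def vec_lambda_beta norm_of_real by (simp add: z_def)
      moreover have "(2 * z l - 1) / (2 * z l + 1) < 1" for l by (simp add: z_def)
      ultimately show ?thesis by (simp add: polydisc_def)
    qed
    have wz: "(1 / 2) * ((1 + w $ l) / (1 - w $ l)) = complex_of_real (z l)" for l
    proof -
      have "(1 / 2) * ((1 + (2 * z l - 1) / (2 * z l + 1)) / (1 - (2 * z l - 1) / (2 * z l + 1))) = z l"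
        by (simp add: z_def field_simps)
      moreover have "(1 / 2) * ((1 + complex_of_real q) / (1 - complex_of_real q))
          = complex_of_real ((1 / 2) * ((1 + q) / (1 - q)))" for q by simp
      ultimately show ?thesis unfolding w_def vec_lambda_beta by (simp only:)
    qed
    have "g t * complex_of_real (mpow (expm t) k)
       = f t * (\<Prod>l\<in>UNIV. exp (- (1 / 2) * ((1 + w $ l) / (1 - w $ l)) * complex_of_real (t $ l)))" for t
    proof -
      have "exp (- (1 / 2) * ((1 + w $ l) / (1 - w $ l)) * complex_of_real (t $ l))
          = complex_of_real (exp (- (t $ l)) * exp (- (t $ l)) ^ k l)" for l
      proof -
        have "- (1 / 2) * ((1 + w $ l) / (1 - w $ l)) * complex_of_real (t $ l) = complex_of_real (- z l * t $ l)"
        proof -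
          have "- (1 / 2) * ((1 + w $ l) / (1 - w $ l)) * complex_of_real (t $ l)
              = - ((1 / 2) * ((1 + w $ l) / (1 - w $ l)) * complex_of_real (t $ l))"
            by (simp only: minus_mult_left)
          then show ?thesis unfolding wz by simp
        qed
        moreover have "exp (- z l * t $ l) = exp (- (t $ l)) * exp (- (t $ l)) ^ k l"
          by (simp add: z_def algebra_simps flip: exp_of_nat_mult exp_add)
        ultimately show ?thesis by (simp only: exp_of_real)
      qed
      then show ?thesis by (simp add: g_def mpow_def prod.distrib)
    qed
    then have "(\<integral>t. g t * complex_of_real (mpow (expm t) k) \<partial>orthant_measure) = F_disc f w"
      by (simp add: F_disc_def)
    also have "\<dots> = 0" using F_disc_eq_disc_series[OF f w] by (simp add: disc_series_def coeff)
    finally show "(\<integral>t. g t * complex_of_real (mpow (expm t) k) \<partial>orthant_measure) = 0" .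
  qed
  then show ?thesis by eventually_elim (simp add: g_def)
qed

section \<open>Subexponential decay\<close>

lemma self_pow_eq: "self_pow \<beta> p = (\<Prod>l\<in>UNIV. (real (p l) ^ p l) powr \<beta>)"
  unfolding self_pow_def
proof (intro prod.cong refl)
  fix l
  show "(if p l = 0 then 1 else real (p l) powr (\<beta> * real (p l))) = (real (p l) ^ p l) powr \<beta>"
    by (cases "p l = 0") (auto simp: powr_realpow[symmetric] powr_powr mult.commute)
qed

lemma power_mdeg: "B ^ mdeg p = (\<Prod>l\<in>UNIV. (B :: 'a :: comm_semiring_1) ^ p l)"
  by (simp add: mdeg_def power_sum)

lemma self_power_ge_1: "1 \<le> real n ^ n"
  by (cases "n = 0") (simp, intro one_le_power, simp)

lemma power_Suc_self_le: "real (Suc q) ^ Suc q \<le> exp 1 * 2 ^ q * real q ^ q"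
proof (cases "q = 0")
  case True
  then show ?thesis using exp_ge_add_one_self[of 1] by simp
next
  case False
  have "real (Suc q) ^ q = (1 + 1 / real q) ^ q * real q ^ q"
    using False by (simp add: power_mult_distrib[symmetric] field_simps)
  also have "(1 + 1 / real q) ^ q \<le> exp (1 / real q) ^ q"
    by (intro power_mono exp_ge_add_one_self) auto
  also have "exp (1 / real q) ^ q = exp 1" using False by (simp flip: exp_of_nat_mult)
  finally have 1: "real (Suc q) ^ q \<le> exp 1 * real q ^ q" by (simp add: mult_right_mono)
  have "real (Suc q) \<le> 2 ^ q" using self_le_ge2_pow[of 2 "Suc q"] by (metis Suc_leI less_exp of_nat_le_iff of_nat_numeral of_nat_power)
  then have "real (Suc q) * real (Suc q) ^ q \<le> 2 ^ q * (exp 1 * real q ^ q)"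
    using 1 by (intro mult_mono) auto
  then show ?thesis by (simp add: mult_ac)
qed

lemma power_add_2_self_le: "real (q + 2) ^ (q + 2) \<le> 2 * exp 2 * 4 ^ q * real q ^ q"
proof -
  have "real (Suc (Suc q)) ^ Suc (Suc q) \<le> exp 1 * 2 ^ Suc q * real (Suc q) ^ Suc q" by (rule power_Suc_self_le)
  also have "\<dots> \<le> exp 1 * 2 ^ Suc q * (exp 1 * 2 ^ q * real q ^ q)"
    by (intro mult_left_mono power_Suc_self_le) auto
  also have "\<dots> = 2 * (exp 1 * exp 1) * (2 ^ q * 2 ^ q) * real q ^ q" by simp
  also have "\<dots> = 2 * exp 2 * 4 ^ q * real q ^ q" by (simp flip: exp_add power_mult_distrib)
  finally show ?thesis by simp
qed

lemma power_add_self_le: "real (p + k) ^ (p + k) \<le> (2 * exp 1) ^ (p + k) * (real p ^ p * real k ^ k)"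
proof -
  have fact_ge: "real n ^ n \<le> exp 1 ^ n * fact n" for n
  proof -
    have "real n ^ n /\<^sub>R fact n \<le> exp (real n)"
      using sum_le_suminf[of "\<lambda>i. real n ^ i /\<^sub>R fact i" "{n}"] exp_converges[of "real n"] by (simp add: sums_iff)
    then show ?thesis by (simp add: field_simps flip: exp_of_nat_mult)
  qed
  have fact_le: "fact n \<le> real n ^ n" for n
    using fact_le_power[of n, where 'a = real] by simp
  have "fact (p + k) = real ((p + k) choose p) * fact p * fact k"
    using binomial_fact[of p "p + k", where 'a = real] by simp
  also have "\<dots> \<le> 2 ^ (p + k) * real p ^ p * real k ^ k"
  proof (intro mult_mono fact_le)
    show "real ((p + k) choose p) \<le> 2 ^ (p + k)"
      using of_nat_mono[OF binomial_le_pow2[of "p + k" p], where 'a = real] by simp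
  qed auto
  finally have "exp 1 ^ (p + k) * fact (p + k) \<le> exp 1 ^ (p + k) * (2 ^ (p + k) * real p ^ p * real k ^ k)"
    by (intro mult_left_mono) auto
  also have "\<dots> = (2 * exp 1) ^ (p + k) * (real p ^ p * real k ^ k)"
    by (simp add: power_mult_distrib)
  finally show ?thesis using fact_ge[of "p + k"] by linarith
qed

lemma power_split_self_le: "j \<le> p \<Longrightarrow> real j ^ j * real (p - j) ^ (p - j) \<le> real p ^ p"
  using mult_mono[of "real j ^ j" "real p ^ j" "real (p - j) ^ (p - j)" "real p ^ (p - j)"]
  by (simp add: power_mono flip: power_add)

text \<open>
  The maximum over \<open>x\<close>, up to the factor \<open>e^(-\<alpha>r)\<close>.
\<close>

lemma powr_exp_le:
  fixes \<alpha> \<delta> r x :: real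
  assumes "x \<ge> 0" "r > 0" "\<delta> > 0" "\<alpha> > 0"
  shows "x powr r * exp (- \<delta> * x powr (1 / \<alpha>)) \<le> (\<alpha> * r / \<delta>) powr (\<alpha> * r)"
proof (cases "x = 0")
  case False
  define y where "y = x powr (1 / \<alpha>)"
  define s where "s = \<alpha> * r"
  have s: "s > 0" using assms by (simp add: s_def)
  have y: "y > 0" using False assms by (simp add: y_def)
  have "x powr r = y powr s" using assms by (simp add: y_def s_def powr_powr)
  have "\<delta> * y / s \<le> exp (\<delta> * y / s)" using exp_ge_add_one_self[of "\<delta> * y / s"] by linarith
  then have "(\<delta> * y / s) powr s \<le> exp (\<delta> * y / s) powr s" using assms y s by (intro powr_mono2) auto
  also have "\<dots> = exp (\<delta> * y)" using s by (simp add: powr_def)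
  finally have "(\<delta> * y / s) powr s \<le> exp (\<delta> * y)" .
  moreover have "y powr s = (s / \<delta>) powr s * (\<delta> * y / s) powr s"
    using assms y s by (subst powr_mult[symmetric]) auto
  ultimately have "y powr s \<le> (s / \<delta>) powr s * exp (\<delta> * y)" by (simp add: mult_left_mono)
  then show ?thesis using \<open>x powr r = y powr s\<close> by (simp add: exp_minus y_def s_def field_simps)
qed auto

definition subexp :: "real \<Rightarrow> real \<Rightarrow> nat \<Rightarrow> real"
  where "subexp \<alpha> \<delta> j = exp (- \<delta> * real j powr (1 / \<alpha>))"

lemma subexp_pos: "subexp \<alpha> \<delta> j > 0" by (simp add: subexp_def)

lemma subexp_double: "subexp \<alpha> \<delta> j = subexp \<alpha> (\<delta> / 2) j * subexp \<alpha> (\<delta> / 2) j"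
  by (simp add: subexp_def flip: exp_add)

lemma summable_subexp:
  assumes "\<delta> > 0" "\<alpha> > 0"
  shows "subexp \<alpha> \<delta> summable_on UNIV"
proof -
  define K where "K = (\<alpha> * 2 / \<delta>) powr (\<alpha> * 2)"
  have "summable (\<lambda>j. K * inverse (real (Suc j) ^ 2))"
    using summable_Suc_iff[of "\<lambda>j. inverse (real j ^ 2)"] inverse_power_summable[of 2, where 'a = real]
    by (intro summable_mult) simp_all
  then have "summable (\<lambda>j. subexp \<alpha> \<delta> (Suc j))"
  proof (rule summable_comparison_test')
    fix j :: nat
    have "real (Suc j) powr 2 * subexp \<alpha> \<delta> (Suc j) \<le> K"
      unfolding subexp_def K_def using assms by (intro powr_exp_le) auto
    then show "norm (subexp \<alpha> \<delta> (Suc j)) \<le> K * inverse (real (Suc j) ^ 2)"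
      using subexp_pos[of \<alpha> \<delta> "Suc j"] by (simp add: field_simps del: of_nat_Suc)
  qed
  then have "summable (subexp \<alpha> \<delta>)" by (simp add: summable_Suc_iff)
  then show ?thesis by (intro summable_nonneg_imp_summable_on) (auto intro: less_imp_le subexp_pos)
qed

lemma subexp_moment:
  assumes "\<delta> > 0" "\<alpha> > 0"
  shows "\<exists>A>0. \<forall>N j. subexp \<alpha> \<delta> j * sqrt (real j) ^ N \<le> A ^ N * (real N ^ N) powr (\<alpha> / 2)"
proof (intro exI conjI allI)
  define A where "A = (\<alpha> / (2 * \<delta>)) powr (\<alpha> / 2)"
  show "A > 0" using assms by (simp add: A_def)
  fix N j
  show "subexp \<alpha> \<delta> j * sqrt (real j) ^ N \<le> A ^ N * (real N ^ N) powr (\<alpha> / 2)"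
  proof (cases "N = 0 \<or> j = 0")
    case True
    then consider "N = 0" | "j = 0" "N > 0" by auto
    then show ?thesis
    proof cases
      case 1
      then show ?thesis using assms by (simp add: subexp_def)
    next
      case 2
      then show ?thesis using \<open>A > 0\<close> by (simp add: zero_power)
    qed
  next
    case False
    then have "sqrt (real j) ^ N = real j powr (real N / 2)"
      by (simp add: powr_half_sqrt[symmetric] powr_realpow[symmetric] powr_powr)
    then have "subexp \<alpha> \<delta> j * sqrt (real j) ^ N \<le> (\<alpha> * (real N / 2) / \<delta>) powr (\<alpha> * (real N / 2))"
      unfolding subexp_def using powr_exp_le[of "real j" "real N / 2" \<delta> \<alpha>] assms False by (simp add: mult.commute)
    also have "\<dots> = (\<alpha> / (2 * \<delta>) * real N) powr (\<alpha> / 2 * real N)" by (simp add: field_simps)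
    also have "\<dots> = (\<alpha> / (2 * \<delta>)) powr (\<alpha> / 2 * real N) * real N powr (\<alpha> / 2 * real N)"
      by (rule powr_mult)
    also have "\<dots> = A ^ N * (real N ^ N) powr (\<alpha> / 2)"
      using False assms by (simp add: A_def powr_realpow[symmetric] powr_powr mult_ac)
    finally show ?thesis .
  qed
qed

text \<open>
  Half of the exponent bounds the powers, the other half makes the series converge.
\<close>

lemma subexp_sum_sqrt:
  assumes "\<delta> > 0" "\<alpha> > 0"
  shows "\<exists>A>0. \<exists>D>0. \<forall>N. (\<lambda>j. subexp \<alpha> \<delta> j * sqrt (real j) ^ N) summable_on UNIV \<and>
     infsum (\<lambda>j. subexp \<alpha> \<delta> j * sqrt (real j) ^ N) UNIV \<le> D * A ^ N * (real N ^ N) powr (\<alpha> / 2)"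
proof -
  obtain A where A: "A > 0" "\<And>N j. subexp \<alpha> (\<delta> / 2) j * sqrt (real j) ^ N \<le> A ^ N * (real N ^ N) powr (\<alpha> / 2)"
    using subexp_moment[of "\<delta> / 2" \<alpha>] assms by auto
  have s: "subexp \<alpha> (\<delta> / 2) summable_on UNIV" using assms by (intro summable_subexp) auto
  define D where "D = 1 + infsum (subexp \<alpha> (\<delta> / 2)) UNIV"
  have D: "D > 0" unfolding D_def by (intro add_pos_nonneg infsum_nonneg) (auto intro: less_imp_le subexp_pos)
  have le: "subexp \<alpha> \<delta> j * sqrt (real j) ^ N \<le> (A ^ N * (real N ^ N) powr (\<alpha> / 2)) * subexp \<alpha> (\<delta> / 2) j" for N j
    using mult_right_mono[OF A(2)[of j N] less_imp_le[OF subexp_pos[of \<alpha> "\<delta> / 2" j]]]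
    by (subst subexp_double) (simp add: mult_ac)
  have s': "(\<lambda>j. (A ^ N * (real N ^ N) powr (\<alpha> / 2)) * subexp \<alpha> (\<delta> / 2) j) summable_on UNIV" for N
    using s by (rule summable_on_cmult_right)
  have nn: "0 \<le> subexp \<alpha> \<delta> j * sqrt (real j) ^ N" for j N by (simp add: less_imp_le subexp_pos)
  have "(\<lambda>j. subexp \<alpha> \<delta> j * sqrt (real j) ^ N) summable_on UNIV" for N
    by (rule summable_on_comparison_test[OF s' le nn])
  moreover have "infsum (\<lambda>j. subexp \<alpha> \<delta> j * sqrt (real j) ^ N) UNIV \<le> D * A ^ N * (real N ^ N) powr (\<alpha> / 2)" for N
  proof -
    have "infsum (\<lambda>j. subexp \<alpha> \<delta> j * sqrt (real j) ^ N) UNIV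
        \<le> infsum (\<lambda>j. (A ^ N * (real N ^ N) powr (\<alpha> / 2)) * subexp \<alpha> (\<delta> / 2) j) UNIV"
      by (intro infsum_mono calculation s' le)
    also have "\<dots> = (A ^ N * (real N ^ N) powr (\<alpha> / 2)) * infsum (subexp \<alpha> (\<delta> / 2)) UNIV"
      by (rule infsum_cmult_right')
    also have "\<dots> \<le> (A ^ N * (real N ^ N) powr (\<alpha> / 2)) * D"
      using A(1) by (intro mult_left_mono) (auto simp: D_def)
    finally show ?thesis by (simp add: mult_ac)
  qed
  ultimately show ?thesis using A D by blast
qed

lemma subexp_sum_power:
  assumes "\<delta> > 0" "\<alpha> > 0"
  shows "\<exists>A>0. \<exists>D>0. \<forall>p. (\<lambda>j. subexp \<alpha> \<delta> j * real j ^ p) summable_on UNIV \<and>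
     infsum (\<lambda>j. subexp \<alpha> \<delta> j * real j ^ p) UNIV \<le> D * A ^ p * (real p ^ p) powr \<alpha>"
proof -
  obtain A D where A: "A > 0" "D > 0" "\<And>N. (\<lambda>j. subexp \<alpha> \<delta> j * sqrt (real j) ^ N) summable_on UNIV"
     "\<And>N. infsum (\<lambda>j. subexp \<alpha> \<delta> j * sqrt (real j) ^ N) UNIV \<le> D * A ^ N * (real N ^ N) powr (\<alpha> / 2)"
    using subexp_sum_sqrt[OF assms] by metis
  define A' where "A' = A\<^sup>2 * 2 powr \<alpha>"
  have eq: "sqrt (real j) ^ (2 * p) = real j ^ p" for j p by (simp add: power_mult)
  have "A ^ (2 * p) * (real (2 * p) ^ (2 * p)) powr (\<alpha> / 2) = A' ^ p * (real p ^ p) powr \<alpha>" for p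
  proof -
    have "real (2 * p) ^ (2 * p) = (2 ^ p * real p ^ p) ^ 2"
      by (simp add: power_mult_distrib power_mult[symmetric] mult.commute)
    also have "\<dots> powr (\<alpha> / 2) = (2 ^ p * real p ^ p) powr \<alpha>"
    proof -
      have "(x ^ 2) powr (\<alpha> / 2) = x powr \<alpha>" if "x > 0" for x :: real
        using that by (simp add: powr_powr flip: powr_numeral)
      moreover have "2 ^ p * real p ^ p > 0" using self_power_ge_1[of p] by (intro mult_pos_pos) (auto intro: less_le_trans[of 0 1])
      ultimately show ?thesis by blast
    qed
    also have "\<dots> = (2 powr \<alpha>) ^ p * (real p ^ p) powr \<alpha>"
      by (simp add: powr_mult powr_realpow[symmetric] powr_powr mult.commute)
    finally show ?thesis by (simp add: A'_def power_mult_distrib power_mult)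
  qed
  moreover have "A' > 0" using A(1) by (simp add: A'_def)
  ultimately show ?thesis using A(2) A(3)[of "2 * p" for p] A(4)[of "2 * p" for p] unfolding eq
    by (intro exI[of _ A'] conjI exI[of _ D]) (auto simp: mult.assoc)
qed

text \<open>
  The form in which the bounds of \<open>lag_weighted_bound\<close> are summed against the
  coefficients: the shift by \<open>q + 2\<close> only changes the constants, because
  \<open>(j+q+2)^((q+2)/2)\<close> is at most \<open>2^((q+2)/2)\<close> times
  \<open>j^((q+2)/2) + (q+2)^((q+2)/2)\<close>, and the second summand is at most
  \<open>(q+2)^(\<alpha>(q+2)/2)\<close> as \<open>1 \<le> \<alpha>\<close>.
\<close>

lemma subexp_sum_shifted:
  assumes "\<delta> > 0" "\<alpha> \<ge> 1"
  shows "\<exists>A>0. \<exists>D>0. \<forall>q. (\<lambda>j. subexp \<alpha> \<delta> j * sqrt (real (j + q + 2)) ^ (q + 2)) summable_on UNIV \<and>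
     infsum (\<lambda>j. subexp \<alpha> \<delta> j * sqrt (real (j + q + 2)) ^ (q + 2)) UNIV \<le> D * A ^ q * (real q ^ q) powr (\<alpha> / 2)"
proof -
  have a0: "\<alpha> > 0" using assms by simp
  obtain A D where A: "A > 0" "D > 0" "\<And>N. (\<lambda>j. subexp \<alpha> \<delta> j * sqrt (real j) ^ N) summable_on UNIV"
     "\<And>N. infsum (\<lambda>j. subexp \<alpha> \<delta> j * sqrt (real j) ^ N) UNIV \<le> D * A ^ N * (real N ^ N) powr (\<alpha> / 2)"
    using subexp_sum_sqrt[OF assms(1) a0] by metis
  let ?f = "\<lambda>q j. subexp \<alpha> \<delta> j * sqrt (real (j + q + 2)) ^ (q + 2)"
  let ?g = "\<lambda>q j. sqrt 2 ^ (q + 2) * (subexp \<alpha> \<delta> j * sqrt (real j) ^ (q + 2)) + sqrt 2 ^ (q + 2) * sqrt (real (q + 2)) ^ (q + 2) * (subexp \<alpha> \<delta> j * sqrt (real j) ^ 0)"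
  have le: "?f q j \<le> ?g q j" for q j
  proof -
    have "sqrt (real (j + q + 2)) ^ (q + 2) \<le> sqrt 2 ^ (q + 2) * sqrt (real j) ^ (q + 2) + sqrt 2 ^ (q + 2) * sqrt (real (q + 2)) ^ (q + 2)"
    proof -
      have "sqrt (real (j + q + 2)) ^ (q + 2) \<le> sqrt (2 * max (real j) (real (q + 2))) ^ (q + 2)"
        by (intro power_mono real_sqrt_le_mono) (auto simp: max_def)
      also have "\<dots> \<le> sqrt 2 ^ (q + 2) * sqrt (real j) ^ (q + 2) + sqrt 2 ^ (q + 2) * sqrt (real (q + 2)) ^ (q + 2)"
      proof -
        define h where "h x = sqrt 2 ^ (q + 2) * sqrt x ^ (q + 2)" for x
        have "h (real j) \<ge> 0" "h (real (q + 2)) \<ge> 0" unfolding h_def by (intro mult_nonneg_nonneg; simp)+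
        then have "h (max (real j) (real (q + 2))) \<le> h (real j) + h (real (q + 2))" by (simp add: max_def)
        then show ?thesis by (simp only: h_def real_sqrt_mult power_mult_distrib)
      qed
      finally show ?thesis .
    qed
    from mult_left_mono[OF this, of "subexp \<alpha> \<delta> j"] subexp_pos[of \<alpha> \<delta> j] show ?thesis
      by (simp add: algebra_simps)
  qed
  have nn: "0 \<le> ?f q j" for q j by (simp add: less_imp_le subexp_pos)
  have sg: "?g q summable_on UNIV" for q
    by (intro summable_on_add summable_on_cmult_right A(3))
  have sf: "?f q summable_on UNIV" for q by (rule summable_on_comparison_test[OF sg le nn])
  define B where "B = sqrt 2 * max A 1"
  define E where "E = (2 * exp 2) powr (\<alpha> / 2)"
  define A' where "A' = B * 4 powr (\<alpha> / 2)"
  have B: "B \<ge> 1" "sqrt 2 \<le> B" "sqrt 2 * A \<le> B"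
    by (auto simp: B_def intro: mult_left_mono order_trans[OF _ mult_mono[of 1 "sqrt 2" 1 "max A 1"]])
  have bound: "infsum (?f q) UNIV \<le> (2 * D * B\<^sup>2 * E) * A' ^ q * (real q ^ q) powr (\<alpha> / 2)" for q
  proof -
    let ?P = "(real (q + 2) ^ (q + 2)) powr (\<alpha> / 2)"
    have "infsum (?f q) UNIV \<le> infsum (?g q) UNIV" by (intro infsum_mono sf sg le)
    also have "\<dots> = sqrt 2 ^ (q + 2) * infsum (\<lambda>j. subexp \<alpha> \<delta> j * sqrt (real j) ^ (q + 2)) UNIV
        + sqrt 2 ^ (q + 2) * sqrt (real (q + 2)) ^ (q + 2) * infsum (\<lambda>j. subexp \<alpha> \<delta> j * sqrt (real j) ^ 0) UNIV"
      by (subst infsum_add) (intro summable_on_cmult_right A(3) | simp only: infsum_cmult_right')+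
    also have "\<dots> \<le> sqrt 2 ^ (q + 2) * (D * A ^ (q + 2) * ?P) + sqrt 2 ^ (q + 2) * ?P * D"
    proof (intro add_mono mult_mono A(4))
      have "sqrt (real (q + 2)) ^ (q + 2) = (real (q + 2) ^ (q + 2)) powr (1 / 2)"
        using powr_half_sqrt[of "real (q + 2) ^ (q + 2)"] by (simp only: real_sqrt_power of_nat_0_le_iff zero_le_power)
      also have "\<dots> \<le> ?P" using assms self_power_ge_1[of "q + 2"] by (intro powr_mono) auto
      finally show "sqrt (real (q + 2)) ^ (q + 2) \<le> ?P" .
      show "infsum (\<lambda>j. subexp \<alpha> \<delta> j * sqrt (real j) ^ 0) UNIV \<le> D" using A(4)[of 0] by simp
    qed (auto intro!: infsum_nonneg mult_nonneg_nonneg less_imp_le[OF subexp_pos])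
    also have "\<dots> \<le> B ^ (q + 2) * (D * ?P) + B ^ (q + 2) * (D * ?P)"
    proof (intro add_mono)
      have "(sqrt 2 * A) ^ (q + 2) * (D * ?P) \<le> B ^ (q + 2) * (D * ?P)"
        using B A(1,2) by (intro mult_right_mono power_mono) auto
      then show "sqrt 2 ^ (q + 2) * (D * A ^ (q + 2) * ?P) \<le> B ^ (q + 2) * (D * ?P)"
        by (simp only: power_mult_distrib mult_ac)
      have "sqrt 2 ^ (q + 2) * (D * ?P) \<le> B ^ (q + 2) * (D * ?P)"
        using B A(1,2) by (intro mult_right_mono power_mono) auto
      then show "sqrt 2 ^ (q + 2) * ?P * D \<le> B ^ (q + 2) * (D * ?P)" by (simp only: mult_ac)
    qed
    also have "\<dots> = 2 * D * B\<^sup>2 * B ^ q * ?P" by (simp add: power_add power2_eq_square)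
    also have "?P \<le> (2 * exp 2 * 4 ^ q * real q ^ q) powr (\<alpha> / 2)"
    proof (rule powr_mono2)
      show "real (q + 2) ^ (q + 2) \<le> 2 * exp 2 * 4 ^ q * real q ^ q" by (rule power_add_2_self_le)
    qed (use assms in auto)
    also have "\<dots> = E * (4 powr (\<alpha> / 2)) ^ q * (real q ^ q) powr (\<alpha> / 2)"
      by (simp add: E_def powr_mult powr_realpow[symmetric] powr_powr mult.commute)
    finally show ?thesis using A(2) B by (simp add: A'_def power_mult_distrib mult_ac mult_left_mono)
  qed
  have "A' > 0" "2 * D * B\<^sup>2 * E > 0" using A B by (auto simp: A'_def E_def)
  then show ?thesis using sf bound by blast
qed

section \<open>Optimizing the order of differentiation\<close>

text \<open>
  From \<open>(n/p)^p \<le> n choose p\<close> and \<open>p^p \<le> e^p p!\<close>.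
\<close>

lemma fact_ratio_le:
  assumes "p \<le> n" "n > 0"
  shows "fact (n - p) / fact n \<le> (exp 1 / real n) ^ p"
proof (cases "p = 0")
  case False
  have "(real p ^ p) /\<^sub>R fact p \<le> exp (real p)"
    using sum_le_suminf[of "\<lambda>i. real p ^ i /\<^sub>R fact i" "{p}"] exp_converges[of "real p"] by (simp add: sums_iff)
  then have 1: "real p ^ p \<le> exp 1 ^ p * fact p" by (simp add: field_simps flip: exp_of_nat_mult)
  have 2: "(real n / real p) ^ p \<le> real (n choose p)" using binomial_ge_n_over_k_pow_k[OF assms(1), where 'a = real] .
  have "real n ^ p = (real n / real p) ^ p * real p ^ p" using False by (simp flip: power_mult_distrib)
  also have "\<dots> \<le> real (n choose p) * (exp 1 ^ p * fact p)" using 1 2 by (intro mult_mono) auto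
  also have "\<dots> = exp 1 ^ p * (fact n / fact (n - p))"
    using binomial_fact[OF assms(1), where 'a = real] by (simp add: field_simps)
  finally show ?thesis using assms by (simp add: power_divide field_simps)
qed simp

text \<open>
  By \<open>fact_ratio_le\<close> the left-hand side is at most \<open>(B p^\<alpha> e /
  n)^p\<close>. The largest \<open>p\<close> with \<open>B p^\<alpha> e / n \<le>
  1/e\<close> makes it at most \<open>e^(-p)\<close>, and this \<open>p\<close> is the
  integer part of a multiple of \<open>n^(1/\<alpha>)\<close>.
\<close>

lemma optimal_order:
  assumes "B > 0" "\<alpha> \<ge> 1"
  shows "\<exists>\<delta>>0. \<forall>n. \<exists>p\<le>n. B ^ p * (real p ^ p) powr \<alpha> * (fact (n - p) / fact n) \<le> exp 1 * subexp \<alpha> \<delta> n"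
proof -
  define B' where "B' = max B 1"
  define K where "K = B' * exp 2"
  define \<delta> where "\<delta> = (1 / K) powr (1 / \<alpha>)"
  have B': "B' \<ge> 1" "B \<le> B'" by (auto simp: B'_def)
  have K: "K \<ge> 1" using mult_mono[of 1 B' 1 "exp 2"] B' by (simp add: K_def)
  have \<delta>: "\<delta> > 0" using K by (simp add: \<delta>_def)
  have main: "\<exists>p\<le>n. B ^ p * (real p ^ p) powr \<alpha> * (fact (n - p) / fact n) \<le> exp 1 * subexp \<alpha> \<delta> n" for n
  proof -
    define y where "y = (real n / K) powr (1 / \<alpha>)"
    define p where "p = nat \<lfloor>y\<rfloor>"
    have y0: "y \<ge> 0" by (simp add: y_def)
    have p: "real p \<le> y" "y < real p + 1" unfolding p_def using y0 by (auto simp: of_nat_nat)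
    have yd: "y = \<delta> * real n powr (1 / \<alpha>)"
      using K by (simp add: y_def \<delta>_def powr_mult[symmetric])
    have sub: "subexp \<alpha> \<delta> n = exp (- y)" by (simp add: subexp_def yd)
    show ?thesis
    proof (cases "p = 0")
      case True
      then have "1 \<le> exp 1 * exp (- y)" using p by (simp flip: exp_add)
      then show ?thesis using True by (intro exI[of _ 0]) (simp add: sub)
    next
      case False
      then have n: "n > 0" using p by (cases n) (auto simp: y_def)
      have pa: "real p powr \<alpha> \<le> real n / K"
      proof -
        have "real p powr \<alpha> \<le> y powr \<alpha>" using p assms by (intro powr_mono2) auto
        also have "\<dots> = real n / K" using assms K by (simp add: y_def powr_powr)
        finally show ?thesis .
      qed
      have "real p \<le> real p powr \<alpha>" using powr_mono[of 1 \<alpha> "real p"] False assms by simp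
      also have "\<dots> \<le> real n / K" by (rule pa)
      also have "\<dots> \<le> real n / 1" using K by (intro divide_left_mono) auto
      finally have pn: "p \<le> n" by simp
      have "B ^ p * (real p ^ p) powr \<alpha> * (fact (n - p) / fact n)
          \<le> B' ^ p * (real p powr \<alpha>) ^ p * (exp 1 / real n) ^ p"
      proof (intro mult_mono fact_ratio_le pn n power_mono)
        show "(real p ^ p) powr \<alpha> \<le> (real p powr \<alpha>) ^ p"
          using False by (simp add: powr_realpow[symmetric] powr_powr mult.commute)
      qed (use B' assms in auto)
      also have "\<dots> = (B' * (real p powr \<alpha>) * (exp 1 / real n)) ^ p" by (simp only: power_mult_distrib)
      also have "\<dots> \<le> exp (- 1) ^ p"
      proof (rule power_mono)
        have "B' * (real p powr \<alpha>) * (exp 1 / real n) \<le> B' * (real n / K) * (exp 1 / real n)"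
          using pa B' by (intro mult_right_mono mult_left_mono) auto
        also have "\<dots> = exp (- 1)" using n B' by (simp add: K_def exp_minus field_simps flip: exp_add)
        finally show "B' * (real p powr \<alpha>) * (exp 1 / real n) \<le> exp (- 1)" .
      qed (use B' in auto)
      also have "\<dots> = exp (- real p)" by (simp flip: exp_of_nat_mult)
      also have "\<dots> \<le> exp 1 * exp (- y)" using p by (simp flip: exp_add)
      finally show ?thesis using pn by (auto simp: sub)
    qed
  qed
  show ?thesis using main \<delta> by blast
qed

text \<open>
  Condition (i) in product form, which can be handled coordinate by coordinate.
\<close>

definition decays :: "real \<Rightarrow> ('d::finite mindex \<Rightarrow> complex) \<Rightarrow> bool"
  where "decays \<alpha> a \<longleftrightarrow> (\<exists>C>0. \<exists>\<delta>>0. \<forall>n. cmod (a n) \<le> C * (\<Prod>l\<in>UNIV. subexp \<alpha> \<delta> (n l)))"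

text \<open>
  The order is optimized in every coordinate separately; this is possible because the bound
  is assumed for all \<open>p \<le> n\<close> and has product form.
\<close>

lemma decaysI_optimal_order:
  fixes a :: "'d::finite mindex \<Rightarrow> complex"
  assumes "B > 0" "\<alpha> \<ge> 1" "C > 0"
    and bound: "\<And>n p. (\<And>l. p l \<le> n l) \<Longrightarrow>
      cmod (a n) \<le> C * (\<Prod>l\<in>UNIV. B ^ p l * (real (p l) ^ p l) powr \<alpha> * (fact (n l - p l) / fact (n l)))"
  shows "decays \<alpha> a"
proof -
  obtain \<delta> where \<delta>: "\<delta> > 0"
    "\<forall>n. \<exists>p\<le>n. B ^ p * (real p ^ p) powr \<alpha> * (fact (n - p) / fact n) \<le> exp 1 * subexp \<alpha> \<delta> n"
    using optimal_order[OF assms(1,2)] by blast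
  then obtain P where P: "\<And>n. P n \<le> n"
    "\<And>n. B ^ P n * (real (P n) ^ P n) powr \<alpha> * (fact (n - P n) / fact n) \<le> exp 1 * subexp \<alpha> \<delta> n"
    by metis
  have "cmod (a n) \<le> (C * exp 1 ^ CARD('d)) * (\<Prod>l\<in>UNIV. subexp \<alpha> \<delta> (n l))" for n
  proof -
    have "cmod (a n) \<le> C * (\<Prod>l\<in>UNIV. B ^ P (n l) * (real (P (n l)) ^ P (n l)) powr \<alpha> * (fact (n l - P (n l)) / fact (n l)))"
      by (rule bound) (rule P)
    also have "\<dots> \<le> C * (\<Prod>l\<in>UNIV. exp 1 * subexp \<alpha> \<delta> (n l))"
      using assms by (intro mult_left_mono prod_mono conjI P mult_nonneg_nonneg) auto
    finally show ?thesis by (simp add: prod.distrib)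
  qed
  then show ?thesis unfolding decays_def using \<delta>(1) assms(3)
    by (intro exI[of _ "C * exp 1 ^ CARD('d)"] conjI exI[of _ \<delta>]) auto
qed

text \<open>
  For two summands, scaling to \<open>u + v = 1\<close> reduces the claim to \<open>z \<le>
  z^r\<close> on the unit interval.
\<close>

lemma powr_sum_le:
  fixes f :: "'a \<Rightarrow> real"
  assumes "finite S" "0 < r" "r \<le> 1" "\<And>x. x \<in> S \<Longrightarrow> f x \<ge> 0"
  shows "(sum f S) powr r \<le> (\<Sum>x\<in>S. f x powr r)"
  using assms(1,4)
proof (induction S rule: finite_induct)
  case (insert x S)
  have two: "(u + v) powr r \<le> u powr r + v powr r" if "u \<ge> 0" "v \<ge> 0" for u v :: real
  proof (cases "u + v = 0")
    case True
    then show ?thesis using that by simp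
  next
    case False
    have le: "z \<le> z powr r" if "0 \<le> z" "z \<le> 1" for z :: real
      using powr_mono'[of r 1 z] that assms by (cases "z = 0") auto
    have "1 = u / (u + v) + v / (u + v)" using False by (simp flip: add_divide_distrib)
    also have "\<dots> \<le> (u / (u + v)) powr r + (v / (u + v)) powr r"
      using that False by (intro add_mono le) (auto simp: field_simps)
    also have "\<dots> = (u powr r + v powr r) / (u + v) powr r"
      using that by (simp add: powr_divide add_divide_distrib)
    finally show ?thesis using that False by (simp add: field_simps)
  qed
  have "sum f (insert x S) powr r \<le> f x powr r + sum f S powr r"
    using insert by (auto intro!: two sum_nonneg)
  then show ?case using insert by fastforce
qed simp

lemma decays_iff:
  fixes a :: "'d::finite mindex \<Rightarrow> complex"
  assumes "\<alpha> \<ge> 1"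
  shows "(\<exists>c>0. \<exists>b>1. \<forall>n. cmod (a n) \<le> c * b powr (- (real (mdeg n) powr (1 / \<alpha>)))) \<longleftrightarrow> decays \<alpha> a"
proof
  assume "\<exists>c>0. \<exists>b>1. \<forall>n. cmod (a n) \<le> c * b powr (- (real (mdeg n) powr (1 / \<alpha>)))"
  then obtain c b where cb: "c > 0" "b > 1" "\<And>n. cmod (a n) \<le> c * b powr (- (real (mdeg n) powr (1 / \<alpha>)))" by blast
  (* The sum of the n_l^(1/\<alpha>) is at most CARD times |n|^(1/\<alpha>). *)
  define \<delta> where "\<delta> = ln b / real CARD('d)"
  have \<delta>: "\<delta> > 0" using cb by (simp add: \<delta>_def)
  have "cmod (a n) \<le> c * (\<Prod>l\<in>UNIV. subexp \<alpha> \<delta> (n l))" for n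
  proof -
    have "(\<Sum>l\<in>UNIV. real (n l) powr (1 / \<alpha>)) \<le> (\<Sum>l\<in>(UNIV :: 'd set). real (mdeg n) powr (1 / \<alpha>))"
      using assms by (intro sum_mono powr_mono2) (auto simp: mdeg_def intro!: member_le_sum)
    then have "\<delta> * (\<Sum>l\<in>UNIV. real (n l) powr (1 / \<alpha>)) \<le> \<delta> * (real CARD('d) * real (mdeg n) powr (1 / \<alpha>))"
      using \<delta> by (intro mult_left_mono) auto
    also have "\<dots> = ln b * real (mdeg n) powr (1 / \<alpha>)" by (simp add: \<delta>_def)
    finally have "b powr (- (real (mdeg n) powr (1 / \<alpha>))) \<le> exp (- (\<delta> * (\<Sum>l\<in>UNIV. real (n l) powr (1 / \<alpha>))))"
      using cb by (simp add: powr_def mult.commute)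
    also have "\<dots> = (\<Prod>l\<in>UNIV. subexp \<alpha> \<delta> (n l))"
      by (simp add: subexp_def exp_sum[symmetric] sum_distrib_left sum_negf)
    finally show ?thesis using cb(3)[of n] cb(1) by (meson mult_left_mono less_imp_le order_trans)
  qed
  then show "decays \<alpha> a" unfolding decays_def using cb(1) \<delta> by blast
next
  assume "decays \<alpha> a"
  then obtain C \<delta> where C: "C > 0" "\<delta> > 0" "\<And>n. cmod (a n) \<le> C * (\<Prod>l\<in>UNIV. subexp \<alpha> \<delta> (n l))"
    unfolding decays_def by blast
  have "cmod (a n) \<le> C * exp \<delta> powr (- (real (mdeg n) powr (1 / \<alpha>)))" for n
  proof -
    have "(\<Prod>l\<in>UNIV. subexp \<alpha> \<delta> (n l)) = exp (- (\<delta> * (\<Sum>l\<in>UNIV. real (n l) powr (1 / \<alpha>))))"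
      by (simp add: subexp_def exp_sum[symmetric] sum_distrib_left sum_negf)
    also have "\<dots> \<le> exp (- (\<delta> * real (mdeg n) powr (1 / \<alpha>)))"
      using powr_sum_le[of "UNIV :: 'd set" "1 / \<alpha>" "\<lambda>l. real (n l)"] assms C(2) by (simp add: mdeg_def)
    also have "\<dots> = exp \<delta> powr (- (real (mdeg n) powr (1 / \<alpha>)))" by (simp add: powr_def)
    finally show ?thesis using C(3)[of n] C(1) by (meson mult_left_mono less_imp_le order_trans)
  qed
  moreover have "exp \<delta> > 1" using C by simp
  ultimately show "\<exists>c>0. \<exists>b>1. \<forall>n. cmod (a n) \<le> c * b powr (- (real (mdeg n) powr (1 / \<alpha>)))" using C(1) by blast
qed

section \<open>Power series on the polydisc\<close>

lemma mpow_upd: "mpow x (n(l := j)) = (x $ l) ^ j * (\<Prod>i\<in>UNIV-{l}. (x $ i) ^ n i)"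
  by (subst mpow_remove[of _ _ l]) simp

text \<open>
  Replaces one coordinate, so that one-variable results can be applied in direction
  \<open>l\<close>.
\<close>

definition vupd :: "'a ^ 'd \<Rightarrow> 'd \<Rightarrow> 'a \<Rightarrow> 'a ^ 'd::finite"
  where "vupd w l z = (\<chi> i. if i = l then z else w $ i)"

lemma vupd_nth [simp]: "vupd w l z $ i = (if i = l then z else w $ i)" by (simp add: vupd_def)

lemma vupd_same [simp]: "vupd w l (w $ l) = w" by (simp add: vec_eq_iff)

lemma vupd_polydisc: "w \<in> polydisc \<Longrightarrow> norm z < 1 \<Longrightarrow> vupd w l z \<in> polydisc"
  by (simp add: polydisc_def)

lemma mpow_vupd: "mpow (vupd w l z) n = z ^ n l * (\<Prod>i\<in>UNIV-{l}. (w $ i) ^ n i)"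
  by (subst mpow_remove[of _ _ l]) simp

lemma has_sum_mindex_shift:
  fixes g :: "('d::finite \<Rightarrow> nat) \<Rightarrow> 'b::{comm_monoid_add,topological_space}"
  shows "((\<lambda>n. if n l = 0 then 0 else g (n(l := n l - 1))) has_sum S) UNIV \<longleftrightarrow> (g has_sum S) UNIV"
proof -
  have bij: "bij_betw (\<lambda>n :: 'd \<Rightarrow> nat. n(l := Suc (n l))) UNIV {n. n l \<noteq> 0}"
    by (rule bij_betwI[where g = "\<lambda>n. n(l := n l - 1)"]) auto
  have "((\<lambda>n. if n l = 0 then 0 else g (n(l := n l - 1))) has_sum S) UNIV
     \<longleftrightarrow> ((\<lambda>n. if n l = 0 then 0 else g (n(l := n l - 1))) has_sum S) {n. n l \<noteq> 0}"
    by (rule has_sum_cong_neutral) auto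
  also have "\<dots> \<longleftrightarrow> (g has_sum S) UNIV"
    unfolding has_sum_reindex_bij_betw[OF bij, symmetric] by simp
  finally show ?thesis .
qed

lemma summable_on_mindex_shift:
  fixes g :: "('d::finite \<Rightarrow> nat) \<Rightarrow> 'b::{comm_monoid_add,topological_space}"
  shows "(\<lambda>n. if n l = 0 then 0 else g (n(l := n l - 1))) summable_on UNIV \<longleftrightarrow> g summable_on UNIV"
  unfolding summable_on_def has_sum_mindex_shift ..

text \<open>
  Reduced to the theorem on series of functions indexed by the natural numbers, along an
  enumeration of the multi-indices; the majorant gives the uniform convergence of the
  derivatives.
\<close>

lemma has_derivative_infsum_mindex:
  fixes f :: "('d::finite \<Rightarrow> nat) \<Rightarrow> 'a::real_normed_vector \<Rightarrow> complex"
  assumes S: "convex S" "open S"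
    and deriv: "\<And>n x. x \<in> S \<Longrightarrow> (f n has_derivative f' n x) (at x)"
    and M: "\<And>n x h. x \<in> S \<Longrightarrow> norm (f' n x h) \<le> M n * norm h" "\<And>n. M n \<ge> 0" "M summable_on UNIV"
    and sum: "\<And>x. x \<in> S \<Longrightarrow> (\<lambda>n. f n x) summable_on UNIV"
    and x: "x \<in> S"
  shows "((\<lambda>x. \<Sum>\<^sub>\<infinity>n. f n x) has_derivative (\<lambda>h. \<Sum>\<^sub>\<infinity>n. f' n x h)) (at x)"
proof -
  obtain e :: "nat \<Rightarrow> ('d \<Rightarrow> nat)" where e: "bij e" using ex_mindex_enumeration by blast
  have sums: "(\<lambda>i. F (e i)) sums infsum F UNIV" if "F summable_on UNIV" for F :: "('d \<Rightarrow> nat) \<Rightarrow> complex"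
    using has_sum_infsum[OF that] has_sum_reindex_bij_betw[OF e, of F] by (intro has_sum_imp_sums) blast
  have Me: "summable (\<lambda>i. M (e i))"
    using summable_on_reindex_bij_betw[OF e, of M] M(3) by (intro summable_on_imp_summable) blast
  have f'_sum: "(\<lambda>n. f' n x h) summable_on UNIV" if "x \<in> S" for x h
    by (rule abs_summable_summable, rule summable_on_comparison_test[OF summable_on_cmult_left[OF M(3), of "norm h"]])
       (use M(1)[OF that] in auto)
  have "\<exists>g. \<forall>x\<in>S. (\<lambda>i. f (e i) x) sums g x \<and> (g has_derivative (\<lambda>h. \<Sum>\<^sub>\<infinity>n. f' n x h)) (at x within S)"
  proof (rule has_derivative_series[OF S(1), where f' = "\<lambda>i. f' (e i)"])
    show "(f (e i) has_derivative f' (e i) x) (at x within S)" if "x \<in> S" for i x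
      using deriv[OF that] by (rule has_derivative_at_withinI)
    show "\<forall>\<^sub>F n in sequentially. \<forall>x\<in>S. \<forall>h. norm ((\<Sum>i<n. f' (e i) x h) - (\<Sum>\<^sub>\<infinity>n. f' n x h)) \<le> \<epsilon> * norm h"
      if "\<epsilon> > 0" for \<epsilon>
    proof -
      have "\<forall>\<^sub>F n in sequentially. norm (\<Sum>i. M (e (i + n))) < \<epsilon>"
        using suminf_exist_split[OF that Me] by (auto simp: eventually_sequentially)
      then show ?thesis
      proof eventually_elim
        case (elim n)
        show ?case
        proof (intro ballI allI)
          fix x h assume x: "x \<in> S"
          have s: "(\<lambda>i. f' (e i) x h) sums (\<Sum>\<^sub>\<infinity>n. f' n x h)" by (rule sums[OF f'_sum[OF x]])
          have Ms: "summable (\<lambda>i. M (e (i + n)) * norm h)"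
            using summable_ignore_initial_segment[OF Me, of n] by (rule summable_mult2)
          have ns: "summable (\<lambda>i. norm (f' (e (i + n)) x h))"
            by (rule summable_comparison_test'[OF Ms, of 0]) (use M(1)[OF x] in auto)
          have "(\<Sum>\<^sub>\<infinity>n. f' n x h) - (\<Sum>i<n. f' (e i) x h) = (\<Sum>i. f' (e (i + n)) x h)"
            using suminf_minus_initial_segment[of "\<lambda>i. f' (e i) x h" n] s by (simp add: sums_iff)
          then have "norm ((\<Sum>i<n. f' (e i) x h) - (\<Sum>\<^sub>\<infinity>n. f' n x h)) = norm (\<Sum>i. f' (e (i + n)) x h)"
            by (metis norm_minus_commute)
          also have "\<dots> \<le> (\<Sum>i. norm (f' (e (i + n)) x h))" by (rule summable_norm[OF ns])
          also have "\<dots> \<le> (\<Sum>i. M (e (i + n)) * norm h)" using M(1)[OF x] by (intro suminf_le ns Ms) auto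
          also have "\<dots> = (\<Sum>i. M (e (i + n))) * norm h"
            using summable_ignore_initial_segment[OF Me, of n] by (rule suminf_mult2[symmetric])
          also have "\<dots> \<le> \<epsilon> * norm h" using elim by (intro mult_right_mono) auto
          finally show "norm ((\<Sum>i<n. f' (e i) x h) - (\<Sum>\<^sub>\<infinity>n. f' n x h)) \<le> \<epsilon> * norm h" .
        qed
      qed
    qed
    show "x \<in> S" by fact
    show "(\<lambda>i. f (e i) x) sums infsum (\<lambda>n. f n x) UNIV" by (rule sums[OF sum[OF x]])
  qed
  then obtain g where g: "\<And>x. x \<in> S \<Longrightarrow> (\<lambda>i. f (e i) x) sums g x"
    "\<And>x. x \<in> S \<Longrightarrow> (g has_derivative (\<lambda>h. \<Sum>\<^sub>\<infinity>n. f' n x h)) (at x within S)" by blast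
  have gy: "g y = (\<Sum>\<^sub>\<infinity>n. f n y)" if "y \<in> S" for y
    using g(1)[OF that] sums[OF sum[OF that]] by (rule sums_unique2)
  have "(g has_derivative (\<lambda>h. \<Sum>\<^sub>\<infinity>n. f' n x h)) (at x)"
    using g(2)[OF x] by (simp only: at_within_open[OF x S(2)])
  from this S(2) x gy show ?thesis by (rule has_derivative_transform_within_open)
qed

text \<open>
  The power series with coefficients \<open>c\<close>; unlike \<open>disc_series\<close> it
  carries no factor \<open>\<Prod>_l (1 - w_l)\<close>.
\<close>

definition gser :: "('d::finite mindex \<Rightarrow> complex) \<Rightarrow> complex ^ 'd \<Rightarrow> complex"
  where "gser c w = (\<Sum>\<^sub>\<infinity>n. c n * mpow w n)"

text \<open>
  Polynomial growth of the coefficients guarantees absolute convergence on the polydisc and,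
  in contrast to boundedness, is preserved by differentiation. The binomial coefficients are
  those of \<open>1 / (1 - w)^(k+1)\<close>.
\<close>

definition poly_growth :: "('d::finite mindex \<Rightarrow> complex) \<Rightarrow> bool"
  where "poly_growth c \<longleftrightarrow> (\<exists>k K. K \<ge> 0 \<and> (\<forall>n. cmod (c n) \<le> K * (\<Prod>l\<in>UNIV. real ((k + n l) choose (n l)))))"

lemma poly_growth_bounded:
  assumes "\<And>n. cmod (c n) \<le> K" shows "poly_growth c"
proof -
  have "K \<ge> 0" using assms[of undefined] norm_ge_zero by (rule order_trans[rotated])
  then show ?thesis unfolding poly_growth_def using assms by (intro exI[of _ 0] exI[of _ K]) auto
qed

lemma summable_poly_growth:
  assumes c: "poly_growth c" and w: "w \<in> polydisc"
  shows "(\<lambda>n. cmod (c n * mpow w n)) summable_on UNIV"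
proof -
  obtain k K where K: "K \<ge> 0" "\<And>n. cmod (c n) \<le> K * (\<Prod>l\<in>UNIV. real ((k + n l) choose (n l)))"
    using c unfolding poly_growth_def by blast
  have "(\<lambda>n. \<Prod>l\<in>UNIV. real ((k + n l) choose (n l)) * cmod (w $ l) ^ n l) summable_on UNIV"
    using w sums_inverse_power_one_minus_real[of "cmod (w $ l)" k for l]
    by (intro summable_on_prod_mindex(1) summable_nonneg_imp_summable_on) (auto simp: polydisc_def sums_iff)
  from summable_on_cmult_right[OF this, of K] show ?thesis
  proof (rule summable_on_comparison_test)
    fix n
    have "cmod (c n * mpow w n) = cmod (c n) * (\<Prod>l\<in>UNIV. cmod (w $ l) ^ n l)"
      by (simp add: norm_mult mpow_def norm_power flip: prod_norm)
    also have "\<dots> \<le> K * (\<Prod>l\<in>UNIV. real ((k + n l) choose (n l))) * (\<Prod>l\<in>UNIV. cmod (w $ l) ^ n l)"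
      by (intro mult_right_mono K prod_nonneg) auto
    finally show "cmod (c n * mpow w n) \<le> K * (\<Prod>l\<in>UNIV. real ((k + n l) choose (n l)) * cmod (w $ l) ^ n l)"
      by (simp add: prod.distrib mult.assoc)
  qed auto
qed

lemma has_sum_gser:
  "poly_growth c \<Longrightarrow> w \<in> polydisc \<Longrightarrow> ((\<lambda>n. c n * mpow w n) has_sum gser c w) UNIV"
  unfolding gser_def by (rule has_sum_infsum[OF abs_summable_summable[OF summable_poly_growth]])

text \<open>
  The coefficients of the derivative in direction \<open>l\<close>.
\<close>

definition cshift :: "'d \<Rightarrow> ('d::finite mindex \<Rightarrow> complex) \<Rightarrow> 'd mindex \<Rightarrow> complex"
  where "cshift l c n = of_nat (Suc (n l)) * c (n(l := Suc (n l)))"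

lemma poly_growth_cshift:
  assumes "poly_growth c" shows "poly_growth (cshift l c)"
proof -
  obtain k K where K: "K \<ge> 0" "\<And>n. cmod (c n) \<le> K * (\<Prod>l\<in>UNIV. real ((k + n l) choose (n l)))"
    using assms unfolding poly_growth_def by blast
  have "cmod (cshift l c n) \<le> (K * real (Suc k)) * (\<Prod>i\<in>UNIV. real ((Suc k + n i) choose (n i)))" for n
  proof -
    let ?m = "n(l := Suc (n l))"
    have "Suc (n l) * ((k + Suc (n l)) choose Suc (n l)) = Suc k * ((Suc k + n l) choose n l)"
    proof -
      have "Suc (n l) * (Suc (k + n l) choose Suc (n l)) = Suc (k + n l) * ((k + n l) choose n l)"
        by (rule Suc_times_binomial)
      moreover have "Suc k * (Suc (k + n l) choose n l) = Suc (k + n l) * ((k + n l) choose n l)"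
        using binomial_absorb_comp[of "Suc (k + n l)" "n l"] by (simp only: diff_Suc_1 Suc_diff_le diff_add_inverse2 le_add2)
      ultimately show ?thesis by (simp only: add_Suc add_Suc_right)
    qed
    then have 1: "real (Suc (n l)) * real ((k + Suc (n l)) choose Suc (n l)) = real (Suc k) * real ((Suc k + n l) choose n l)"
      by (metis of_nat_mult)
    have "cmod (cshift l c n) \<le> real (Suc (n l)) * (K * (\<Prod>i\<in>UNIV. real ((k + ?m i) choose (?m i))))"
      unfolding cshift_def norm_mult norm_of_nat by (intro mult_left_mono K) auto
    also have "(\<Prod>i\<in>UNIV. real ((k + ?m i) choose (?m i)))
        = real ((k + Suc (n l)) choose Suc (n l)) * (\<Prod>i\<in>UNIV-{l}. real ((k + n i) choose (n i)))"
      by (subst prod.remove[of _ l]) auto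
    also have "real (Suc (n l)) * (K * (real ((k + Suc (n l)) choose Suc (n l)) * (\<Prod>i\<in>UNIV-{l}. real ((k + n i) choose (n i)))))
        = K * (real (Suc k) * real ((Suc k + n l) choose n l)) * (\<Prod>i\<in>UNIV-{l}. real ((k + n i) choose (n i)))"
      unfolding 1[symmetric] by (simp only: mult_ac)
    also have "\<dots> \<le> K * (real (Suc k) * real ((Suc k + n l) choose n l)) * (\<Prod>i\<in>UNIV-{l}. real ((Suc k + n i) choose (n i)))"
    proof (intro mult_left_mono prod_mono conjI mult_nonneg_nonneg K)
      fix i show "real ((k + n i) choose (n i)) \<le> real ((Suc k + n i) choose (n i))"
        by (cases "n i") auto
    qed auto
    also have "\<dots> = (K * real (Suc k)) * (\<Prod>i\<in>UNIV. real ((Suc k + n i) choose (n i)))"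
      by (subst (2) prod.remove[of _ l]) (auto simp: mult_ac)
    finally show ?thesis .
  qed
  then show ?thesis using K(1) unfolding poly_growth_def
    by (intro exI[of _ "Suc k"] exI[of _ "K * real (Suc k)"]) auto
qed

lemma cpartial_gser:
  assumes c: "poly_growth c" and w: "w \<in> polydisc"
  shows "cpartial l (gser c) w = gser (cshift l c) w"
    and "norm z < 1 \<Longrightarrow> ((\<lambda>z. gser c (vupd w l z)) has_field_derivative gser (cshift l c) (vupd w l z)) (at z)"
proof -
  show deriv: "((\<lambda>z. gser c (vupd w l z)) has_field_derivative gser (cshift l c) (vupd w l z)) (at z)"
    if z: "norm z < 1" for z
  proof -
    (* On the smaller disc of radius \<rho> the differentiated terms are dominated by their
       absolute values at the point \<rho>. *)
    obtain \<rho> where \<rho>: "norm z < \<rho>" "\<rho> < 1" using z dense by blast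
    then have \<rho>0: "\<rho> > 0" using norm_ge_zero[of z] by linarith
    let ?R = "\<lambda>n. \<Prod>i\<in>UNIV-{l}. (w $ i) ^ n i"
    define v where "v = vupd w l (complex_of_real \<rho>)"
    have v: "v \<in> polydisc" unfolding v_def using \<rho> \<rho>0 by (intro vupd_polydisc w) auto
    define f where "f n z = c n * mpow (vupd w l z) n" for n z
    define f' where "f' n z = c n * (of_nat (n l) * z ^ (n l - 1) * ?R n)" for n z
    define M where "M n = cmod (f' n (of_real \<rho>))" for n
    have f'_shift: "f' n z = (if n l = 0 then 0 else (\<lambda>m. cshift l c m * mpow (vupd w l z) m) (n(l := n l - 1)))" for n z
    proof (cases "n l")
      case (Suc j)
      have "?R (n(l := j)) = ?R n" by (intro prod.cong) auto
      moreover have "n(l := Suc j) = n" using Suc by auto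
      ultimately show ?thesis using Suc by (simp add: f'_def cshift_def mpow_vupd)
    qed (simp add: f'_def)
    have "((\<lambda>z. \<Sum>\<^sub>\<infinity>n. f n z) has_derivative (\<lambda>h. \<Sum>\<^sub>\<infinity>n. f' n z * h)) (at z)"
    proof (rule has_derivative_infsum_mindex[where S = "ball 0 \<rho>" and M = M])
      show "(f n has_derivative (\<lambda>h. f' n y * h)) (at y)" for n y
      proof -
        have "(f n has_field_derivative f' n y) (at y)"
          unfolding f_def f'_def mpow_vupd by (auto intro!: derivative_eq_intros)
        then show ?thesis by (simp add: has_field_derivative_def)
      qed
      show "norm (f' n y * h) \<le> M n * norm h" if "y \<in> ball 0 \<rho>" for n y h
      proof -
        have "norm y ^ (n l - 1) \<le> \<rho> ^ (n l - 1)" using that by (intro power_mono) auto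
        then have "norm (f' n y) \<le> M n"
          unfolding M_def f'_def norm_mult norm_power using \<rho>0
          by (intro mult_left_mono mult_right_mono) auto
        then show ?thesis by (simp add: norm_mult mult_right_mono)
      qed
      show "M summable_on UNIV"
      proof -
        have "(\<lambda>m. cmod (cshift l c m * mpow v m)) summable_on UNIV"
          by (intro summable_poly_growth poly_growth_cshift c v)
        then have "(\<lambda>n. if n l = 0 then 0 else (\<lambda>m. cmod (cshift l c m * mpow v m)) (n(l := n l - 1))) summable_on UNIV"
          by (rule summable_on_mindex_shift[of l "\<lambda>m. cmod (cshift l c m * mpow v m)", THEN iffD2])
        moreover have "M = (\<lambda>n. if n l = 0 then 0 else (\<lambda>m. cmod (cshift l c m * mpow v m)) (n(l := n l - 1)))"
          unfolding M_def f'_shift v_def by (auto simp: fun_eq_iff)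
        ultimately show ?thesis by simp
      qed
      show "(\<lambda>n. f n y) summable_on UNIV" if "y \<in> ball 0 \<rho>" for y
        unfolding f_def using that \<rho>
        by (intro abs_summable_summable[OF summable_poly_growth[OF c]] vupd_polydisc[OF w]) auto
    qed (use \<rho> in \<open>auto simp: M_def\<close>)
    moreover have "(\<Sum>\<^sub>\<infinity>n. f' n z * h) = gser (cshift l c) (vupd w l z) * h" for h
    proof -
      have "((\<lambda>n. f' n z) has_sum gser (cshift l c) (vupd w l z)) UNIV"
      proof -
        have "((\<lambda>m. cshift l c m * mpow (vupd w l z) m) has_sum gser (cshift l c) (vupd w l z)) UNIV"
          using z by (intro has_sum_gser poly_growth_cshift c vupd_polydisc w)
        then show ?thesis unfolding f'_shift
          by (rule has_sum_mindex_shift[of l "\<lambda>m. cshift l c m * mpow (vupd w l z) m", THEN iffD2])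
      qed
      then show ?thesis by (intro infsumI has_sum_cmult_left)
    qed
    ultimately show ?thesis by (simp add: has_field_derivative_def f_def gser_def)
  qed
  have eq: "w + z *s axis l 1 = vupd w l (w $ l + z)" for z
    by (simp add: vec_eq_iff axis_def)
  have "norm (w $ l) < 1" using w by (simp add: polydisc_def)
  from deriv[OF this] have "((\<lambda>z. gser c (vupd w l (w $ l + z))) has_field_derivative gser (cshift l c) w) (at 0)"
    using DERIV_shift[of "\<lambda>z. gser c (vupd w l z)" "gser (cshift l c) w" 0 "w $ l"] by (simp add: add.commute)
  then show "cpartial l (gser c) w = gser (cshift l c) w"
    unfolding cpartial_def eq by (rule DERIV_imp_deriv)
qed

lemma cpartial_cong:
  assumes "\<And>w. w \<in> polydisc \<Longrightarrow> F w = G w" and w: "w \<in> polydisc"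
  shows "cpartial l F w = cpartial l G w"
  unfolding cpartial_def
proof (rule deriv_cong_ev[OF _ refl])
  have "\<forall>\<^sub>F z in nhds 0. z \<in> ball 0 (1 - norm (w $ l))"
    using w by (intro eventually_nhds_in_open) (auto simp: polydisc_def)
  then show "\<forall>\<^sub>F z in nhds 0. F (w + z *s axis l 1) = G (w + z *s axis l 1)"
  proof eventually_elim
    case (elim z)
    have "norm (w $ l + z) < 1" using elim norm_triangle_ineq[of "w $ l" z] by simp
    then have "w + z *s axis l 1 \<in> polydisc" using w by (auto simp: polydisc_def axis_def)
    then show ?case by (rule assms(1))
  qed
qed

text \<open>
  Termwise differentiation in all directions; each coefficient collects the factor
  \<open>(n+p)!/n!\<close>.
\<close>

lemma cD_eq_gser:
  assumes F: "\<And>w. w \<in> polydisc \<Longrightarrow> F w = gser c w" and c: "poly_growth c" and w: "w \<in> polydisc"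
  shows "cD p F w = gser (\<lambda>n. (\<Prod>l\<in>UNIV. fact (n l + p l) / fact (n l)) * c (\<lambda>l. n l + p l)) w"
    and "poly_growth (\<lambda>n. (\<Prod>l\<in>UNIV. fact (n l + p l) / fact (n l)) * c (\<lambda>l. n l + p l))"
proof -
  have iter: "poly_growth ((cshift l ^^ k) c') \<and> (\<forall>w\<in>polydisc. (cpartial l ^^ k) F' w = gser ((cshift l ^^ k) c') w)"
    if "poly_growth c'" "\<forall>w\<in>polydisc. F' w = gser c' w" for l :: 'a and k c' F'
  proof (induction k)
    case (Suc k)
    then show ?case
      using cpartial_cong[of "(cpartial l ^^ k) F'" "gser ((cshift l ^^ k) c')"] cpartial_gser(1)
      by (auto intro: poly_growth_cshift)
  qed (use that in auto)
  have fold: "poly_growth (foldr (\<lambda>l. cshift l ^^ p l) ls c) \<and>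
     (\<forall>w\<in>polydisc. foldr (\<lambda>l. cpartial l ^^ p l) ls F w = gser (foldr (\<lambda>l. cshift l ^^ p l) ls c) w)" for ls
    by (induction ls) (use F c iter in auto)
  have cs: "(cshift l ^^ k) c' n = fact (n l + k) / fact (n l) * c' (n(l := n l + k))" for l :: 'a and k c' n
  proof (induction k arbitrary: n)
    case (Suc k)
    have "of_nat (Suc a) * (F / fact (Suc a) * C) = F / fact a * C" for a and F C :: complex
      by (simp add: fact_Suc del: of_nat_Suc)
    then show ?case unfolding funpow.simps o_apply cshift_def[of l "(cshift l ^^ k) c'"] Suc
      by (simp del: of_nat_Suc fact_Suc) (rule arg_cong[where f = c'], auto simp: fun_eq_iff)
  qed simp
  have closed: "foldr (\<lambda>l. cshift l ^^ p l) ls c n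
      = (\<Prod>l\<in>set ls. fact (n l + p l) / fact (n l)) * c (\<lambda>l. if l \<in> set ls then n l + p l else n l)"
    if "distinct ls" for ls n
    using that
  proof (induction ls arbitrary: n)
    case (Cons l ls)
    have *: "(n(l := n l + p l)) l' = n l'" if "l' \<in> set ls" for l' using that Cons.prems by auto
    have "foldr (\<lambda>l. cshift l ^^ p l) (l # ls) c n
       = fact (n l + p l) / fact (n l) * foldr (\<lambda>l. cshift l ^^ p l) ls c (n(l := n l + p l))"
      by (simp add: cs)
    also have "foldr (\<lambda>l. cshift l ^^ p l) ls c (n(l := n l + p l))
       = (\<Prod>l\<in>set ls. fact (n l + p l) / fact (n l)) * c (\<lambda>l'. if l' \<in> set ls then n l' + p l' else (n(l := n l + p l)) l')"
      using Cons.prems by (subst Cons.IH) (auto intro!: arg_cong2[where f = "(*)"] prod.cong arg_cong[where f = c] simp: fun_eq_iff)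
    also have "(\<lambda>l'. if l' \<in> set ls then n l' + p l' else (n(l := n l + p l)) l')
       = (\<lambda>l'. if l' \<in> set (l # ls) then n l' + p l' else n l')"
      using Cons.prems by (auto simp: fun_eq_iff)
    finally show ?case using Cons.prems by simp
  qed simp
  have eq: "foldr (\<lambda>l. cshift l ^^ p l) coords c = (\<lambda>n. (\<Prod>l\<in>UNIV. fact (n l + p l) / fact (n l)) * c (\<lambda>l. n l + p l))"
    using closed[OF distinct_coords] by (simp add: fun_eq_iff set_coords)
  show "cD p F w = gser (\<lambda>n. (\<Prod>l\<in>UNIV. fact (n l + p l) / fact (n l)) * c (\<lambda>l. n l + p l)) w"
    "poly_growth (\<lambda>n. (\<Prod>l\<in>UNIV. fact (n l + p l) / fact (n l)) * c (\<lambda>l. n l + p l))"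
    using fold[of coords] w unfolding eq cD_def multi_iter_def by auto
qed

section \<open>Cauchy's estimates on the polydisc\<close>

text \<open>
  The coefficients of the function obtained by taking the \<open>j\<close>-th Taylor
  coefficient in the variable \<open>w_l\<close>, regarded again as a function on the
  polydisc that is constant in \<open>w_l\<close>.
\<close>

definition slice :: "'d \<Rightarrow> nat \<Rightarrow> ('d::finite mindex \<Rightarrow> complex) \<Rightarrow> 'd mindex \<Rightarrow> complex"
  where "slice l j c n = (if n l = 0 then c (n(l := j)) else 0)"

text \<open>
  Cauchy's estimate in the single variable \<open>w_l\<close>, on circles of radius tending
  to \<open>1\<close>.
\<close>

lemma slice_bound:
  assumes c: "poly_growth c" and M: "\<And>w. w \<in> polydisc \<Longrightarrow> cmod (gser c w) \<le> M"
  shows "poly_growth (slice l j c)" "w \<in> polydisc \<Longrightarrow> cmod (gser (slice l j c) w) \<le> M"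
proof -
  show pg: "poly_growth (slice l j c)" for j
  proof -
    obtain k K where K: "K \<ge> 0" "\<And>n. cmod (c n) \<le> K * (\<Prod>l\<in>UNIV. real ((k + n l) choose (n l)))"
      using c unfolding poly_growth_def by blast
    have "cmod (slice l j c n) \<le> (K * real ((k + j) choose j)) * (\<Prod>i\<in>UNIV. real ((k + n i) choose (n i)))" for n
    proof (cases "n l = 0")
      case True
      have "cmod (slice l j c n) \<le> K * (\<Prod>i\<in>UNIV. real ((k + (n(l := j)) i) choose ((n(l := j)) i)))"
        using K(2)[of "n(l := j)"] True by (simp add: slice_def del: fun_upd_apply)
      also have "(\<Prod>i\<in>UNIV. real ((k + (n(l := j)) i) choose ((n(l := j)) i)))
          = real ((k + j) choose j) * (\<Prod>i\<in>UNIV-{l}. real ((k + n i) choose (n i)))"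
        by (subst prod.remove[of _ l]) auto
      also have "(\<Prod>i\<in>UNIV-{l}. real ((k + n i) choose (n i))) = (\<Prod>i\<in>UNIV. real ((k + n i) choose (n i)))"
        using True by (subst (2) prod.remove[of _ l]) auto
      finally show ?thesis by (simp add: mult.assoc)
    qed (use K(1) in \<open>auto simp: slice_def intro!: mult_nonneg_nonneg prod_nonneg\<close>)
    then show ?thesis using K(1) unfolding poly_growth_def
      by (intro exI[of _ k] exI[of _ "K * real ((k + j) choose j)"]) auto
  qed
  assume w: "w \<in> polydisc"
  have sums: "(\<lambda>j. gser (slice l j c) w * z ^ j) sums gser c (vupd w l z)" if z: "norm z < 1" for z
  proof -
    let ?v = "vupd w l z"
    have bij: "bij_betw (\<lambda>(j, n). n(l := j)) (UNIV \<times> {n :: 'a \<Rightarrow> nat. n l = 0}) UNIV"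
      by (rule bij_betwI[where g = "\<lambda>n. (n l, n(l := 0))"]) auto
    have "((\<lambda>n. c n * mpow ?v n) has_sum gser c ?v) UNIV"
      using z by (intro has_sum_gser c vupd_polydisc w)
    then have "((\<lambda>(j, n). c (n(l := j)) * mpow ?v (n(l := j))) has_sum gser c ?v) (UNIV \<times> {n. n l = 0})"
      using has_sum_reindex_bij_betw[OF bij, of "\<lambda>n. c n * mpow ?v n"] by (simp add: case_prod_unfold)
    moreover have "((\<lambda>n. case (j, n) of (j, n) \<Rightarrow> c (n(l := j)) * mpow ?v (n(l := j))) has_sum gser (slice l j c) w * z ^ j) {n. n l = 0}" for j
    proof -
      have "((\<lambda>n. slice l j c n * mpow w n) has_sum gser (slice l j c) w) UNIV"
        by (intro has_sum_gser pg w)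
      then have "((\<lambda>n. slice l j c n * mpow w n) has_sum gser (slice l j c) w) {n. n l = 0}"
        by (rule has_sum_cong_neutral[THEN iffD1, rotated -1]) (auto simp: slice_def)
      from has_sum_cmult_left[OF this, of "z ^ j"] show ?thesis
      proof (rule has_sum_cong[THEN iffD1, rotated])
        fix n assume n: "n \<in> {n :: 'a \<Rightarrow> nat. n l = 0}"
        have "mpow ?v (n(l := j)) = z ^ j * (\<Prod>i\<in>UNIV-{l}. (w $ i) ^ n i)" by (simp add: mpow_vupd)
        moreover have "mpow w n = (\<Prod>i\<in>UNIV-{l}. (w $ i) ^ n i)"
          using n by (subst mpow_remove[of _ _ l]) simp
        ultimately show "slice l j c n * mpow w n * z ^ j = (case (j, n) of (j, n) \<Rightarrow> c (n(l := j)) * mpow ?v (n(l := j)))"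
          using n by (simp add: slice_def)
      qed
    qed
    ultimately have "((\<lambda>j. gser (slice l j c) w * z ^ j) has_sum gser c ?v) UNIV"
      by (rule has_sum_SigmaD)
    then show ?thesis by (rule has_sum_imp_sums)
  qed
  have "norm (gser (slice l j c) w) * r ^ j \<le> M" if "0 < r" "r < 1" for r
    by (rule power_series_coeff_bound[OF sums that]) (use that in \<open>auto intro!: M vupd_polydisc w\<close>)
  then have "\<forall>\<^sub>F r in at_left 1. norm (gser (slice l j c) w) * r ^ j \<le> M"
    by (intro eventually_at_leftI[of 0]) auto
  moreover have "((\<lambda>r::real. norm (gser (slice l j c) w) * r ^ j) \<longlongrightarrow> norm (gser (slice l j c) w) * 1 ^ j) (at_left 1)"
    by (intro tendsto_intros)
  ultimately show "cmod (gser (slice l j c) w) \<le> M"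
    using tendsto_upperbound[of "\<lambda>r. norm (gser (slice l j c) w) * r ^ j"] by fastforce
qed

text \<open>
  Take Taylor coefficients in one variable after the other; each time the bound
  \<open>M\<close> persists.
\<close>

lemma coeff_le_sup_polydisc:
  assumes c: "poly_growth c" and M: "\<And>w. w \<in> polydisc \<Longrightarrow> cmod (gser c w) \<le> M"
  shows "cmod (c n) \<le> M"
proof -
  have fold: "poly_growth (foldr (\<lambda>l. slice l (n l)) ls c) \<and> (\<forall>w\<in>polydisc. cmod (gser (foldr (\<lambda>l. slice l (n l)) ls c) w) \<le> M)" for ls
  proof (induction ls)
    case (Cons l ls)
    then show ?case using slice_bound[where c = "foldr (\<lambda>l. slice l (n l)) ls c" and M = M and l = l and j = "n l"] by simp
  qed (use c M in auto)
  have closed: "foldr (\<lambda>l. slice l (n l)) ls c m = (if \<forall>l\<in>set ls. m l = 0 then c (\<lambda>l. if l \<in> set ls then n l else m l) else 0)"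
    if "distinct ls" for ls m
    using that
  proof (induction ls arbitrary: m)
    case (Cons l ls)
    have "(\<lambda>l'. if l' \<in> set ls then n l' else (m(l := n l)) l') = (\<lambda>l'. if l' \<in> set (l # ls) then n l' else m l')"
      by (auto simp: fun_eq_iff)
    moreover have "(\<forall>l'\<in>set ls. (m(l := n l)) l' = 0) \<longleftrightarrow> (\<forall>l'\<in>set ls. m l' = 0)"
      using Cons.prems by auto
    ultimately show ?case using Cons by (simp add: slice_def)
  qed simp
  (* After all variables have been treated the constant function c n is left. *)
  have "foldr (\<lambda>l. slice l (n l)) coords c = (\<lambda>m. if m = (\<lambda>_. 0) then c n else 0)"
    by (auto simp: fun_eq_iff closed[OF distinct_coords] set_coords)
  moreover have "(0 :: complex ^ 'a) \<in> polydisc" by (simp add: polydisc_def)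
  ultimately have "cmod (gser (\<lambda>m :: 'a \<Rightarrow> nat. if m = (\<lambda>_. 0) then c n else 0) 0) \<le> M"
    using bspec[OF conjunct2[OF fold[of coords]], of 0] by (simp only:)
  moreover have "((\<lambda>m. (if m = (\<lambda>_. 0) then c n else 0) * mpow (0 :: complex ^ 'a) m) has_sum c n) UNIV"
  proof -
    have "((\<lambda>m. (if m = (\<lambda>_. 0) then c n else 0) * mpow (0 :: complex ^ 'a) m) has_sum c n) {\<lambda>_. 0}"
      using has_sum_finite[of "{\<lambda>_. 0} :: ('a \<Rightarrow> nat) set" "\<lambda>m. (if m = (\<lambda>_. 0) then c n else 0) * mpow (0 :: complex ^ 'a) m"]
      by (simp add: mpow_def)
    then show ?thesis by (rule has_sum_cong_neutral[THEN iffD1, rotated -1]) auto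
  qed
  ultimately show ?thesis by (simp add: gser_def infsumI)
qed

section \<open>Differencing the coefficients\<close>

text \<open>
  The coefficients of \<open>(1 - w_l) \<Sum> a_n w^n\<close>.
\<close>

definition bdiff :: "'d \<Rightarrow> ('d::finite mindex \<Rightarrow> complex) \<Rightarrow> 'd mindex \<Rightarrow> complex"
  where "bdiff l a n = a n - (if n l = 0 then 0 else a (n(l := n l - 1)))"

lemma bdiff_bounded:
  assumes "\<And>n. cmod (a n) \<le> K" shows "cmod (bdiff l a n) \<le> 2 * K"
proof -
  have "K \<ge> 0" using assms[of n] norm_ge_zero by (rule order_trans[rotated])
  have "cmod (bdiff l a n) \<le> cmod (a n) + cmod (if n l = 0 then 0 else a (n(l := n l - 1)))"
    unfolding bdiff_def by (rule norm_triangle_ineq4)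
  also have "\<dots> \<le> K + K" using assms \<open>K \<ge> 0\<close> by (intro add_mono) auto
  finally show ?thesis by simp
qed

lemma bdiff_fold_bounded:
  assumes "\<And>n. cmod (a n) \<le> K" shows "\<exists>K. \<forall>n. cmod (foldr bdiff ls a n) \<le> K"
proof (induction ls)
  case (Cons l ls)
  then show ?case using bdiff_bounded[of "foldr bdiff ls a"] by (auto intro: exI[of _ "2 * _"])
qed (use assms in auto)

lemma gser_bdiff:
  assumes a: "\<And>n. cmod (a n) \<le> K" and w: "w \<in> polydisc"
  shows "gser (bdiff l a) w = (1 - w $ l) * gser a w"
proof -
  have 1: "((\<lambda>n. a n * mpow w n) has_sum gser a w) UNIV"
    by (intro has_sum_gser poly_growth_bounded[OF a] w)
  define g where "g m = - (w $ l) * (a m * mpow w m)" for m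
  have "(g has_sum - (w $ l) * gser a w) UNIV"
    unfolding g_def by (rule has_sum_cmult_right[OF 1])
  then have "((\<lambda>n. if n l = 0 then 0 else g (n(l := n l - 1))) has_sum - (w $ l) * gser a w) UNIV"
    by (rule has_sum_mindex_shift[THEN iffD2])
  from has_sum_add[OF 1 this]
  have "((\<lambda>n. a n * mpow w n + (if n l = 0 then 0 else g (n(l := n l - 1)))) has_sum
      (gser a w + - (w $ l) * gser a w)) UNIV" .
  moreover have "a n * mpow w n + (if n l = 0 then 0 else g (n(l := n l - 1))) = bdiff l a n * mpow w n" for n
  proof (cases "n l")
    case (Suc j)
    have "w $ l * mpow w (n(l := j)) = mpow w n"
      unfolding mpow_upd mpow_remove[of w n l] using Suc by simp
    then have "g (n(l := j)) = - (a (n(l := j)) * mpow w n)"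
      unfolding g_def by (metis mult.left_commute mult_minus_left)
    then show ?thesis using Suc by (simp add: bdiff_def left_diff_distrib del: fun_upd_apply)
  qed (simp add: bdiff_def)
  ultimately have "((\<lambda>n. bdiff l a n * mpow w n) has_sum (gser a w + - (w $ l) * gser a w)) UNIV" by simp
  then show ?thesis by (simp add: gser_def infsumI left_diff_distrib)
qed

lemma disc_series_eq_gser:
  fixes w :: "complex ^ 'd::finite"
  assumes a: "\<And>n. cmod (a n) \<le> K" and w: "w \<in> polydisc"
  shows "disc_series a w = gser (foldr bdiff coords a) w"
proof -
  have "gser (foldr bdiff ls a) w = prod_list (map (\<lambda>l. 1 - w $ l) ls) * gser a w" for ls
  proof (induction ls)
    case (Cons l ls)
    obtain K' where "\<And>n. cmod (foldr bdiff ls a n) \<le> K'" using bdiff_fold_bounded[of a K, OF a] by blast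
    from gser_bdiff[OF this w] show ?case by (simp add: Cons)
  qed simp
  moreover have "prod_list (map (\<lambda>l. 1 - w $ l) (coords :: 'd list)) = (\<Prod>l\<in>UNIV. 1 - w $ l)"
    using prod.distinct_set_conv_list[OF distinct_coords, of "\<lambda>l. 1 - w $ l"] by (simp add: set_coords)
  ultimately show ?thesis by (simp add: disc_series_def gser_def)
qed

lemma subexp_antimono: "\<delta> \<ge> 0 \<Longrightarrow> \<alpha> > 0 \<Longrightarrow> j \<le> k \<Longrightarrow> subexp \<alpha> \<delta> k \<le> subexp \<alpha> \<delta> j"
  unfolding subexp_def by (auto intro!: mult_left_mono powr_mono2)

lemma decays_bdiff:
  assumes "decays \<alpha> a" "\<alpha> \<ge> 1" shows "decays \<alpha> (bdiff l a)"
proof -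
  obtain C \<delta> where C: "C > 0" "\<delta> > 0" "\<And>n. cmod (a n) \<le> C * (\<Prod>i\<in>UNIV. subexp \<alpha> \<delta> (n i))"
    using assms(1) unfolding decays_def by blast
  have step: "subexp \<alpha> \<delta> j \<le> exp \<delta> * subexp \<alpha> \<delta> (Suc j)" for j
  proof -
    have "real (Suc j) powr (1 / \<alpha>) \<le> real j powr (1 / \<alpha>) + 1"
      using powr_sum_le[of "{True, False}" "1 / \<alpha>" "\<lambda>b. if b then real j else 1"] assms(2) by (simp add: add.commute)
    then have "\<delta> * real (Suc j) powr (1 / \<alpha>) \<le> \<delta> * (real j powr (1 / \<alpha>) + 1)"
      using C(2) by (intro mult_left_mono) auto
    then show ?thesis unfolding subexp_def by (simp add: algebra_simps flip: exp_add)
  qed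
  have "cmod (bdiff l a n) \<le> (C * (1 + exp \<delta>)) * (\<Prod>i\<in>UNIV. subexp \<alpha> \<delta> (n i))" for n
  proof -
    have P: "(\<Prod>i\<in>UNIV. subexp \<alpha> \<delta> (n i)) \<ge> 0" by (intro prod_nonneg) (auto intro: less_imp_le subexp_pos)
    have "cmod (if n l = 0 then 0 else a (n(l := n l - 1))) \<le> C * exp \<delta> * (\<Prod>i\<in>UNIV. subexp \<alpha> \<delta> (n i))"
    proof (cases "n l")
      case (Suc j)
      have "(\<Prod>i\<in>UNIV. subexp \<alpha> \<delta> ((n(l := j)) i)) = subexp \<alpha> \<delta> j * (\<Prod>i\<in>UNIV-{l}. subexp \<alpha> \<delta> (n i))"
        by (subst prod.remove[of _ l]) auto
      also have "\<dots> \<le> (exp \<delta> * subexp \<alpha> \<delta> (Suc j)) * (\<Prod>i\<in>UNIV-{l}. subexp \<alpha> \<delta> (n i))"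
        by (intro mult_right_mono step prod_nonneg) (auto intro: less_imp_le subexp_pos)
      also have "\<dots> = exp \<delta> * (\<Prod>i\<in>UNIV. subexp \<alpha> \<delta> (n i))"
        using Suc by (subst (2) prod.remove[of _ l]) auto
      finally have "C * (\<Prod>i\<in>UNIV. subexp \<alpha> \<delta> ((n(l := j)) i)) \<le> C * (exp \<delta> * (\<Prod>i\<in>UNIV. subexp \<alpha> \<delta> (n i)))"
        using C(1) by (intro mult_left_mono) auto
      then show ?thesis using C(3)[of "n(l := j)"] Suc by (simp add: mult.assoc del: fun_upd_apply)
    qed (use C(1) P in simp)
    then show ?thesis
      using norm_triangle_ineq4[of "a n" "if n l = 0 then 0 else a (n(l := n l - 1))"] C(3)[of n]
      unfolding bdiff_def by (simp add: algebra_simps)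
  qed
  moreover have "C * (1 + exp \<delta>) > 0" using C(1) by (simp add: add_pos_pos)
  ultimately show ?thesis unfolding decays_def using C(2) by blast
qed

text \<open>
  Telescoping to infinity along the coordinate line gives \<open>a_n\<close> as minus the
  sum of the differences beyond \<open>n_l\<close>. Half of the exponent pays for the
  summation.
\<close>

lemma decays_bdiffD:
  assumes dec: "decays \<alpha> (bdiff l a)" and \<alpha>: "\<alpha> \<ge> 1" and lim: "\<And>n. (\<lambda>j. a (n(l := j))) \<longlonglongrightarrow> 0"
  shows "decays \<alpha> a"
proof -
  obtain C \<delta> where C: "C > 0" "\<delta> > 0" "\<And>n. cmod (bdiff l a n) \<le> C * (\<Prod>i\<in>UNIV. subexp \<alpha> \<delta> (n i))"
    using dec unfolding decays_def by blast
  define T where "T = 1 + infsum (subexp \<alpha> (\<delta> / 2)) UNIV"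
  have sT: "subexp \<alpha> (\<delta> / 2) summable_on UNIV" using C(2) \<alpha> by (intro summable_subexp) auto
  have T: "T > 0" unfolding T_def by (intro add_pos_nonneg infsum_nonneg) (auto intro: less_imp_le subexp_pos)
  have half: "subexp \<alpha> \<delta> j \<le> subexp \<alpha> (\<delta> / 2) j" for j
    unfolding subexp_def using C(2) by (simp add: mult_right_mono)
  have "cmod (a n) \<le> (C * T) * (\<Prod>i\<in>UNIV. subexp \<alpha> (\<delta> / 2) (n i))" for n
  proof -
    define b where "b j = a (n(l := n l + j))" for j
    define R where "R = (\<Prod>i\<in>UNIV-{l}. subexp \<alpha> (\<delta> / 2) (n i))"
    have R: "R \<ge> 0" unfolding R_def by (intro prod_nonneg) (auto intro: less_imp_le subexp_pos)
    have "b \<longlonglongrightarrow> 0" unfolding b_def using LIMSEQ_ignore_initial_segment[OF lim[of n], of "n l"] by (simp add: add.commute)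
    then have sums: "(\<lambda>j. b (Suc j) - b j) sums (0 - b 0)" by (rule telescope_sums)
    have le: "cmod (b (Suc j) - b j) \<le> C * (subexp \<alpha> (\<delta> / 2) (n l) * R) * subexp \<alpha> (\<delta> / 2) j" for j
    proof -
      have "b (Suc j) - b j = bdiff l a (n(l := Suc (n l + j)))" by (simp add: b_def bdiff_def)
      then have "cmod (b (Suc j) - b j) \<le> C * (\<Prod>i\<in>UNIV. subexp \<alpha> \<delta> ((n(l := Suc (n l + j))) i))"
        using C(3) by (simp del: fun_upd_apply)
      also have "(\<Prod>i\<in>UNIV. subexp \<alpha> \<delta> ((n(l := Suc (n l + j))) i)) = subexp \<alpha> \<delta> (Suc (n l + j)) * (\<Prod>i\<in>UNIV-{l}. subexp \<alpha> \<delta> (n i))"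
        by (subst prod.remove[of _ l]) auto
      also have "\<dots> \<le> (subexp \<alpha> (\<delta> / 2) (n l) * subexp \<alpha> (\<delta> / 2) j) * R"
      proof (rule mult_mono)
        show "subexp \<alpha> \<delta> (Suc (n l + j)) \<le> subexp \<alpha> (\<delta> / 2) (n l) * subexp \<alpha> (\<delta> / 2) j"
          unfolding subexp_double[of \<alpha> \<delta>] using C(2) \<alpha>
          by (intro mult_mono subexp_antimono) (auto intro: less_imp_le subexp_pos)
        show "(\<Prod>i\<in>UNIV-{l}. subexp \<alpha> \<delta> (n i)) \<le> R"
          unfolding R_def by (intro prod_mono conjI half) (auto intro: less_imp_le subexp_pos)
      qed (auto intro!: prod_nonneg mult_nonneg_nonneg intro: less_imp_le subexp_pos)
      finally show ?thesis using C(1) by (simp add: mult_ac)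
    qed
    have sm: "summable (\<lambda>j. C * (subexp \<alpha> (\<delta> / 2) (n l) * R) * subexp \<alpha> (\<delta> / 2) j)"
      using summable_on_imp_summable[OF sT] by (rule summable_mult)
    have sn: "summable (\<lambda>j. cmod (b (Suc j) - b j))"
      by (rule summable_comparison_test'[OF sm, of 0]) (use le in auto)
    have "cmod (a n) = cmod (\<Sum>j. b (Suc j) - b j)"
      using sums by (simp add: sums_iff b_def)
    also have "\<dots> \<le> (\<Sum>j. cmod (b (Suc j) - b j))" by (rule summable_norm[OF sn])
    also have "\<dots> \<le> (\<Sum>j. C * (subexp \<alpha> (\<delta> / 2) (n l) * R) * subexp \<alpha> (\<delta> / 2) j)"
      by (rule suminf_le[OF le sn sm])
    also have "\<dots> = C * (subexp \<alpha> (\<delta> / 2) (n l) * R) * (\<Sum>j. subexp \<alpha> (\<delta> / 2) j)"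
      by (rule suminf_mult[OF summable_on_imp_summable[OF sT]])
    also have "(\<Sum>j. subexp \<alpha> (\<delta> / 2) j) = infsum (subexp \<alpha> (\<delta> / 2)) UNIV"
      using has_sum_imp_sums[OF has_sum_infsum[OF sT]] by (simp add: sums_iff)
    also have "C * (subexp \<alpha> (\<delta> / 2) (n l) * R) * infsum (subexp \<alpha> (\<delta> / 2)) UNIV \<le> C * (subexp \<alpha> (\<delta> / 2) (n l) * R) * T"
      using C(1) R by (intro mult_left_mono) (auto simp: T_def intro!: mult_nonneg_nonneg intro: less_imp_le subexp_pos)
    also have "subexp \<alpha> (\<delta> / 2) (n l) * R = (\<Prod>i\<in>UNIV. subexp \<alpha> (\<delta> / 2) (n i))"
      unfolding R_def by (subst (2) prod.remove[of _ l]) auto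
    finally show ?thesis by (simp add: mult_ac)
  qed
  then show ?thesis unfolding decays_def using C T by (intro exI[of _ "C * T"] conjI exI[of _ "\<delta> / 2"]) auto
qed

lemma decays_fold_bdiff_iff:
  assumes \<alpha>: "\<alpha> \<ge> 1" and lim: "\<And>l n. (\<lambda>j. a (n(l := j))) \<longlonglongrightarrow> 0"
  shows "decays \<alpha> (foldr bdiff ls a) \<longleftrightarrow> decays \<alpha> a"
proof -
  have lim': "(\<lambda>j. foldr bdiff ls a (n(l := j))) \<longlonglongrightarrow> 0" for ls l n
  proof (induction ls arbitrary: l n)
    case (Cons k ls)
    let ?g = "foldr bdiff ls a"
    show ?case
    proof (cases "k = l")
      case True
      have "(\<lambda>j. ?g (n(l := Suc j)) - ?g (n(l := j))) \<longlonglongrightarrow> 0 - 0"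
        by (intro tendsto_diff Cons.IH LIMSEQ_Suc[OF Cons.IH])
      then have "(\<lambda>j. bdiff l ?g (n(l := Suc j))) \<longlonglongrightarrow> 0" by (simp add: bdiff_def)
      then have "(\<lambda>j. bdiff l ?g (n(l := j))) \<longlonglongrightarrow> 0" by (rule LIMSEQ_imp_Suc)
      then show ?thesis using True by (simp del: fun_upd_apply)
    next
      case False
      show ?thesis
      proof (cases "n k = 0")
        case nk: True
        then show ?thesis using False Cons.IH[of n l] by (simp add: bdiff_def)
      next
        case nk: False
        have "(\<lambda>j. ?g (n(l := j)) - ?g ((n(k := n k - 1))(l := j))) \<longlonglongrightarrow> 0 - 0"
          by (intro tendsto_diff Cons.IH)
        moreover have "bdiff k ?g (n(l := j)) = ?g (n(l := j)) - ?g ((n(k := n k - 1))(l := j))" for j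
          using False nk by (simp add: bdiff_def[of k ?g "n(l := j)"] fun_upd_twist del: fun_upd_apply)
            (simp add: fun_upd_twist)
        ultimately show ?thesis by (simp del: fun_upd_apply)
      qed
    qed
  qed (use lim in simp)
  show ?thesis
  proof (induction ls)
    case (Cons l ls)
    then show ?case using decays_bdiff[of \<alpha> "foldr bdiff ls a" l] decays_bdiffD[of \<alpha> l "foldr bdiff ls a"] lim' \<alpha>
      by (auto simp del: fun_upd_apply)
  qed simp
qed

section \<open>Coefficient decay and derivative bounds on the polydisc\<close>

lemma fact_ratio_le_power: "fact (n + p) / fact n \<le> (real (n + p) ^ p :: real)"
proof (induction p)
  case (Suc p)
  have "fact (n + Suc p) / fact n = real (n + Suc p) * (fact (n + p) / fact n)"
    by (simp add: fact_Suc del: of_nat_Suc)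
  also have "\<dots> \<le> real (n + Suc p) * real (n + Suc p) ^ p"
    using Suc by (intro mult_left_mono order_trans[OF Suc power_mono]) auto
  finally show ?case by simp
qed simp

text \<open>
  The absolute sum of the coefficients \<open>c_(n+p) (n+p)!/n!\<close> of \<open>D^p
  F\<close> is bounded on the polydisc; use \<open>(n+p)!/n! \<le> (n+p)^p\<close> and the
  moments of the subexponential weight.
\<close>

lemma decays_imp_derivative_bound:
  fixes F :: "complex ^ 'd::finite \<Rightarrow> complex"
  assumes dec: "decays \<alpha> c" and \<alpha>: "\<alpha> \<ge> 1" and F: "\<And>w. w \<in> polydisc \<Longrightarrow> F w = gser c w" and pg: "poly_growth c"
  shows "\<exists>C>0. \<exists>A>0. \<forall>p. \<forall>w\<in>polydisc. cmod (cD p F w) \<le> C * A ^ mdeg p * self_pow \<alpha> p"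
proof -
  obtain C \<delta> where C: "C > 0" "\<delta> > 0" "\<And>n. cmod (c n) \<le> C * (\<Prod>i\<in>UNIV. subexp \<alpha> \<delta> (n i))"
    using dec unfolding decays_def by blast
  have a0: "\<alpha> > 0" using \<alpha> by simp
  obtain A D where A: "A > 0" "D > 0" "\<And>p. (\<lambda>j. subexp \<alpha> \<delta> j * real j ^ p) summable_on UNIV"
     "\<And>p. infsum (\<lambda>j. subexp \<alpha> \<delta> j * real j ^ p) UNIV \<le> D * A ^ p * (real p ^ p) powr \<alpha>"
    using subexp_sum_power[OF C(2) a0] by metis
  have bound: "cmod (cD p F w) \<le> (C * D ^ CARD('d)) * A ^ mdeg p * self_pow \<alpha> p" if w: "w \<in> polydisc" for p w
  proof -
    define c' where "c' = (\<lambda>n. (\<Prod>l\<in>UNIV. fact (n l + p l) / fact (n l)) * c (\<lambda>l. n l + p l))"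
    have cD: "cD p F w = gser c' w" "poly_growth c'"
      unfolding c'_def using cD_eq_gser[OF F pg w] by auto
    define h where "h l j = subexp \<alpha> \<delta> (j + p l) * real (j + p l) ^ p l" for l j
    have hs: "h l summable_on UNIV" "infsum (h l) UNIV \<le> D * A ^ p l * (real (p l) ^ p l) powr \<alpha>" for l
    proof -
      let ?h = "\<lambda>j. subexp \<alpha> \<delta> j * real j ^ p l"
      have bij: "bij_betw (\<lambda>j. j + p l) UNIV {p l..}"
        by (rule bij_betwI[where g = "\<lambda>j. j - p l"]) auto
      have s: "?h summable_on {p l..}" using A(3) by (rule summable_on_subset_banach) auto
      then show "h l summable_on UNIV" unfolding h_def
        using summable_on_reindex_bij_betw[OF bij, of ?h] by simp
      have "infsum (h l) UNIV = infsum ?h {p l..}" unfolding h_def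
        using infsum_reindex_bij_betw[OF bij, of ?h] by simp
      also have "\<dots> \<le> infsum ?h UNIV"
        by (intro infsum_mono_neutral s A(3)) (auto intro!: mult_nonneg_nonneg less_imp_le[OF subexp_pos])
      finally show "infsum (h l) UNIV \<le> D * A ^ p l * (real (p l) ^ p l) powr \<alpha>" using A(4) by (rule order_trans)
    qed
    have h0: "h l j \<ge> 0" for l j by (simp add: h_def less_imp_le subexp_pos)
    have c'_le: "cmod (c' n) \<le> C * (\<Prod>l\<in>UNIV. h l (n l))" for n
    proof -
      have "cmod (c' n) = (\<Prod>l\<in>UNIV. fact (n l + p l) / fact (n l)) * cmod (c (\<lambda>l. n l + p l))"
        by (simp add: c'_def norm_mult norm_divide norm_fact flip: prod_norm)
      also have "\<dots> \<le> (\<Prod>l\<in>UNIV. real (n l + p l) ^ p l) * (C * (\<Prod>l\<in>UNIV. subexp \<alpha> \<delta> (n l + p l)))"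
        by (intro mult_mono prod_mono conjI fact_ratio_le_power C(3) prod_nonneg) auto
      finally show ?thesis by (simp add: h_def prod.distrib mult_ac)
    qed
    have sh: "(\<lambda>n. \<Prod>l\<in>UNIV. h l (n l)) summable_on UNIV"
      "infsum (\<lambda>n. \<Prod>l\<in>UNIV. h l (n l)) UNIV = (\<Prod>l\<in>UNIV. infsum (h l) UNIV)"
      using summable_on_prod_mindex[of h, OF hs(1) h0] by auto
    have le: "cmod (c' n * mpow w n) \<le> C * (\<Prod>l\<in>UNIV. h l (n l))" for n
    proof -
      have "cmod (mpow w n) \<le> 1"
        using w unfolding mpow_def prod_norm[symmetric]
        by (intro prod_le_1) (auto simp: norm_power polydisc_def less_imp_le power_le_one)
      then have "cmod (c' n * mpow w n) \<le> cmod (c' n) * 1" unfolding norm_mult by (intro mult_left_mono) auto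
      then show ?thesis using c'_le[of n] by simp
    qed
    have s: "(\<lambda>n. cmod (c' n * mpow w n)) summable_on UNIV" by (rule summable_poly_growth[OF cD(2) w])
    have "cmod (gser c' w) \<le> infsum (\<lambda>n. cmod (c' n * mpow w n)) UNIV"
      unfolding gser_def by (rule norm_infsum_bound[OF s])
    also have "\<dots> \<le> infsum (\<lambda>n. C * (\<Prod>l\<in>UNIV. h l (n l))) UNIV"
      by (intro infsum_mono s summable_on_cmult_right[OF sh(1)] le)
    also have "\<dots> = C * (\<Prod>l\<in>UNIV. infsum (h l) UNIV)" by (simp add: infsum_cmult_right' sh(2))
    also have "\<dots> \<le> C * (\<Prod>l\<in>UNIV. D * A ^ p l * (real (p l) ^ p l) powr \<alpha>)"
      using C(1) by (intro mult_left_mono prod_mono conjI hs(2) infsum_nonneg h0) auto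
    also have "\<dots> = (C * D ^ CARD('d)) * A ^ mdeg p * self_pow \<alpha> p"
      by (simp add: prod.distrib power_mdeg self_pow_eq)
    finally show ?thesis by (simp add: cD)
  qed
  have "C * D ^ CARD('d) > 0" using C(1) A(2) by simp
  then show ?thesis using bound A(1) by blast
qed

text \<open>
  The coefficient of \<open>D^p F\<close> with index \<open>n - p\<close> is \<open>c_n
  n!/(n-p)!\<close>, and it is at most the supremum of \<open>D^p F\<close>. This holds for
  all \<open>p \<le> n\<close>, and the order can be optimized.
\<close>

lemma derivative_bound_imp_decays:
  fixes F :: "complex ^ 'd::finite \<Rightarrow> complex"
  assumes \<alpha>: "\<alpha> \<ge> 1" and F: "\<And>w. w \<in> polydisc \<Longrightarrow> F w = gser c w" and pg: "poly_growth c"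
    and bound: "\<exists>C>0. \<exists>A>0. \<forall>p. \<forall>w\<in>polydisc. cmod (cD p F w) \<le> C * A ^ mdeg p * self_pow \<alpha> p"
  shows "decays \<alpha> c"
proof -
  obtain C A where C: "C > 0" "A > 0" "\<And>p w. w \<in> polydisc \<Longrightarrow> cmod (cD p F w) \<le> C * A ^ mdeg p * self_pow \<alpha> p"
    using bound by blast
  show ?thesis
  proof (rule decaysI_optimal_order[OF C(2) \<alpha> C(1)])
    fix n p :: "'d \<Rightarrow> nat" assume p: "\<And>l. p l \<le> n l"
    define c' where "c' = (\<lambda>n. (\<Prod>l\<in>UNIV. fact (n l + p l) / fact (n l)) * c (\<lambda>l. n l + p l))"
    have cD: "cD p F w = gser c' w" "poly_growth c'" if "w \<in> polydisc" for w
      using cD_eq_gser[OF F pg that, of p] unfolding c'_def by auto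
    have z: "(0 :: complex ^ 'd) \<in> polydisc" by (simp add: polydisc_def)
    have "cmod (c' (\<lambda>l. n l - p l)) \<le> C * A ^ mdeg p * self_pow \<alpha> p"
    proof (rule coeff_le_sup_polydisc[OF cD(2)[OF z]])
      fix w :: "complex ^ 'd" assume w: "w \<in> polydisc"
      show "cmod (gser c' w) \<le> C * A ^ mdeg p * self_pow \<alpha> p"
        using C(3)[OF w, of p] cD(1)[OF w] by simp
    qed
    moreover have "c' (\<lambda>l. n l - p l) = (\<Prod>l\<in>UNIV. fact (n l) / fact (n l - p l)) * c n"
      using p by (simp add: c'_def)
    ultimately have "(\<Prod>l\<in>UNIV. fact (n l) / fact (n l - p l)) * cmod (c n) \<le> C * A ^ mdeg p * self_pow \<alpha> p"
      by (simp add: norm_mult norm_divide norm_fact flip: prod_norm)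
    then have "(\<Prod>l\<in>UNIV. fact (n l - p l) / fact (n l)) * ((\<Prod>l\<in>UNIV. fact (n l) / fact (n l - p l)) * cmod (c n))
        \<le> (\<Prod>l\<in>UNIV. fact (n l - p l) / fact (n l)) * (C * A ^ mdeg p * self_pow \<alpha> p)"
      by (intro mult_left_mono prod_nonneg) auto
    moreover have "(\<Prod>l\<in>UNIV. fact (n l - p l) / fact (n l)) * (\<Prod>l\<in>UNIV. fact (n l) / fact (n l - p l)) = (1 :: real)"
      by (simp flip: prod.distrib)
    ultimately have "cmod (c n) \<le> (\<Prod>l\<in>UNIV. fact (n l - p l) / fact (n l)) * (C * A ^ mdeg p * self_pow \<alpha> p)"
      by (simp flip: mult.assoc)
    then show "cmod (c n) \<le> C * (\<Prod>l\<in>UNIV. A ^ p l * (real (p l) ^ p l) powr \<alpha> * (fact (n l - p l) / fact (n l)))"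
      by (simp only: prod.distrib power_mdeg self_pow_eq mult_ac)
  qed
qed

text \<open>
  \<open>F\<close> is the power series of the iterated differences of \<open>a\<close>,
  which decay iff \<open>a\<close> does.
\<close>

lemma decays_iff_derivative_bound:
  fixes F :: "complex ^ 'd::finite \<Rightarrow> complex"
  assumes \<alpha>: "\<alpha> \<ge> 1" and F: "\<And>w. w \<in> polydisc \<Longrightarrow> F w = disc_series a w"
    and a: "\<And>n. cmod (a n) \<le> K" and lim: "\<And>l n. (\<lambda>j. a (n(l := j))) \<longlonglongrightarrow> 0"
  shows "decays \<alpha> a \<longleftrightarrow> (\<exists>C>0. \<exists>A>0. \<forall>p. \<forall>w\<in>polydisc. cmod (cD p F w) \<le> C * A ^ mdeg p * self_pow \<alpha> p)"
proof -
  define c where "c = foldr bdiff coords a"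
  have F': "F w = gser c w" if "w \<in> polydisc" for w
    unfolding c_def using F[OF that] disc_series_eq_gser[OF a that] by simp
  obtain K' where "\<And>n. cmod (c n) \<le> K'" unfolding c_def using bdiff_fold_bounded[of a K, OF a] by blast
  then have pg: "poly_growth c" by (rule poly_growth_bounded)
  have "decays \<alpha> c \<longleftrightarrow> decays \<alpha> a" unfolding c_def by (rule decays_fold_bdiff_iff[OF \<alpha> lim])
  then show ?thesis
    using decays_imp_derivative_bound[OF _ \<alpha> F' pg] derivative_bound_imp_decays[OF \<alpha> F' pg] by blast
qed

lemma decays_summable:
  fixes a :: "'d::finite mindex \<Rightarrow> complex"
  assumes "decays \<alpha> a" "\<alpha> \<ge> 1"
  shows "(\<lambda>n. cmod (a n)) summable_on UNIV"
proof -
  obtain C \<delta> where C: "C > 0" "\<delta> > 0" "\<And>n. cmod (a n) \<le> C * (\<Prod>i\<in>UNIV. subexp \<alpha> \<delta> (n i))"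
    using assms unfolding decays_def by blast
  have "(\<lambda>n :: 'd \<Rightarrow> nat. \<Prod>i\<in>UNIV. subexp \<alpha> \<delta> (n i)) summable_on UNIV"
    using C(2) assms by (intro summable_on_prod_mindex(1)[of "\<lambda>_. subexp \<alpha> \<delta>"] summable_subexp less_imp_le[OF subexp_pos]) auto
  from summable_on_cmult_right[OF this, of C] show ?thesis
    by (rule summable_on_comparison_test) (use C(3) in auto)
qed

lemma disc_series_tendsto_0:
  fixes a :: "'d::finite mindex \<Rightarrow> complex"
  assumes "decays \<alpha> a" "\<alpha> \<ge> 1"
  shows "(disc_series a \<longlongrightarrow> 0) (at (vec 1) within polydisc)"
proof (rule Lim_null_comparison)
  let ?S = "infsum (\<lambda>n. cmod (a n)) UNIV"
  have s: "(\<lambda>n. cmod (a n)) summable_on UNIV" by (rule decays_summable[OF assms])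
  have bound: "norm (disc_series a w) \<le> cmod (\<Prod>l\<in>UNIV. 1 - w $ l) * ?S" if w: "w \<in> polydisc" for w
  proof -
    have le: "cmod (a n * mpow w n) \<le> cmod (a n)" for n
    proof -
      have "cmod (mpow w n) \<le> 1"
        using w unfolding mpow_def prod_norm[symmetric]
        by (intro prod_le_1) (auto simp: norm_power polydisc_def less_imp_le power_le_one)
      then have "cmod (a n) * cmod (mpow w n) \<le> cmod (a n) * 1" by (intro mult_left_mono) auto
      then show ?thesis by (simp add: norm_mult)
    qed
    have s': "(\<lambda>n. cmod (a n * mpow w n)) summable_on UNIV"
      by (rule summable_on_comparison_test[OF s le]) auto
    have "cmod (infsum (\<lambda>n. a n * mpow w n) UNIV) \<le> infsum (\<lambda>n. cmod (a n * mpow w n)) UNIV"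
      by (rule norm_infsum_bound[OF s'])
    also have "\<dots> \<le> ?S" by (intro infsum_mono s s' le)
    finally show ?thesis unfolding disc_series_def norm_mult by (intro mult_left_mono) auto
  qed
  show "\<forall>\<^sub>F w in at (vec 1) within polydisc. norm (disc_series a w) \<le> cmod (\<Prod>l\<in>UNIV. 1 - w $ l) * ?S"
    using bound by (auto simp: eventually_at_filter)
  have "((\<lambda>w :: complex ^ 'd. cmod (\<Prod>l\<in>UNIV. 1 - w $ l) * ?S) \<longlongrightarrow> cmod (\<Prod>l\<in>(UNIV :: 'd set). 1 - vec 1 $ l) * ?S) (at (vec 1) within polydisc)"
    by (intro tendsto_intros)
  then show "((\<lambda>w :: complex ^ 'd. cmod (\<Prod>l\<in>UNIV. 1 - w $ l) * ?S) \<longlongrightarrow> 0) (at (vec 1) within polydisc)"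
    by (simp add: zero_power)
qed

section \<open>Laguerre series on the orthant\<close>

definition lterm :: "'d::finite mindex \<Rightarrow> 'd mindex \<Rightarrow> real ^ 'd \<Rightarrow> real"
  where "lterm p n x = (\<Prod>l\<in>UNIV. lagd (p l) 0 (n l) (x $ l))"

text \<open>
  The series obtained from \<open>\<Sum> a_n L_n e^(-t/2)\<close> by applying
  \<open>D^p\<close> to every term.
\<close>

definition lser :: "('d::finite mindex \<Rightarrow> complex) \<Rightarrow> 'd mindex \<Rightarrow> real ^ 'd \<Rightarrow> complex"
  where "lser a p x = (\<Sum>\<^sub>\<infinity>n. a n * complex_of_real (lterm p n x))"

lemma pos_orthant_closed: "x \<in> pos_orthant \<Longrightarrow> x \<in> closed_orthant"
  by (simp add: pos_orthant_def closed_orthant_def less_imp_le)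

lemma laguerre_fun_eq_lterm: "laguerre_fun n x = lterm (\<lambda>_. 0) n x"
  by (simp add: laguerre_fun_def lterm_def laguerre_poly_eq_lag)

lemma lagd_power_bound:
  "\<exists>H\<ge>0. \<forall>n t. t \<ge> 0 \<longrightarrow> t ^ k * \<bar>lagd p 0 n t\<bar> \<le> H * sqrt (real (n + 2 * (p + k) + 2)) ^ (2 * (p + k) + 2)"
proof (intro exI conjI allI impI)
  define q where "q = 2 * (p + k)"
  define H where "H = (3 / 2) ^ p * exp 1 + (3 / 2) ^ p * (2 ^ q * exp (real (q + 1)))"
  show "0 \<le> (3 / 2) ^ p * exp 1 + (3 / 2) ^ p * (2 ^ (2 * (p + k)) * exp (real (2 * (p + k) + 1)))" by simp
  fix n :: nat and t :: real assume t: "t \<ge> 0"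
  let ?N = "real (n + q + 2)"
  have "t ^ k \<le> 1 + sqrt t ^ q"
  proof (cases "t \<le> 1")
    case True
    then have "t ^ k \<le> 1" using t by (rule power_le_one[rotated])
    moreover have "sqrt t ^ q \<ge> 0" using t by simp
    ultimately show ?thesis by linarith
  next
    case False
    have "t ^ k = sqrt t ^ (2 * k)" using t by (simp add: power_mult)
    also have "\<dots> \<le> sqrt t ^ q" using False by (intro power_increasing) (auto simp: q_def)
    finally show ?thesis by simp
  qed
  then have "t ^ k * \<bar>lagd p 0 n t\<bar> \<le> (1 + sqrt t ^ q) * \<bar>lagd p 0 n t\<bar>" by (intro mult_right_mono) auto
  also have "\<dots> = \<bar>lagd p 0 n t\<bar> + sqrt t ^ q * \<bar>lagd p 0 n t\<bar>" by (simp add: distrib_right)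
  also have "\<dots> \<le> (3 / 2) ^ p * (exp 1 * sqrt ?N ^ (q + 2)) + (3 / 2) ^ p * (2 ^ q * exp (real (q + 1)) * sqrt ?N ^ (q + 2))"
  proof (intro add_mono)
    have "\<bar>lagd p 0 n t\<bar> \<le> (3 / 2) ^ p * (exp 1 * real (n + 2) ^ Suc p)" using lagd_bound[OF t, of p 0 n] by simp
    also have "real (n + 2) ^ Suc p = sqrt (real (n + 2)) ^ (2 * Suc p)" unfolding power_mult by simp
    also have "\<dots> \<le> sqrt ?N ^ (2 * Suc p)" by (intro power_mono real_sqrt_le_mono) auto
    also have "\<dots> \<le> sqrt ?N ^ (q + 2)" by (intro power_increasing) (auto simp: q_def)
    finally show "\<bar>lagd p 0 n t\<bar> \<le> (3 / 2) ^ p * (exp 1 * sqrt ?N ^ (q + 2))" by (simp add: mult_left_mono)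
    show "sqrt t ^ q * \<bar>lagd p 0 n t\<bar> \<le> (3 / 2) ^ p * (2 ^ q * exp (real (q + 1)) * sqrt ?N ^ (q + 2))"
      using lagd_weighted_bound[OF t, of p 0 q n] by (simp add: q_def)
  qed
  also have "\<dots> = H * sqrt ?N ^ (q + 2)" unfolding H_def distrib_right by (simp only: mult.assoc)
  finally show "t ^ k * \<bar>lagd p 0 n t\<bar> \<le> ((3 / 2) ^ p * exp 1 + (3 / 2) ^ p * (2 ^ (2 * (p + k)) * exp (real (2 * (p + k) + 1))))
      * sqrt (real (n + 2 * (p + k) + 2)) ^ (2 * (p + k) + 2)"
    unfolding H_def q_def .
qed

text \<open>
  The Laguerre functions and their derivatives grow polynomially in \<open>n\<close>,
  uniformly on the closed orthant and even after multiplication by powers of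
  \<open>x\<close>; the coefficients decay faster than any power. Convergence, continuity
  and termwise differentiation of the series rest on this majorant.
\<close>

lemma lterm_majorant:
  fixes a :: "'d::finite mindex \<Rightarrow> complex"
  assumes "decays \<alpha> a" "\<alpha> \<ge> 1"
  shows "\<exists>M. (\<forall>n. M n \<ge> 0) \<and> M summable_on UNIV \<and>
    (\<forall>n. \<forall>x\<in>closed_orthant. mpow x k * cmod (a n * complex_of_real (lterm p n x)) \<le> M n)"
proof -
  obtain C \<delta> where C: "C > 0" "\<delta> > 0" "\<And>n. cmod (a n) \<le> C * (\<Prod>i\<in>UNIV. subexp \<alpha> \<delta> (n i))"
    using assms unfolding decays_def by blast
  define R where "R l j = sqrt (real (j + 2 * (p l + k l) + 2)) ^ (2 * (p l + k l) + 2)" for l j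
  obtain H where H: "\<And>l. H l \<ge> 0" "\<And>l n t. t \<ge> 0 \<Longrightarrow> t ^ k l * \<bar>lagd (p l) 0 n t\<bar> \<le> H l * R l n"
  proof -
    have "\<exists>H. H \<ge> 0 \<and> (\<forall>n t. t \<ge> 0 \<longrightarrow> t ^ k l * \<bar>lagd (p l) 0 n t\<bar> \<le> H * R l n)" for l
      using lagd_power_bound[of "k l" "p l"] unfolding R_def by blast
    then obtain H where "\<forall>l. H l \<ge> 0 \<and> (\<forall>n t. t \<ge> 0 \<longrightarrow> t ^ k l * \<bar>lagd (p l) 0 n t\<bar> \<le> H l * R l n)"
      using choice[of "\<lambda>l H. H \<ge> 0 \<and> (\<forall>n t. t \<ge> 0 \<longrightarrow> t ^ k l * \<bar>lagd (p l) 0 n t\<bar> \<le> H * R l n)"] by blast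
    then show ?thesis using that by blast
  qed
  have R: "R l j \<ge> 0" for l j by (simp add: R_def)
  define M where "M n = C * (\<Prod>l\<in>UNIV. H l * (subexp \<alpha> \<delta> (n l) * R l (n l)))" for n
  have "M n \<ge> 0" for n
    unfolding M_def using C(1) by (intro mult_nonneg_nonneg prod_nonneg H(1) R) (auto intro: less_imp_le subexp_pos)
  moreover have "M summable_on UNIV" unfolding M_def
  proof (intro summable_on_cmult_right summable_on_prod_mindex(1)[of "\<lambda>l j. H l * (subexp \<alpha> \<delta> j * R l j)"])
    fix l
    show "(\<lambda>j. subexp \<alpha> \<delta> j * R l j) summable_on UNIV"
      using subexp_sum_shifted[OF C(2) assms(2)] unfolding R_def by blast
  qed (auto intro!: mult_nonneg_nonneg H(1) R intro: less_imp_le subexp_pos)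
  moreover have "mpow x k * cmod (a n * complex_of_real (lterm p n x)) \<le> M n" if x: "x \<in> closed_orthant" for n x
  proof -
    have x0: "x $ l \<ge> 0" for l using x by (simp add: closed_orthant_def)
    have "mpow x k * cmod (a n * complex_of_real (lterm p n x))
       = cmod (a n) * (\<Prod>l\<in>UNIV. (x $ l) ^ k l * \<bar>lagd (p l) 0 (n l) (x $ l)\<bar>)"
      unfolding norm_mult norm_of_real lterm_def abs_prod mpow_def prod.distrib by simp
    also have "\<dots> \<le> (C * (\<Prod>i\<in>UNIV. subexp \<alpha> \<delta> (n i))) * (\<Prod>l\<in>UNIV. (x $ l) ^ k l * \<bar>lagd (p l) 0 (n l) (x $ l)\<bar>)"
      using x0 by (intro mult_right_mono[OF C(3)] prod_nonneg) auto
    also have "\<dots> \<le> (C * (\<Prod>i\<in>UNIV. subexp \<alpha> \<delta> (n i))) * (\<Prod>l\<in>UNIV. H l * R l (n l))"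
    proof (rule mult_left_mono)
      show "(\<Prod>l\<in>UNIV. (x $ l) ^ k l * \<bar>lagd (p l) 0 (n l) (x $ l)\<bar>) \<le> (\<Prod>l\<in>UNIV. H l * R l (n l))"
        using x0 by (intro prod_mono) (auto intro: H(2))
      show "0 \<le> C * (\<Prod>i\<in>UNIV. subexp \<alpha> \<delta> (n i))"
        by (intro mult_nonneg_nonneg prod_nonneg) (auto intro: less_imp_le subexp_pos C(1))
    qed
    also have "\<dots> = M n" by (simp add: M_def prod.distrib mult_ac)
    finally show ?thesis .
  qed
  ultimately show ?thesis by blast
qed

lemma lterm_summable:
  assumes "decays \<alpha> a" "\<alpha> \<ge> 1" "x \<in> closed_orthant"
  shows "(\<lambda>n. cmod (a n * complex_of_real (lterm p n x))) summable_on UNIV"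
proof -
  obtain M where M: "M summable_on UNIV" "\<forall>n. \<forall>x\<in>closed_orthant. mpow x (\<lambda>_. 0) * cmod (a n * complex_of_real (lterm p n x)) \<le> M n"
    using lterm_majorant[OF assms(1,2), of "\<lambda>_. 0" p] by blast
  show ?thesis by (rule summable_on_comparison_test[OF M(1)]) (use M(2) assms(3) in \<open>auto simp: mpow_def\<close>)
qed

lemma lser_bound:
  assumes "decays \<alpha> a" "\<alpha> \<ge> 1"
  shows "\<exists>K. \<forall>x\<in>closed_orthant. mpow x k * cmod (lser a p x) \<le> K"
proof -
  obtain M where M: "M summable_on UNIV" "\<And>n x. x \<in> closed_orthant \<Longrightarrow> mpow x k * cmod (a n * complex_of_real (lterm p n x)) \<le> M n"
    using lterm_majorant[OF assms, of k p] by blast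
  have "mpow x k * cmod (lser a p x) \<le> infsum M UNIV" if x: "x \<in> closed_orthant" for x
  proof -
    have k: "mpow x k \<ge> 0" using x by (auto simp: mpow_def closed_orthant_def intro!: prod_nonneg)
    note s = lterm_summable[OF assms x, of p]
    have "mpow x k * cmod (lser a p x) \<le> mpow x k * infsum (\<lambda>n. cmod (a n * complex_of_real (lterm p n x))) UNIV"
      unfolding lser_def by (intro mult_left_mono norm_infsum_bound s k)
    also have "\<dots> = infsum (\<lambda>n. mpow x k * cmod (a n * complex_of_real (lterm p n x))) UNIV"
      by (rule infsum_cmult_right'[symmetric])
    also have "\<dots> \<le> infsum M UNIV"
      by (intro infsum_mono summable_on_cmult_right s M x)
    finally show ?thesis .
  qed
  then show ?thesis by blast
qed

lemma continuous_lagd: "continuous_on S (lagd p j n)"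
  by (intro continuous_at_imp_continuous_on ballI DERIV_isCont[OF has_real_derivative_lagd])

lemma continuous_lterm: "continuous_on S (lterm p n)"
  unfolding lterm_def
  by (intro continuous_intros continuous_on_compose2[OF continuous_lagd[of UNIV]]) auto

lemma continuous_lser:
  fixes a :: "'d::finite mindex \<Rightarrow> complex"
  assumes "decays \<alpha> a" "\<alpha> \<ge> 1"
  shows "continuous_on closed_orthant (lser a p)"
proof -
  obtain M where M: "M summable_on UNIV" "\<And>n x. x \<in> closed_orthant \<Longrightarrow> mpow x (\<lambda>_. 0) * cmod (a n * complex_of_real (lterm p n x)) \<le> M n"
    using lterm_majorant[OF assms, of "\<lambda>_. 0" p] by blast
  show ?thesis
  proof (rule uniform_limit_theorem)
    show "uniform_limit closed_orthant (\<lambda>X x. \<Sum>n\<in>X. a n * complex_of_real (lterm p n x)) (lser a p) (finite_subsets_at_top UNIV)"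
      unfolding lser_def [abs_def] using M
      by (intro Weierstrass_m_test_general[where M = M]) (auto simp: mpow_def)
    show "\<forall>\<^sub>F X in finite_subsets_at_top UNIV. continuous_on closed_orthant (\<lambda>x. \<Sum>n\<in>X. a n * complex_of_real (lterm p n x))"
      by (intro always_eventually allI continuous_intros continuous_lterm)
  qed simp
qed

lemma has_derivative_lser:
  fixes a :: "'d::finite mindex \<Rightarrow> complex"
  assumes a: "decays \<alpha> a" "\<alpha> \<ge> 1" and x: "x \<in> pos_orthant"
  shows "((\<lambda>s. lser a p (x + s *\<^sub>R axis l 1)) has_vector_derivative lser a (p(l := Suc (p l))) x) (at 0)"
proof -
  let ?e = "axis l 1 :: real ^ 'd" and ?p = "p(l := Suc (p l))"
  obtain M where M: "\<And>n. M n \<ge> 0" "M summable_on UNIV"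
    "\<And>n x. x \<in> closed_orthant \<Longrightarrow> mpow x (\<lambda>_. 0) * cmod (a n * complex_of_real (lterm ?p n x)) \<le> M n"
    using lterm_majorant[OF a, of "\<lambda>_. 0" ?p] by blast
  define S where "S = {s :: real. - (x $ l) < s}"
  have S: "x + s *\<^sub>R ?e \<in> pos_orthant" if "s \<in> S" for s
    using x that by (auto simp: pos_orthant_def S_def axis_def)
  have deriv_term: "((\<lambda>s. lterm p n (x + s *\<^sub>R ?e)) has_real_derivative lterm ?p n (x + s *\<^sub>R ?e)) (at s)" for n s
  proof -
    let ?R = "\<Prod>i\<in>UNIV-{l}. lagd (p i) 0 (n i) (x $ i)"
    have ax: "(x + s *\<^sub>R ?e) $ i = (if i = l then x $ l + s else x $ i)" for s i by (simp add: axis_def)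
    have 1: "lterm p n (x + s *\<^sub>R ?e) = lagd (p l) 0 (n l) (x $ l + s) * ?R" for s
      unfolding lterm_def ax by (subst prod.remove[of _ l]) auto
    have 2: "lterm ?p n (x + s *\<^sub>R ?e) = lagd (Suc (p l)) 0 (n l) (x $ l + s) * ?R" for s
      unfolding lterm_def ax by (subst prod.remove[of _ l]) auto
    have "((\<lambda>s. lagd (p l) 0 (n l) (x $ l + s)) has_real_derivative lagd (Suc (p l)) 0 (n l) (x $ l + s)) (at s)"
      using has_real_derivative_lagd[of "p l" 0 "n l" "x $ l + s"]
        DERIV_shift[of "lagd (p l) 0 (n l)" "lagd (Suc (p l)) 0 (n l) (x $ l + s)" s "x $ l"]
      by (simp only: add.commute)
    from DERIV_cmult_right[OF this, of ?R] show ?thesis unfolding 1 2 .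
  qed
  have "((\<lambda>s. \<Sum>\<^sub>\<infinity>n. a n * complex_of_real (lterm p n (x + s *\<^sub>R ?e))) has_derivative
      (\<lambda>h. \<Sum>\<^sub>\<infinity>n. h *\<^sub>R (a n * complex_of_real (lterm ?p n (x + 0 *\<^sub>R ?e))))) (at 0)"
  proof (rule has_derivative_infsum_mindex[where S = S and M = M])
    show "convex S" "open S" unfolding S_def greaterThan_def[symmetric] by auto
    show "((\<lambda>s. a n * complex_of_real (lterm p n (x + s *\<^sub>R ?e))) has_derivative
      (\<lambda>h. h *\<^sub>R (a n * complex_of_real (lterm ?p n (x + s *\<^sub>R ?e))))) (at s)" for n s
    proof -
      have "((\<lambda>s. complex_of_real (lterm p n (x + s *\<^sub>R ?e))) has_vector_derivative complex_of_real (lterm ?p n (x + s *\<^sub>R ?e))) (at s)"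
        using deriv_term by (intro has_vector_derivative_of_real) (simp add: has_real_derivative_iff_has_vector_derivative)
      then have "((\<lambda>s. a n * complex_of_real (lterm p n (x + s *\<^sub>R ?e))) has_vector_derivative a n * complex_of_real (lterm ?p n (x + s *\<^sub>R ?e))) (at s)"
        by (rule has_vector_derivative_mult_right)
      then show ?thesis by (simp add: has_vector_derivative_def)
    qed
    show "norm (h *\<^sub>R (a n * complex_of_real (lterm ?p n (x + s *\<^sub>R ?e)))) \<le> M n * norm h" if "s \<in> S" for n s h
    proof -
      have "cmod (a n * complex_of_real (lterm ?p n (x + s *\<^sub>R ?e))) \<le> M n"
        using M(3)[OF pos_orthant_closed[OF S[OF that]], of n] by (simp add: mpow_def)
      then have "\<bar>h\<bar> * cmod (a n * complex_of_real (lterm ?p n (x + s *\<^sub>R ?e))) \<le> \<bar>h\<bar> * M n" by (intro mult_left_mono) auto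
      then show ?thesis unfolding norm_scaleR by (simp only: real_norm_def mult.commute)
    qed
    show "(\<lambda>n. a n * complex_of_real (lterm p n (x + s *\<^sub>R ?e))) summable_on UNIV" if "s \<in> S" for s
      by (rule abs_summable_summable[OF lterm_summable[OF a pos_orthant_closed[OF S[OF that]]]])
    show "0 \<in> S" using x by (simp add: S_def pos_orthant_def)
  qed (use M in auto)
  moreover have "(\<Sum>\<^sub>\<infinity>n. h *\<^sub>R (a n * complex_of_real (lterm ?p n (x + 0 *\<^sub>R ?e)))) = h *\<^sub>R lser a ?p x" for h
  proof -
    have "((\<lambda>n. a n * complex_of_real (lterm ?p n x)) has_sum lser a ?p x) UNIV"
      unfolding lser_def by (rule has_sum_infsum[OF abs_summable_summable[OF lterm_summable[OF a pos_orthant_closed[OF x]]]])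
    from has_sum_cmult_right[OF this, of "complex_of_real h"] show ?thesis
      by (simp add: infsumI scaleR_conv_of_real)
  qed
  ultimately show ?thesis by (simp add: has_vector_derivative_def lser_def)
qed

lemma rpartial_cong:
  assumes "\<And>x. x \<in> pos_orthant \<Longrightarrow> f x = g x" and x: "x \<in> pos_orthant"
  shows "rpartial l f x = rpartial l g x"
    and "((\<lambda>s. f (x + s *\<^sub>R axis l 1)) has_vector_derivative D) (at 0) \<longleftrightarrow> ((\<lambda>s. g (x + s *\<^sub>R axis l 1)) has_vector_derivative D) (at 0)"
proof -
  let ?S = "(\<lambda>s::real. x + s *\<^sub>R axis l 1) -` pos_orthant"
  have S: "open ?S" "0 \<in> ?S" using x by (auto intro!: open_vimage open_pos_orthant continuous_intros)
  have eq: "f (x + s *\<^sub>R axis l 1) = g (x + s *\<^sub>R axis l 1)" if "s \<in> ?S" for s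
    using that by (intro assms(1)) simp
  show D: "((\<lambda>s. f (x + s *\<^sub>R axis l 1)) has_vector_derivative D) (at 0) \<longleftrightarrow> ((\<lambda>s. g (x + s *\<^sub>R axis l 1)) has_vector_derivative D) (at 0)" for D
  proof
    assume "((\<lambda>s. f (x + s *\<^sub>R axis l 1)) has_vector_derivative D) (at 0)"
    then show "((\<lambda>s. g (x + s *\<^sub>R axis l 1)) has_vector_derivative D) (at 0)"
      by (rule has_vector_derivative_transform_within_open[OF _ S]) (rule eq)
  next
    assume "((\<lambda>s. g (x + s *\<^sub>R axis l 1)) has_vector_derivative D) (at 0)"
    then show "((\<lambda>s. f (x + s *\<^sub>R axis l 1)) has_vector_derivative D) (at 0)"
      by (rule has_vector_derivative_transform_within_open[OF _ S]) (rule eq[symmetric])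
  qed
  show "rpartial l f x = rpartial l g x"
    unfolding rpartial_def vector_derivative_def D ..
qed

lemma Ck_on_cong:
  assumes "\<And>x. x \<in> pos_orthant \<Longrightarrow> f x = g x"
  shows "Ck_on k pos_orthant f \<longleftrightarrow> Ck_on k pos_orthant g"
  using assms
proof (induction k arbitrary: f g)
  case 0
  have "continuous_on pos_orthant f \<longleftrightarrow> continuous_on pos_orthant g"
    by (rule continuous_on_cong[OF refl]) (rule 0)
  then show ?case by simp
next
  case (Suc k)
  have "continuous_on pos_orthant f \<longleftrightarrow> continuous_on pos_orthant g"
    by (rule continuous_on_cong[OF refl]) (rule Suc.prems)
  moreover have "(\<lambda>s. f (x + s *\<^sub>R axis l 1)) differentiable (at 0) \<longleftrightarrow> (\<lambda>s. g (x + s *\<^sub>R axis l 1)) differentiable (at 0)"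
    if "x \<in> pos_orthant" for x l
    using rpartial_cong(2)[of f g, OF Suc.prems that] differentiableI_vector vector_derivative_works by blast
  moreover have "Ck_on k pos_orthant (rpartial l f) \<longleftrightarrow> Ck_on k pos_orthant (rpartial l g)" for l
    by (rule Suc.IH) (rule rpartial_cong(1)[OF Suc.prems])
  ultimately show ?case by simp
qed

lemma rpartial_lser:
  assumes a: "decays \<alpha> a" "\<alpha> \<ge> 1" and x: "x \<in> pos_orthant"
  shows "rpartial l (lser a p) x = lser a (p(l := Suc (p l))) x"
  unfolding rpartial_def by (rule vector_derivative_at[OF has_derivative_lser[OF assms]])

lemma smooth_lser:
  assumes a: "decays \<alpha> a" "\<alpha> \<ge> 1"
  shows "smooth_on pos_orthant (lser a p)"
  unfolding smooth_on_def
proof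
  fix k
  have cont: "continuous_on pos_orthant (lser a p)" for p
    using continuous_lser[OF a] by (rule continuous_on_subset) (auto simp: pos_orthant_closed)
  show "Ck_on k pos_orthant (lser a p)"
  proof (induction k arbitrary: p)
    case (Suc k)
    have "Ck_on k pos_orthant (rpartial l (lser a p))" for l
      using Suc[of "p(l := Suc (p l))"] Ck_on_cong[of "rpartial l (lser a p)" "lser a (p(l := Suc (p l)))" k] rpartial_lser[OF a]
      by blast
    moreover have "(\<lambda>s. lser a p (x + s *\<^sub>R axis l 1)) differentiable (at 0)" if "x \<in> pos_orthant" for x l
      using has_derivative_lser[OF a that] by (rule differentiableI_vector)
    ultimately show ?case using cont by simp
  qed (use cont in simp)
qed

lemma rD_lser:
  fixes a :: "'d::finite mindex \<Rightarrow> complex"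
  assumes a: "decays \<alpha> a" "\<alpha> \<ge> 1" and x: "x \<in> pos_orthant"
  shows "rD p (lser a (\<lambda>_. 0)) x = lser a p x"
proof -
  have iter: "\<forall>x\<in>pos_orthant. (rpartial l ^^ k) f x = lser a (q(l := q l + k)) x"
    if "\<forall>x\<in>pos_orthant. f x = lser a q x" for f q l k
  proof (induction k)
    case (Suc k)
    show ?case
    proof
      fix x :: "real ^ 'd" assume x: "x \<in> pos_orthant"
      have "(rpartial l ^^ Suc k) f x = rpartial l (lser a (q(l := q l + k))) x"
        using rpartial_cong(1)[of "(rpartial l ^^ k) f" "lser a (q(l := q l + k))" x l] Suc x
        by (simp del: fun_upd_apply)
      also have "\<dots> = lser a (q(l := q l + Suc k)) x" by (simp add: rpartial_lser[OF a x])
      finally show "(rpartial l ^^ Suc k) f x = lser a (q(l := q l + Suc k)) x" .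
    qed
  qed (use that in simp)
  have "\<forall>x\<in>pos_orthant. foldr (\<lambda>l. rpartial l ^^ p l) ls (lser a (\<lambda>_. 0)) x = lser a (\<lambda>l. if l \<in> set ls then p l else 0) x"
    if "distinct ls" for ls using that
  proof (induction ls)
    case (Cons l ls)
    then have "\<forall>x\<in>pos_orthant. foldr (\<lambda>l. rpartial l ^^ p l) ls (lser a (\<lambda>_. 0)) x = lser a (\<lambda>l. if l \<in> set ls then p l else 0) x"
      by simp
    from iter[OF this, where l = l and k = "p l"] have "\<forall>x\<in>pos_orthant. foldr (\<lambda>l. rpartial l ^^ p l) (l # ls) (lser a (\<lambda>_. 0)) x
       = lser a ((\<lambda>l. if l \<in> set ls then p l else 0)(l := p l)) x"
      using Cons.prems by simp
    moreover have "(\<lambda>l. if l \<in> set ls then p l else 0)(l := p l) = (\<lambda>l'. if l' \<in> set (l # ls) then p l' else 0)"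
      by (auto simp: fun_eq_iff)
    ultimately show ?case by simp
  qed simp
  from this[OF distinct_coords] x show ?thesis by (simp add: rD_def multi_iter_def set_coords)
qed

lemma lser_schwartz:
  assumes a: "decays \<alpha> a" "\<alpha> \<ge> 1"
  shows "lser a (\<lambda>_. 0) \<in> schwartz_orthant"
  unfolding schwartz_orthant_def
proof (intro CollectI conjI allI)
  show "smooth_on pos_orthant (lser a (\<lambda>_. 0))" by (rule smooth_lser[OF a])
  fix p
  show "\<exists>g. continuous_on closed_orthant g \<and> (\<forall>x\<in>pos_orthant. g x = rD p (lser a (\<lambda>_. 0)) x)"
    by (intro exI[of _ "lser a p"] conjI continuous_lser[OF a]) (simp add: rD_lser[OF a])
  fix k
  obtain K where "\<forall>x\<in>closed_orthant. mpow x k * cmod (lser a p x) \<le> K" using lser_bound[OF a] by blast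
  then show "bdd_above ((\<lambda>x. mpow x k * cmod (rD p (lser a (\<lambda>_. 0)) x)) ` pos_orthant)"
    by (intro bdd_aboveI2[where M = K]) (simp add: rD_lser[OF a] pos_orthant_closed)
qed

section \<open>Weighted norms of Laguerre series\<close>

lemma set_integrable_inverse_square: "set_integrable lborel {0<..} (\<lambda>t::real. (1 / (1 + t))\<^sup>2)"
proof -
  have E: "einterval 0 \<infinity> = {0<..}" by (auto simp: einterval_def zero_ereal_def)
  have "set_integrable lborel (einterval 0 \<infinity>) (\<lambda>t::real. (1 / (1 + t))\<^sup>2)"
  proof (rule interval_integral_FTC_nonneg(1)[where F = "\<lambda>t. - (1 / (1 + t))"])
    show "DERIV (\<lambda>t. - (1 / (1 + t))) x :> (1 / (1 + x))\<^sup>2" if "0 < ereal x" "ereal x < \<infinity>" for x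
      using that by (auto intro!: derivative_eq_intros simp: power2_eq_square zero_ereal_def)
    show "isCont (\<lambda>t. (1 / (1 + t))\<^sup>2) x" if "0 < ereal x" "ereal x < \<infinity>" for x
      using that by (intro continuous_intros) (auto simp: zero_ereal_def)
    have "isCont (\<lambda>t::real. - (1 / (1 + t))) 0" by (intro continuous_intros) auto
    then have "((\<lambda>t::real. - (1 / (1 + t))) \<longlongrightarrow> - 1) (at_right 0)"
      by (simp add: isCont_def filterlim_at_split)
    then show "(((\<lambda>t. - (1 / (1 + t))) \<circ> real_of_ereal) \<longlongrightarrow> - 1) (at_right 0)"
      by (simp add: zero_ereal_def ereal_tendsto_simps)
    have "((\<lambda>t::real. - (1 / (1 + t))) \<longlongrightarrow> 0) at_top" by real_asymp
    then show "(((\<lambda>t. - (1 / (1 + t))) \<circ> real_of_ereal) \<longlongrightarrow> 0) (at_left \<infinity>)"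
      by (simp add: ereal_tendsto_simps)
  qed auto
  then show ?thesis by (simp add: E)
qed

lemma power_powr: "x > 0 \<Longrightarrow> (x ^ q) powr r = (x powr r) ^ q" for x r :: real
  by (simp add: powr_realpow[symmetric] powr_powr mult.commute)

text \<open>
  The factor \<open>1 + t\<close>, beyond the weight in the norms of \<open>G_space\<close>,
  makes the pointwise bounds square integrable later. Writing it out turns the weight into
  \<open>t^(q/2) + t^((q+2)/2)\<close> with \<open>q = p + k\<close>, so that two instances
  of \<open>lagd_weighted_bound\<close> suffice; the factor \<open>(p+k)^(p+k)\<close> is
  split into \<open>p^p k^k\<close> up to a geometric factor.
\<close>

lemma lagd_half_weight_bound:
  assumes \<delta>: "\<delta> > 0" and \<alpha>: "\<alpha> \<ge> 1"
  shows "\<exists>A>0. \<exists>D>0. \<forall>p k. \<exists>B. (\<forall>j. B j \<ge> 0) \<and>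
     (\<forall>j t. t \<ge> 0 \<longrightarrow> sqrt t ^ (p + k) * (1 + t) * \<bar>lagd p 0 j t\<bar> \<le> B j) \<and>
     (\<lambda>j. subexp \<alpha> \<delta> j * B j) summable_on UNIV \<and>
     infsum (\<lambda>j. subexp \<alpha> \<delta> j * B j) UNIV \<le> D * A ^ (p + k) * (real p ^ p) powr (\<alpha> / 2) * (real k ^ k) powr (\<alpha> / 2)"
proof -
  define R where "R q j = sqrt (real (j + q + 2)) ^ (q + 2)" for q j
  obtain A0 D0 where AD0: "A0 > 0" "D0 > 0" "\<forall>q. (\<lambda>j. subexp \<alpha> \<delta> j * R q j) summable_on UNIV \<and>
     infsum (\<lambda>j. subexp \<alpha> \<delta> j * R q j) UNIV \<le> D0 * A0 ^ q * (real q ^ q) powr (\<alpha> / 2)"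
    using subexp_sum_shifted[OF \<delta> \<alpha>] unfolding R_def by blast
  note AD = AD0(1,2) AD0(3)[rule_format, THEN conjunct1] AD0(3)[rule_format, THEN conjunct2]
  define A1 where "A1 = max A0 1"
  have A1: "A1 \<ge> 1" "A0 \<le> A1" by (auto simp: A1_def)
  define E where "E = (2 * exp 2) powr (\<alpha> / 2)"
  define F where "F = 4 powr (\<alpha> / 2)"
  define G where "G = (2 * exp 1) powr (\<alpha> / 2)"
  have EFG: "E \<ge> 1" "F \<ge> 1" "G > 0"
  proof -
    have "(1 :: real) \<le> 2 * exp 2" using exp_ge_add_one_self[of "2 :: real"] by simp
    then show "E \<ge> 1" unfolding E_def using \<alpha> by (intro ge_one_powr_ge_zero) auto
    show "F \<ge> 1" unfolding F_def using \<alpha> by (intro ge_one_powr_ge_zero) auto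
    show "G > 0" by (simp add: G_def)
  qed
  define A where "A = 4 * exp 1 * A1 * F * G"
  define D where "D = 8 * exp 3 * D0 * A1\<^sup>2 * E"
  have "A > 0" "D > 0" using A1 EFG AD(2) by (auto simp: A_def D_def)
  have "\<exists>B. (\<forall>j. B j \<ge> 0) \<and>
     (\<forall>j t. t \<ge> 0 \<longrightarrow> sqrt t ^ (p + k) * (1 + t) * \<bar>lagd p 0 j t\<bar> \<le> B j) \<and>
     (\<lambda>j. subexp \<alpha> \<delta> j * B j) summable_on UNIV \<and>
     infsum (\<lambda>j. subexp \<alpha> \<delta> j * B j) UNIV \<le> D * A ^ (p + k) * (real p ^ p) powr (\<alpha> / 2) * (real k ^ k) powr (\<alpha> / 2)" for p k
  proof -
    define q where "q = p + k"
    have pq: "p + 0 \<le> q" "p + 0 \<le> q + 2" by (simp_all add: q_def)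
    define c1 where "c1 = (3 / 2) ^ p * (2 ^ q * exp (real (q + 1)))"
    define c2 where "c2 = (3 / 2) ^ p * (2 ^ (q + 2) * exp (real (q + 2 + 1)))"
    define B where "B j = c1 * R q j + c2 * R (q + 2) j" for j
    define P where "P = (real p ^ p) powr (\<alpha> / 2) * (real k ^ k) powr (\<alpha> / 2)"
    have P: "P \<ge> 0" by (simp add: P_def)
    have c: "c1 \<ge> 0" "c2 \<ge> 0" "c1 \<le> c2"
    proof -
      show "c1 \<ge> 0" "c2 \<ge> 0" by (simp_all add: c1_def c2_def)
      have "2 ^ q * exp (real (q + 1)) \<le> 2 ^ (q + 2) * exp (real (q + 2 + 1))"
        by (intro mult_mono power_increasing) auto
      then show "c1 \<le> c2" unfolding c1_def c2_def by (rule mult_left_mono) simp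
    qed
    have R: "R q j \<ge> 0" for q j by (simp add: R_def)
    have B0: "B j \<ge> 0" for j using c R by (auto simp: B_def)
    have B1: "sqrt t ^ (p + k) * (1 + t) * \<bar>lagd p 0 j t\<bar> \<le> B j" if t: "t \<ge> 0" for j t
    proof -
      have "sqrt t ^ q * (1 + t) = sqrt t ^ q + sqrt t ^ (q + 2)"
        using t by (simp add: power_add distrib_left)
      then have "sqrt t ^ (p + k) * (1 + t) * \<bar>lagd p 0 j t\<bar> = sqrt t ^ q * \<bar>lagd p 0 j t\<bar> + sqrt t ^ (q + 2) * \<bar>lagd p 0 j t\<bar>"
        by (simp add: q_def distrib_right)
      also have "\<dots> \<le> B j"
        using lagd_weighted_bound[OF t pq(1), of j] lagd_weighted_bound[OF t pq(2), of j]
        unfolding B_def c1_def c2_def R_def by (intro add_mono) (simp_all only: mult.assoc)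
      finally show ?thesis .
    qed
    have eq: "subexp \<alpha> \<delta> j * B j = c1 * (subexp \<alpha> \<delta> j * R q j) + c2 * (subexp \<alpha> \<delta> j * R (q + 2) j)" for j
      by (simp add: B_def distrib_left mult.left_commute)
    have sB: "(\<lambda>j. subexp \<alpha> \<delta> j * B j) summable_on UNIV"
      unfolding eq by (intro summable_on_add summable_on_cmult_right AD(3))
    have "infsum (\<lambda>j. subexp \<alpha> \<delta> j * B j) UNIV \<le> D * A ^ (p + k) * (real p ^ p) powr (\<alpha> / 2) * (real k ^ k) powr (\<alpha> / 2)"
    proof -
      let ?Q = "(real q ^ q) powr (\<alpha> / 2)" and ?Q2 = "(real (q + 2) ^ (q + 2)) powr (\<alpha> / 2)"
      have Q2: "?Q2 \<le> E * F ^ q * ?Q"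
      proof -
        have "?Q2 \<le> (2 * exp 2 * 4 ^ q * real q ^ q) powr (\<alpha> / 2)"
          using \<alpha> by (intro powr_mono2 power_add_2_self_le) auto
        also have "\<dots> = E * F ^ q * ?Q"
          by (simp add: E_def F_def powr_mult powr_realpow[symmetric] powr_powr mult.commute)
        finally show ?thesis .
      qed
      have Q: "?Q \<le> G ^ q * P"
      proof -
        have "?Q \<le> ((2 * exp 1) ^ q * (real p ^ p * real k ^ k)) powr (\<alpha> / 2)"
          unfolding q_def using \<alpha> by (intro powr_mono2 power_add_self_le) auto
        also have "\<dots> = ((2 * exp 1) ^ q) powr (\<alpha> / 2) * P" unfolding P_def by (simp add: powr_mult)
        also have "((2 * exp 1) ^ q) powr (\<alpha> / 2) = G ^ q"
          unfolding G_def by (rule power_powr) simp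
        finally show ?thesis .
      qed
      have "infsum (\<lambda>j. subexp \<alpha> \<delta> j * B j) UNIV
         = c1 * infsum (\<lambda>j. subexp \<alpha> \<delta> j * R q j) UNIV + c2 * infsum (\<lambda>j. subexp \<alpha> \<delta> j * R (q + 2) j) UNIV"
      proof -
        have "infsum (\<lambda>j. subexp \<alpha> \<delta> j * B j) UNIV
           = infsum (\<lambda>j. c1 * (subexp \<alpha> \<delta> j * R q j)) UNIV + infsum (\<lambda>j. c2 * (subexp \<alpha> \<delta> j * R (q + 2) j)) UNIV"
          unfolding eq by (rule infsum_add) (intro summable_on_cmult_right AD(3))+
        then show ?thesis by (simp only: infsum_cmult_right')
      qed
      also have "\<dots> \<le> c2 * (D0 * A1 ^ (q + 2) * (E * F ^ q * ?Q)) + c2 * (D0 * A1 ^ (q + 2) * (E * F ^ q * ?Q))"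
      proof (intro add_mono mult_mono)
        have "infsum (\<lambda>j. subexp \<alpha> \<delta> j * R q j) UNIV \<le> D0 * A0 ^ q * ?Q" by (rule AD(4))
        also have "\<dots> \<le> D0 * A1 ^ (q + 2) * (E * F ^ q * ?Q)"
        proof (intro mult_mono)
          show "A0 ^ q \<le> A1 ^ (q + 2)"
            using A1 AD(1) by (intro order_trans[OF power_mono power_increasing]) auto
          have "1 * ?Q \<le> (E * F ^ q) * ?Q"
            using EFG by (intro mult_right_mono order_trans[OF _ mult_mono[of 1 E 1 "F ^ q"]]) auto
          then show "?Q \<le> E * F ^ q * ?Q" by simp
        qed (use AD(1,2) A1 in auto)
        finally show "infsum (\<lambda>j. subexp \<alpha> \<delta> j * R q j) UNIV \<le> D0 * A1 ^ (q + 2) * (E * F ^ q * ?Q)" .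
        have "infsum (\<lambda>j. subexp \<alpha> \<delta> j * R (q + 2) j) UNIV \<le> D0 * A0 ^ (q + 2) * ?Q2" by (rule AD(4))
        also have "\<dots> \<le> D0 * A1 ^ (q + 2) * (E * F ^ q * ?Q)"
          using Q2 AD(1,2) A1 by (intro mult_mono power_mono) auto
        finally show "infsum (\<lambda>j. subexp \<alpha> \<delta> j * R (q + 2) j) UNIV \<le> D0 * A1 ^ (q + 2) * (E * F ^ q * ?Q)" .
      qed (use c R in \<open>auto intro!: infsum_nonneg mult_nonneg_nonneg less_imp_le[OF subexp_pos]\<close>)
      also have "\<dots> = c2 * (2 * D0 * A1 ^ (q + 2) * E * F ^ q) * ?Q" by simp
      also have "\<dots> \<le> (4 * exp 3 * (4 * exp 1) ^ q) * (2 * D0 * A1 ^ (q + 2) * E * F ^ q) * (G ^ q * P)"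
      proof (intro mult_mono Q)
        have "(3 / 2 :: real) ^ p \<le> 2 ^ q"
          by (rule order_trans[OF power_mono[of "3 / 2" 2 p] power_increasing]) (auto simp: q_def)
        then have "c2 \<le> 2 ^ q * (2 ^ (q + 2) * exp (real (q + 2 + 1)))"
          unfolding c2_def by (intro mult_right_mono) auto
        also have "\<dots> = 4 * exp 3 * (4 * exp 1) ^ q"
          by (simp add: power_mult_distrib power_add exp_add flip: exp_of_nat_mult)
             (simp flip: power_mult_distrib)
        finally show "c2 \<le> 4 * exp 3 * (4 * exp 1) ^ q" .
      qed (use AD A1 EFG P in auto)
      also have "\<dots> = D * A ^ q * P"
        by (simp add: D_def A_def power_mult_distrib power_add power2_eq_square)
      finally show ?thesis by (simp add: q_def P_def mult.assoc)
    qed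
    with B0 B1 sB show ?thesis by (intro exI[of _ B]) blast
  qed
  then show ?thesis using \<open>A > 0\<close> \<open>D > 0\<close> by blast
qed

lemma half_weight_eq:
  "t \<in> pos_orthant \<Longrightarrow> half_weight p k t = (\<Prod>l\<in>UNIV. sqrt (t $ l) ^ (p l + k l))"
  unfolding half_weight_def
proof (intro prod.cong refl)
  fix l assume t: "t \<in> pos_orthant"
  then have "t $ l > 0" by (simp add: pos_orthant_def)
  then show "t $ l powr (real (p l + k l) / 2) = sqrt (t $ l) ^ (p l + k l)"
    by (simp add: powr_half_sqrt[symmetric] powr_realpow[symmetric] powr_powr)
qed

text \<open>
  The multi-dimensional series is dominated by a product of one-dimensional ones.
\<close>

lemma lser_half_weight_bound:
  fixes a :: "'d::finite mindex \<Rightarrow> complex"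
  assumes a: "decays \<alpha> a" "\<alpha> \<ge> 1"
  shows "\<exists>A>0. \<exists>K>0. \<forall>p k. \<forall>t\<in>pos_orthant. half_weight p k t * cmod (lser a p t)
      \<le> K * (A ^ (mdeg p + mdeg k) * self_pow (\<alpha> / 2) k * self_pow (\<alpha> / 2) p) * (\<Prod>l\<in>UNIV. 1 / (1 + t $ l))"
proof -
  obtain C \<delta> where C: "C > 0" "\<delta> > 0" "\<And>n. cmod (a n) \<le> C * (\<Prod>i\<in>UNIV. subexp \<alpha> \<delta> (n i))"
    using a unfolding decays_def by blast
  define good where "good A D p k B \<longleftrightarrow> (\<forall>j. B j \<ge> 0) \<and>
     (\<forall>j t. t \<ge> 0 \<longrightarrow> sqrt t ^ (p + k) * (1 + t) * \<bar>lagd p 0 j t\<bar> \<le> B j) \<and>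
     (\<lambda>j. subexp \<alpha> \<delta> j * B j) summable_on UNIV \<and>
     infsum (\<lambda>j. subexp \<alpha> \<delta> j * B j) UNIV \<le> D * A ^ (p + k) * (real p ^ p) powr (\<alpha> / 2) * (real k ^ k) powr (\<alpha> / 2)"
    for A D p k B
  obtain A D where AD: "A > 0" "D > 0" and ex: "\<And>p k. \<exists>B. good A D p k B"
    using lagd_half_weight_bound[OF C(2) a(2)] unfolding good_def by blast
  define B where "B p k = (SOME B. good A D p k B)" for p k
  have "good A D p k (B p k)" for p k unfolding B_def by (rule someI_ex[OF ex])
  then have B: "\<And>p k j. B p k j \<ge> 0"
     "\<And>p k j t. t \<ge> 0 \<Longrightarrow> sqrt t ^ (p + k) * (1 + t) * \<bar>lagd p 0 j t\<bar> \<le> B p k j"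
     "\<And>p k. (\<lambda>j. subexp \<alpha> \<delta> j * B p k j) summable_on UNIV"
     "\<And>p k. infsum (\<lambda>j. subexp \<alpha> \<delta> j * B p k j) UNIV \<le> D * A ^ (p + k) * (real p ^ p) powr (\<alpha> / 2) * (real k ^ k) powr (\<alpha> / 2)"
    unfolding good_def by blast+
  have main: "half_weight p k t * cmod (lser a p t)
      \<le> (C * D ^ CARD('d)) * (A ^ (mdeg p + mdeg k) * self_pow (\<alpha> / 2) k * self_pow (\<alpha> / 2) p) * (\<Prod>l\<in>UNIV. 1 / (1 + t $ l))"
    if t: "t \<in> pos_orthant" for p k t
  proof -
    let ?h = "\<lambda>l j. subexp \<alpha> \<delta> j * B (p l) (k l) j"
    let ?w = "half_weight p k t * (\<Prod>l\<in>UNIV. 1 + t $ l)"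
    have tp: "t $ l > 0" for l using t by (simp add: pos_orthant_def)
    have w: "?w = (\<Prod>l\<in>UNIV. sqrt (t $ l) ^ (p l + k l) * (1 + t $ l))"
      by (simp add: half_weight_eq[OF t] prod.distrib)
    have w0: "?w \<ge> 0" unfolding w using tp by (intro prod_nonneg) (simp add: less_imp_le)
    have h0: "?h l j \<ge> 0" for l j by (intro mult_nonneg_nonneg B(1)) (simp add: less_imp_le subexp_pos)
    have sh: "(\<lambda>n. \<Prod>l\<in>UNIV. ?h l (n l)) summable_on UNIV"
      "infsum (\<lambda>n. \<Prod>l\<in>UNIV. ?h l (n l)) UNIV = (\<Prod>l\<in>UNIV. infsum (?h l) UNIV)"
      using summable_on_prod_mindex[of ?h, OF B(3) h0] by auto
    have s: "(\<lambda>n. cmod (a n * complex_of_real (lterm p n t))) summable_on UNIV"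
      by (rule lterm_summable[OF a pos_orthant_closed[OF t]])
    have le: "?w * cmod (a n * complex_of_real (lterm p n t)) \<le> C * (\<Prod>l\<in>UNIV. ?h l (n l))" for n
    proof -
      have "?w * cmod (a n * complex_of_real (lterm p n t))
        = cmod (a n) * (\<Prod>l\<in>UNIV. sqrt (t $ l) ^ (p l + k l) * (1 + t $ l) * \<bar>lagd (p l) 0 (n l) (t $ l)\<bar>)"
        unfolding w norm_mult norm_of_real lterm_def abs_prod prod.distrib by simp
      also have "\<dots> \<le> cmod (a n) * (\<Prod>l\<in>UNIV. B (p l) (k l) (n l))"
        using tp by (intro mult_left_mono prod_mono conjI B(2) mult_nonneg_nonneg) (auto simp: less_imp_le)
      also have "\<dots> \<le> (C * (\<Prod>i\<in>UNIV. subexp \<alpha> \<delta> (n i))) * (\<Prod>l\<in>UNIV. B (p l) (k l) (n l))"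
        by (intro mult_right_mono C(3) prod_nonneg ballI B(1))
      finally show ?thesis by (simp add: prod.distrib mult.assoc)
    qed
    have "?w * cmod (lser a p t) \<le> ?w * infsum (\<lambda>n. cmod (a n * complex_of_real (lterm p n t))) UNIV"
      unfolding lser_def by (intro mult_left_mono norm_infsum_bound s w0)
    also have "\<dots> = infsum (\<lambda>n. ?w * cmod (a n * complex_of_real (lterm p n t))) UNIV"
      by (rule infsum_cmult_right'[symmetric])
    also have "\<dots> \<le> infsum (\<lambda>n. C * (\<Prod>l\<in>UNIV. ?h l (n l))) UNIV"
      by (intro infsum_mono summable_on_cmult_right s sh(1) le)
    also have "\<dots> = C * (\<Prod>l\<in>UNIV. infsum (?h l) UNIV)" by (simp add: infsum_cmult_right' sh(2))
    also have "\<dots> \<le> C * (\<Prod>l\<in>UNIV. D * A ^ (p l + k l) * (real (p l) ^ p l) powr (\<alpha> / 2) * (real (k l) ^ k l) powr (\<alpha> / 2))"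
      using C(1) by (intro mult_left_mono prod_mono conjI B(4) infsum_nonneg h0) auto
    also have "\<dots> = (C * D ^ CARD('d)) * (A ^ (mdeg p + mdeg k) * self_pow (\<alpha> / 2) k * self_pow (\<alpha> / 2) p)"
      by (simp add: prod.distrib power_add power_mdeg self_pow_eq mult_ac)
    finally have *: "?w * cmod (lser a p t) \<le> (C * D ^ CARD('d)) * (A ^ (mdeg p + mdeg k) * self_pow (\<alpha> / 2) k * self_pow (\<alpha> / 2) p)" .
    have inv: "(\<Prod>l\<in>UNIV. 1 + t $ l) * (\<Prod>l\<in>UNIV. 1 / (1 + t $ l)) = 1"
      using tp by (simp add: prod.distrib[symmetric] add_pos_pos less_imp_neq[symmetric])
    have "half_weight p k t * cmod (lser a p t) = (?w * cmod (lser a p t)) * (\<Prod>l\<in>UNIV. 1 / (1 + t $ l))"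
      using inv by (simp only: mult_ac mult_1)
    also have "\<dots> \<le> (C * D ^ CARD('d)) * (A ^ (mdeg p + mdeg k) * self_pow (\<alpha> / 2) k * self_pow (\<alpha> / 2) p) * (\<Prod>l\<in>UNIV. 1 / (1 + t $ l))"
      using * tp by (intro mult_right_mono prod_nonneg) (auto simp: less_imp_le)
    finally show ?thesis .
  qed
  have "C * D ^ CARD('d) > 0" using C(1) AD(2) by simp
  then show ?thesis using main AD(1) by blast
qed

lemma integrable_square_bound:
  fixes f :: "real ^ 'd::finite \<Rightarrow> complex"
  assumes m: "f \<in> borel_measurable orthant_measure"
    and b: "\<And>t. t \<in> pos_orthant \<Longrightarrow> cmod (f t) \<le> Q * (\<Prod>l\<in>UNIV. 1 / (1 + t $ l))" and Q: "Q \<ge> 0"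
  shows "f \<in> L2" "L2_norm f \<le> Q * sqrt (\<integral>t. (\<Prod>l\<in>UNIV. (1 / (1 + t $ l))\<^sup>2) \<partial>(orthant_measure :: (real ^ 'd) measure))"
proof -
  let ?W = "\<lambda>t :: real ^ 'd. \<Prod>l\<in>UNIV. (1 / (1 + t $ l))\<^sup>2"
  have W: "integrable orthant_measure ?W" by (rule integral_prod_orthant(1)[OF set_integrable_inverse_square])
  have le: "(cmod (f t))\<^sup>2 \<le> Q\<^sup>2 * ?W t" if "t \<in> pos_orthant" for t
    using power_mono[OF b[OF that] norm_ge_zero, of 2] by (simp add: power_mult_distrib prod_power_distrib)
  have int: "integrable orthant_measure (\<lambda>t. (cmod (f t))\<^sup>2)"
  proof (rule Bochner_Integration.integrable_bound)
    show "integrable orthant_measure (\<lambda>t. Q\<^sup>2 * ?W t)" using W by simp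
    show "(\<lambda>t. (cmod (f t))\<^sup>2) \<in> borel_measurable orthant_measure" using m by measurable
    have "norm ((cmod (f t))\<^sup>2) \<le> norm (Q\<^sup>2 * ?W t)" if "t \<in> pos_orthant" for t
    proof -
      have "Q\<^sup>2 * ?W t \<ge> 0" by (intro mult_nonneg_nonneg prod_nonneg) auto
      then show ?thesis using le[OF that] by (simp only: real_norm_def abs_of_nonneg zero_le_power2)
    qed
    then show "AE t in orthant_measure. norm ((cmod (f t))\<^sup>2) \<le> norm (Q\<^sup>2 * ?W t)" by (intro AE_I2) simp
  qed
  show "f \<in> L2" using m int by (simp add: L2_def)
  have "(\<integral>t. (cmod (f t))\<^sup>2 \<partial>orthant_measure) \<le> (\<integral>t. Q\<^sup>2 * ?W t \<partial>orthant_measure)"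
    using W by (intro integral_mono int) (auto intro: le)
  also have "\<dots> = Q\<^sup>2 * (\<integral>t. ?W t \<partial>orthant_measure)" by simp
  finally have "L2_norm f \<le> sqrt (Q\<^sup>2 * (\<integral>t. ?W t \<partial>orthant_measure))" by (simp add: L2_norm_def)
  then show "L2_norm f \<le> Q * sqrt (\<integral>t. ?W t \<partial>orthant_measure)" using Q by (simp add: real_sqrt_mult)
qed

lemma self_pow_pos: "self_pow \<beta> p > 0"
  unfolding self_pow_def by (intro prod_pos) auto

lemma lser_G_space:
  fixes a :: "'d::finite mindex \<Rightarrow> complex"
  assumes a: "decays \<alpha> a" "\<alpha> \<ge> 1"
  shows "lser a (\<lambda>_. 0) \<in> G_space \<alpha>"
proof -
  let ?f = "lser a (\<lambda>_. 0)"
  obtain A K where AK: "A > 0" "K > 0" "\<And>p k t. t \<in> pos_orthant \<Longrightarrow> half_weight p k t * cmod (lser a p t)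
      \<le> K * (A ^ (mdeg p + mdeg k) * self_pow (\<alpha> / 2) k * self_pow (\<alpha> / 2) p) * (\<Prod>l\<in>UNIV. 1 / (1 + t $ l))"
    using lser_half_weight_bound[OF a] by blast
  define c where "c = sqrt (\<integral>t. (\<Prod>l\<in>UNIV. (1 / (1 + t $ l))\<^sup>2) \<partial>(orthant_measure :: (real ^ 'd) measure))"
  define Q where "Q p k = A ^ (mdeg p + mdeg k) * self_pow (\<alpha> / 2) k * self_pow (\<alpha> / 2) p" for p k :: "'d \<Rightarrow> nat"
  have Q: "Q p k > 0" for p k using AK(1) by (simp add: Q_def self_pow_pos)
  let ?g = "\<lambda>p k t. complex_of_real (half_weight p k t) * rD p ?f t"
  have hw: "half_weight p k t \<ge> 0" for p k and t :: "real ^ 'd" unfolding half_weight_def by (intro prod_nonneg) auto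
  have g: "?g p k \<in> L2" "L2_norm (?g p k) \<le> K * Q p k * c" for p k
  proof -
    have m: "?g p k \<in> borel_measurable orthant_measure"
    proof (rule borel_measurable_continuous_pos_orthant)
      have "continuous_on pos_orthant (\<lambda>t. complex_of_real (half_weight p k t))"
        unfolding half_weight_def by (intro continuous_intros) (auto simp: pos_orthant_def less_imp_neq[symmetric])
      moreover have "continuous_on pos_orthant (lser a p)"
        using continuous_lser[OF a] by (rule continuous_on_subset) (auto simp: pos_orthant_closed)
      then have "continuous_on pos_orthant (rD p ?f)"
        by (rule continuous_on_cong[OF refl, THEN iffD1, rotated]) (simp add: rD_lser[OF a])
      ultimately show "continuous_on pos_orthant (?g p k)" by (rule continuous_on_mult)
    qed
    have b: "cmod (?g p k t) \<le> (K * Q p k) * (\<Prod>l\<in>UNIV. 1 / (1 + t $ l))" if "t \<in> pos_orthant" for t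
      using AK(3)[OF that, of p k] hw[of p k t] unfolding Q_def rD_lser[OF a that] by (simp add: norm_mult)
    have "K * Q p k \<ge> 0" using AK(2) Q[of p k] by simp
    from integrable_square_bound[OF m b this]
    show "?g p k \<in> L2" "L2_norm (?g p k) \<le> K * Q p k * c" by (auto simp: c_def)
  qed
  have "bdd_above (range (\<lambda>(p, k). L2_norm (?g p k) / (A ^ (mdeg p + mdeg k) * self_pow (\<alpha> / 2) k * self_pow (\<alpha> / 2) p)))"
  proof (rule bdd_aboveI2)
    fix x :: "('d \<Rightarrow> nat) \<times> ('d \<Rightarrow> nat)"
    obtain p k where x: "x = (p, k)" by (cases x)
    have "L2_norm (?g p k) / Q p k \<le> K * c" using g(2)[of p k] Q[of p k] by (simp add: field_simps)
    then show "(case x of (p, k) \<Rightarrow> L2_norm (?g p k) / (A ^ (mdeg p + mdeg k) * self_pow (\<alpha> / 2) k * self_pow (\<alpha> / 2) p)) \<le> K * c"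
      by (simp add: x Q_def)
  qed
  then show ?thesis unfolding G_space_def using lser_schwartz[OF a] g(1) AK(1) by blast
qed

lemma L2_cong:
  assumes "f \<in> L2" "\<And>t. t \<in> pos_orthant \<Longrightarrow> f t = g t" shows "g \<in> L2"
proof -
  have "g \<in> borel_measurable orthant_measure \<longleftrightarrow> f \<in> borel_measurable orthant_measure"
    by (rule measurable_cong) (simp add: assms(2))
  moreover have "integrable orthant_measure (\<lambda>t. (cmod (g t))\<^sup>2) \<longleftrightarrow> integrable orthant_measure (\<lambda>t. (cmod (f t))\<^sup>2)"
    by (rule Bochner_Integration.integrable_cong) (simp_all add: assms(2))
  ultimately show ?thesis using assms(1) by (simp add: L2_def)
qed

lemma G_space_imp_L2:
  fixes f :: "real ^ 'd::finite \<Rightarrow> complex"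
  assumes "f \<in> G_space \<alpha>" shows "f \<in> L2"
proof -
  have "(\<lambda>t. complex_of_real (half_weight (\<lambda>_. 0) (\<lambda>_. 0) t) * rD (\<lambda>_. 0) f t) \<in> L2"
    using assms unfolding G_space_def by blast
  moreover have "rD (\<lambda>_. 0) f = f"
  proof -
    have "foldr (\<lambda>l. rpartial l ^^ 0) ls f = f" for ls by (induction ls) auto
    then show ?thesis by (simp add: rD_def multi_iter_def)
  qed
  moreover have "half_weight (\<lambda>_. 0) (\<lambda>_. 0) t = 1" if "t \<in> pos_orthant" for t :: "real ^ 'd"
    using half_weight_eq[OF that, of "\<lambda>_. 0" "\<lambda>_. 0"] by simp
  ultimately show ?thesis by (elim L2_cong) simp
qed

text \<open>
  Termwise integration and orthonormality.
\<close>

lemma laguerre_coeff_lser: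
  fixes a :: "'d::finite mindex \<Rightarrow> complex"
  assumes a: "decays \<alpha> a" "\<alpha> \<ge> 1"
  shows "laguerre_coeff (lser a (\<lambda>_. 0)) n = a n"
proof -
  let ?L = "\<lambda>m t. complex_of_real (laguerre_fun m t)"
  have L: "(\<lambda>t. ?L m t) \<in> L2" "L2_norm (\<lambda>t. ?L m t) = 1" for m :: "'d \<Rightarrow> nat"
    using laguerre_fun_orthonormal[of m m] measurable_pexp(2)[of "\<lambda>l. lag_poly 0 (m l)"]
    by (auto simp: L2_def L2_norm_def power2_eq_square laguerre_fun_eq_pexp)
  have "((\<lambda>m. \<integral>t. a m * ?L m t * ?L n t \<partial>orthant_measure) has_sum (\<integral>t. lser a (\<lambda>_. 0) t * ?L n t \<partial>orthant_measure)) UNIV"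
  proof (rule integral_has_sum_mindex(2))
    show "integrable orthant_measure (\<lambda>t. a m * ?L m t * ?L n t)" for m
      using integrable_laguerre_coeff(1)[OF L(1)] by (simp add: mult.assoc)
    show "((\<lambda>m. a m * ?L m t * ?L n t) has_sum lser a (\<lambda>_. 0) t * ?L n t) UNIV"
      if "t \<in> space orthant_measure" for t
    proof -
      have "t \<in> closed_orthant" using that by (simp add: pos_orthant_closed)
      then have "((\<lambda>m. a m * ?L m t) has_sum lser a (\<lambda>_. 0) t) UNIV"
        unfolding lser_def laguerre_fun_eq_lterm
        by (intro has_sum_infsum abs_summable_summable[OF lterm_summable[OF a]])
      then show ?thesis by (rule has_sum_cmult_left)
    qed
    have "(\<lambda>m. cmod (a m)) summable_on UNIV" by (rule decays_summable[OF a])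
    then show "(\<lambda>m. \<integral>t. cmod (a m * ?L m t * ?L n t) \<partial>orthant_measure) summable_on UNIV"
    proof (rule summable_on_comparison_test)
      fix m
      have "(\<integral>t. cmod (?L m t * ?L n t) \<partial>orthant_measure) \<le> 1"
        using integrable_laguerre_coeff(2)[OF L(1)[of m], of n] by (simp add: L(2))
      then have "cmod (a m) * (\<integral>t. cmod (?L m t * ?L n t) \<partial>orthant_measure) \<le> cmod (a m) * 1"
        by (intro mult_left_mono) auto
      then show "(\<integral>t. cmod (a m * ?L m t * ?L n t) \<partial>orthant_measure) \<le> cmod (a m)"
        by (simp add: norm_mult mult.assoc)
    qed auto
  qed
  moreover have "(\<integral>t. a m * ?L m t * ?L n t \<partial>orthant_measure) = (if m = n then a n else 0)" for m
  proof -
    have "(\<integral>t. a m * ?L m t * ?L n t \<partial>orthant_measure) = a m * (\<integral>t. complex_of_real (laguerre_fun m t * laguerre_fun n t) \<partial>orthant_measure)"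
      by (simp add: mult.assoc)
    also have "\<dots> = a m * complex_of_real (\<integral>t. laguerre_fun m t * laguerre_fun n t \<partial>orthant_measure)"
      by (simp only: integral_complex_of_real)
    also have "\<dots> = (if m = n then a n else 0)" by (simp add: laguerre_fun_orthonormal(2))
    finally show ?thesis .
  qed
  ultimately have "((\<lambda>m. if m = n then a n else 0) has_sum laguerre_coeff (lser a (\<lambda>_. 0)) n) UNIV"
    by (simp add: laguerre_coeff_def)
  moreover have "((\<lambda>m. if m = n then a n else 0) has_sum a n) UNIV"
  proof -
    have "((\<lambda>m. if m = n then a n else 0) has_sum a n) {n}"
      using has_sum_finite[of "{n}" "\<lambda>m. if m = n then a n else 0"] by simp
    then show ?thesis by (rule has_sum_cong_neutral[THEN iffD1, rotated -1]) auto
  qed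
  ultimately show ?thesis by (rule has_sum_unique)
qed

section \<open>Coefficient decay for functions in the Gelfand-Shilov type space\<close>

text \<open>
  The iterated derivative \<open>rD j f\<close> applies the partial derivatives in a fixed
  order of the coordinates, given by the rank \<open>r\<close>. A further derivative in
  direction \<open>l\<close> just raises the exponent \<open>j_l\<close> if no coordinate of
  smaller rank has been differentiated. Respecting this order avoids the symmetry of mixed
  derivatives.
\<close>

lemma coordinate_rank:
  obtains r :: "'d::finite \<Rightarrow> nat" where
    "\<And>l (j :: 'd \<Rightarrow> nat) f. (\<And>l'. r l' < r l \<Longrightarrow> j l' = 0) \<Longrightarrow> rpartial l (rD j f) = rD (j(l := Suc (j l))) f"
proof
  fix l :: 'd and j :: "'d \<Rightarrow> nat" and f assume j: "\<And>l'. length (takeWhile (\<lambda>x. x \<noteq> l') coords) < length (takeWhile (\<lambda>x. x \<noteq> l) (coords :: 'd list)) \<Longrightarrow> j l' = 0"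
  obtain xs ys where c: "coords = xs @ l # ys" using split_list[of l coords] by (auto simp: set_coords)
  have d: "l \<notin> set xs" "l \<notin> set ys" using distinct_coords[where 'd = 'd] unfolding c by auto
  have rl: "length (takeWhile (\<lambda>x. x \<noteq> l) (coords :: 'd list)) = length xs"
    using d(1) unfolding c by (subst takeWhile_append2) auto
  have j0: "j l' = 0" if l': "l' \<in> set xs" for l'
  proof (rule j)
    have "takeWhile (\<lambda>x. x \<noteq> l') (coords :: 'd list) = takeWhile (\<lambda>x. x \<noteq> l') xs"
      unfolding c using l' by (intro takeWhile_append1) auto
    moreover have "length (takeWhile (\<lambda>x. x \<noteq> l') xs) < length xs"
      using l' by (induction xs) auto
    ultimately show "length (takeWhile (\<lambda>x. x \<noteq> l') coords) < length (takeWhile (\<lambda>x. x \<noteq> l) (coords :: 'd list))"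
      by (simp add: rl)
  qed
  have skip: "foldr (\<lambda>l. rpartial l ^^ k l) zs h = h" if "\<And>l. l \<in> set zs \<Longrightarrow> k l = 0" for k h and zs :: "'d list"
    using that by (induction zs) auto
  have upd: "foldr (\<lambda>l'. rpartial l' ^^ (j(l := Suc (j l))) l') ys f = foldr (\<lambda>l. rpartial l ^^ j l) ys f"
    using d(2) by (intro foldr_cong) auto
  have "rD j f = (rpartial l ^^ j l) (foldr (\<lambda>l. rpartial l ^^ j l) ys f)"
    unfolding rD_def multi_iter_def c using skip[of xs j] j0 by simp
  moreover have "rD (j(l := Suc (j l))) f = (rpartial l ^^ Suc (j l)) (foldr (\<lambda>l. rpartial l ^^ j l) ys f)"
    unfolding rD_def multi_iter_def c foldr_append foldr_Cons comp_def upd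
    using d j0 by (subst skip) auto
  ultimately show "rpartial l (rD j f) = rD (j(l := Suc (j l))) f" by simp
qed

lemma smooth_on_rD:
  fixes f :: "real ^ 'd::finite \<Rightarrow> complex"
  assumes "smooth_on S f"
  shows "smooth_on S (rD p f)"
proof -
  have 1: "smooth_on S (rpartial l h)" if "smooth_on S h" for l and h :: "real ^ 'd \<Rightarrow> complex"
    unfolding smooth_on_def
  proof
    fix k
    have "Ck_on (Suc k) S h" using that unfolding smooth_on_def by blast
    then show "Ck_on k S (rpartial l h)" by simp
  qed
  have 2: "smooth_on S ((rpartial l ^^ k) h)" if "smooth_on S h" for l k and h :: "real ^ 'd \<Rightarrow> complex"
    using that by (induction k) (auto intro: 1)
  have "smooth_on S (foldr (\<lambda>l. rpartial l ^^ p l) ls f)" for ls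
    using assms by (induction ls) (auto intro: 2)
  then show ?thesis by (simp add: rD_def multi_iter_def)
qed

lemma smooth_onD:
  assumes "smooth_on S f"
  shows "continuous_on S f"
    and "x \<in> S \<Longrightarrow> ((\<lambda>s. f (x + s *\<^sub>R axis l 1)) has_vector_derivative rpartial l f x) (at 0)"
proof -
  have "Ck_on (Suc 0) S f" using assms unfolding smooth_on_def by blast
  then show "continuous_on S f" "x \<in> S \<Longrightarrow> ((\<lambda>s. f (x + s *\<^sub>R axis l 1)) has_vector_derivative rpartial l f x) (at 0)"
    by (simp_all add: rpartial_def vector_derivative_works[symmetric])
qed

text \<open>
  The polynomial part of the \<open>i\<close>-th derivative of \<open>(n-p)! t^p e^(-t)
  L_(n-p)^(p)(t)\<close>, for \<open>i \<le> p \<le> n\<close>; at \<open>i = p\<close> this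
  is \<open>n! L_n\<close>.
\<close>

definition rodrigues :: "nat \<Rightarrow> nat \<Rightarrow> nat \<Rightarrow> real poly"
  where "rodrigues n p i = smult (fact (n - p + i)) (monom 1 (p - i) * lag_poly (p - i) (n - p + i))"

lemma poly_rodrigues: "poly (rodrigues n p i) t = fact (n - p + i) * (t ^ (p - i) * lag (p - i) (n - p + i) t)"
  by (simp add: rodrigues_def poly_lag_poly poly_monom)

lemma rodrigues_deriv:
  assumes "i < p"
  shows "((\<lambda>t. poly (rodrigues n p i) t * exp (- t)) has_real_derivative poly (rodrigues n p (Suc i)) t * exp (- t)) (at t)"
    and "poly (rodrigues n p i) 0 = 0"
proof -
  define q m where "q = p - Suc i" and "m = n - p + i"
  have q: "p - i = Suc q" "p - Suc i = q" "n - p + Suc i = Suc m" "n - p + i = m" using assms by (auto simp: q_def m_def)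
  from DERIV_cmult[OF has_real_derivative_lag_weighted[of q m t], of "fact m"]
  show "((\<lambda>t. poly (rodrigues n p i) t * exp (- t)) has_real_derivative poly (rodrigues n p (Suc i)) t * exp (- t)) (at t)"
    unfolding poly_rodrigues q by (simp add: algebra_simps del: power_Suc)
  show "poly (rodrigues n p i) 0 = 0" unfolding poly_rodrigues q by simp
qed

lemma rodrigues_final: "p \<le> n \<Longrightarrow> rodrigues n p p = smult (fact n) (lag_poly 0 n)"
  by (simp add: rodrigues_def monom_0)

lemma schwartz_rD_bounded:
  assumes "g \<in> schwartz_orthant"
  obtains M where "\<And>x. x \<in> pos_orthant \<Longrightarrow> cmod (rD j g x) \<le> M"
proof -
  have "\<forall>k p. bdd_above ((\<lambda>x. mpow x k * cmod (rD p g x)) ` pos_orthant)"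
    using assms by (simp add: schwartz_orthant_def)
  then have "bdd_above ((\<lambda>x. mpow x (\<lambda>_. 0) * cmod (rD j g x)) ` pos_orthant)" by (elim allE)
  then show ?thesis using that by (auto simp: bdd_above_def mpow_def)
qed

lemma integral_by_parts_rodrigues:
  fixes g :: "real ^ 'd::finite \<Rightarrow> complex"
  assumes g: "g \<in> schwartz_orthant"
    and D: "rpartial l (rD j g) = rD (j(l := Suc (j l))) g"
    and i: "i l < p l"
  shows "(\<integral>x. rD j g x * complex_of_real (pexp (\<lambda>k. rodrigues (n k) (p k) ((i(l := Suc (i l))) k)) x) \<partial>orthant_measure)
      = - (\<integral>x. rD (j(l := Suc (j l))) g x * complex_of_real (pexp (\<lambda>k. rodrigues (n k) (p k) (i k)) x) \<partial>orthant_measure)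
        - (\<integral>x. rD j g x * complex_of_real (pexp (\<lambda>k. rodrigues (n k) (p k) (i k)) x) \<partial>orthant_measure) / 2"
proof -
  let ?P = "\<lambda>k. rodrigues (n k) (p k) (i k)"
  let ?j = "j(l := Suc (j l))"
  have s: "smooth_on pos_orthant (rD k g)" for k
    using g by (intro smooth_on_rD) (simp add: schwartz_orthant_def)
  obtain M1 where M1: "\<And>x. x \<in> pos_orthant \<Longrightarrow> cmod (rD j g x) \<le> M1" using schwartz_rD_bounded[OF g] by blast
  obtain M2 where M2: "\<And>x. x \<in> pos_orthant \<Longrightarrow> cmod (rD ?j g x) \<le> M2" using schwartz_rD_bounded[OF g] by blast
  have P: "(\<lambda>k. rodrigues (n k) (p k) ((i(l := Suc (i l))) k)) = ?P(l := rodrigues (n l) (p l) (Suc (i l)))"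
    by auto
  show ?thesis unfolding P
  proof (rule integral_by_parts_pexp[where M = "max M1 M2"])
    show "continuous_on pos_orthant (rD j g)" "continuous_on pos_orthant (rD ?j g)" by (rule smooth_onD(1)[OF s])+
    show "((\<lambda>t. rD j g (x + t *\<^sub>R axis l 1)) has_vector_derivative rD ?j g x) (at 0)" if "x \<in> pos_orthant" for x
      using smooth_onD(2)[OF s that, of j l] unfolding D .
    show "cmod (rD j g x) \<le> max M1 M2" if "x \<in> pos_orthant" for x using M1[OF that] by simp
    show "cmod (rD ?j g x) \<le> max M1 M2" if "x \<in> pos_orthant" for x using M2[OF that] by simp
    show "poly (rodrigues (n l) (p l) (i l)) 0 = 0" by (rule rodrigues_deriv(2)[OF i])
    show "((\<lambda>t. poly (rodrigues (n l) (p l) (i l)) t * exp (- t)) has_real_derivative poly (rodrigues (n l) (p l) (Suc (i l))) t * exp (- t)) (at t)" for t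
      by (rule rodrigues_deriv(1)[OF i])
  qed
qed

text \<open>
  Before any integration by parts the weight \<open>t^p\<close> is split evenly: one half
  completes the derivative of \<open>g\<close> to a weighted norm from
  \<open>G_space\<close> with \<open>k = p - j\<close>, the other half gives the norm of
  \<open>L_(n-p)^(p)\<close> with respect to \<open>t^p e^(-t)\<close>, known from
  orthogonality.
\<close>

lemma integral_rD_rodrigues_0:
  fixes g :: "real ^ 'd::finite \<Rightarrow> complex"
  assumes L: "(\<lambda>t. complex_of_real (half_weight j (\<lambda>l. p l - j l) t) * rD j g t) \<in> L2"
    and jp: "\<And>l. j l \<le> p l" and pn: "\<And>l. p l \<le> n l"
  shows "cmod (\<integral>x. rD j g x * complex_of_real (pexp (\<lambda>k. rodrigues (n k) (p k) 0) x) \<partial>orthant_measure)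
    \<le> L2_norm (\<lambda>t. complex_of_real (half_weight j (\<lambda>l. p l - j l) t) * rD j g t) * sqrt (\<Prod>l\<in>UNIV. fact (n l - p l) * fact (n l))"
proof -
  let ?f = "\<lambda>t. complex_of_real (half_weight j (\<lambda>l. p l - j l) t) * rD j g t"
  (* The second factor in the Cauchy-Schwarz inequality. *)
  define q where "q t = (\<Prod>l\<in>UNIV. fact (n l - p l) * sqrt (t $ l) ^ p l * lag (p l) (n l - p l) (t $ l) * exp (- (t $ l) / 2))" for t :: "real ^ 'd"
  have eq: "rD j g t * complex_of_real (pexp (\<lambda>k. rodrigues (n k) (p k) 0) t) = ?f t * complex_of_real (q t)"
    if t: "t \<in> pos_orthant" for t
  proof -
    have tp: "t $ l \<ge> 0" for l using t by (simp add: pos_orthant_def less_imp_le)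
    have hw: "half_weight j (\<lambda>l. p l - j l) t = (\<Prod>l\<in>UNIV. sqrt (t $ l) ^ p l)"
      unfolding half_weight_eq[OF t] using jp by simp
    have sq: "sqrt (t $ l) ^ p l * sqrt (t $ l) ^ p l = t $ l ^ p l" for l
      using tp by (simp flip: power_mult_distrib)
    have "half_weight j (\<lambda>l. p l - j l) t * q t = pexp (\<lambda>k. rodrigues (n k) (p k) 0) t"
      unfolding hw q_def pexp_def poly_rodrigues prod.distrib[symmetric] diff_zero add_0_right sq[symmetric]
      by (intro prod.cong refl) (simp only: mult_ac)
    then show ?thesis by (simp flip: of_real_mult)
  qed
  have q2: "(q t)\<^sup>2 = (\<Prod>l\<in>UNIV. (fact (n l - p l))\<^sup>2 * (t $ l ^ p l * exp (- (t $ l)) * lag (p l) (n l - p l) (t $ l) * lag (p l) (n l - p l) (t $ l)))"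
    if t: "t \<in> pos_orthant" for t
  proof -
    have tp: "t $ l \<ge> 0" for l using t by (simp add: pos_orthant_def less_imp_le)
    have e: "exp (- s / 2) * exp (- s / 2) = exp (- s)" for s :: real by (simp flip: exp_add)
    have r: "sqrt (t $ l) ^ p l * sqrt (t $ l) ^ p l = t $ l ^ p l" for l
      using tp by (simp flip: power_mult_distrib)
    show ?thesis unfolding q_def power2_eq_square prod.distrib[symmetric]
      unfolding e[symmetric] r[symmetric] by (auto intro!: prod.cong)
  qed
  let ?h = "\<lambda>l s. (fact (n l - p l))\<^sup>2 * (s ^ p l * exp (- s) * lag (p l) (n l - p l) s * lag (p l) (n l - p l) s)"
  have h: "set_integrable lborel {0<..} (?h l)" for l
    by (intro set_integrable_mult_right lag_inner_integrable)
  have hv: "set_lebesgue_integral lborel {0<..} (?h l) = fact (n l - p l) * fact (n l)" for l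
  proof -
    have "set_lebesgue_integral lborel {0<..} (?h l) = (fact (n l - p l))\<^sup>2 * lag_inner (p l) (n l - p l) (n l - p l)"
      unfolding lag_inner_def by (rule set_integral_mult_right)
    then show ?thesis using pn[of l] by (simp add: lag_inner_eq power2_eq_square)
  qed
  have i: "integrable orthant_measure (\<lambda>t. (q t)\<^sup>2) \<longleftrightarrow> integrable orthant_measure (\<lambda>t :: real ^ 'd. \<Prod>l\<in>UNIV. ?h l (t $ l))"
    by (rule Bochner_Integration.integrable_cong) (auto simp: q2)
  have v: "(\<integral>t. (q t)\<^sup>2 \<partial>orthant_measure) = (\<integral>t. (\<Prod>l\<in>UNIV. ?h l (t $ l)) \<partial>(orthant_measure :: (real ^ 'd) measure))"
    by (rule Bochner_Integration.integral_cong) (auto simp: q2)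
  have lagc: "continuous_on S (lag a b)" for S :: "real set" and a b
    unfolding poly_lag_poly[symmetric, abs_def] by (intro continuous_intros)
  have qm: "(\<lambda>t. complex_of_real (q t)) \<in> borel_measurable orthant_measure"
    unfolding q_def
    by (intro borel_measurable_continuous_pos_orthant continuous_intros continuous_on_compose2[OF lagc[of UNIV]]) auto
  have qi: "integrable orthant_measure (\<lambda>t. (cmod (complex_of_real (q t)))\<^sup>2)"
    using i integral_prod_orthant(1)[of ?h, OF h] by simp
  have qv: "(\<integral>t. (cmod (complex_of_real (q t)))\<^sup>2 \<partial>orthant_measure) = (\<Prod>l\<in>UNIV. fact (n l - p l) * fact (n l))"
    using v integral_prod_orthant(2)[of ?h, OF h] hv by simp
  have "(\<integral>x. rD j g x * complex_of_real (pexp (\<lambda>k. rodrigues (n k) (p k) 0) x) \<partial>orthant_measure)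
     = (\<integral>t. ?f t * complex_of_real (q t) \<partial>orthant_measure)"
    by (rule Bochner_Integration.integral_cong) (use eq in auto)
  then have "cmod (\<integral>x. rD j g x * complex_of_real (pexp (\<lambda>k. rodrigues (n k) (p k) 0) x) \<partial>orthant_measure)
     \<le> (\<integral>t. cmod (?f t * complex_of_real (q t)) \<partial>orthant_measure)"
    by (simp only: integral_norm_bound)
  also have "\<dots> \<le> sqrt (\<integral>t. (cmod (?f t))\<^sup>2 \<partial>orthant_measure) * sqrt (\<integral>t. (cmod (complex_of_real (q t)))\<^sup>2 \<partial>orthant_measure)"
    using L by (intro Cauchy_Schwarz_integral(2) qm qi) (auto simp: L2_def)
  finally show ?thesis unfolding qv L2_norm_def .
qed

text \<open>
  Induction on \<open>i\<close>. One integration by parts replaces the integral by one with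
  an additional derivative of \<open>g\<close> and half of one without it, which costs the
  factor \<open>3/2\<close>. The coordinates are used up in the order of decreasing rank, as
  the last assumption records, so that \<open>coordinate_rank\<close> applies.
\<close>

lemma integral_rD_rodrigues_bound:
  fixes g :: "real ^ 'd::finite \<Rightarrow> complex" and i j p n :: "'d \<Rightarrow> nat"
  assumes g: "g \<in> schwartz_orthant"
    and r: "\<And>l j f. (\<And>l'. r l' < r l \<Longrightarrow> j l' = 0) \<Longrightarrow> rpartial l (rD j f) = rD (j(l := Suc (j l))) f"
    and N: "\<And>j. (\<And>l. j l \<le> p l) \<Longrightarrow>
      cmod (\<integral>x. rD j g x * complex_of_real (pexp (\<lambda>k. rodrigues (n k) (p k) 0) x) \<partial>orthant_measure) \<le> N"
    and ij: "\<And>l. j l + i l \<le> p l" "\<And>l l'. i l > 0 \<Longrightarrow> r l' < (r l :: nat) \<Longrightarrow> j l' = 0"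
  shows "cmod (\<integral>x. rD j g x * complex_of_real (pexp (\<lambda>k. rodrigues (n k) (p k) (i k)) x) \<partial>orthant_measure) \<le> (3 / 2) ^ mdeg i * N"
  using ij
proof (induction "mdeg i" arbitrary: i j)
  case 0
  then have i: "i k = 0" for k by (simp add: mdeg_def)
  have "cmod (\<integral>x. rD j g x * complex_of_real (pexp (\<lambda>k. rodrigues (n k) (p k) 0) x) \<partial>orthant_measure) \<le> N"
    by (rule N) (use "0.prems"(1) in \<open>auto simp: i\<close>)
  then show ?case using 0(1) by (simp add: i)
next
  case (Suc m)
  have "{l. i l > 0} \<noteq> {}"
  proof
    assume "{l. i l > 0} = {}"
    then have "i l = 0" for l by auto
    then show False using Suc(2) by (simp add: mdeg_def)
  qed
  (* The next coordinate is the one of largest rank that still has derivatives to be moved. *)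
  then obtain l where l: "i l > 0" "\<And>l'. i l' > 0 \<Longrightarrow> r l' \<le> r l"
  proof -
    have *: "finite (r ` {l. i l > 0})" "r ` {l. i l > 0} \<noteq> {}" using \<open>{l. i l > 0} \<noteq> {}\<close> by auto
    obtain l where "l \<in> {l. i l > 0}" "Max (r ` {l. i l > 0}) = r l" using Max_in[OF *] by blast
    then show ?thesis using that[of l] Max_ge[OF *(1)] by auto
  qed
  define i' where "i' = i(l := i l - 1)"
  have i: "i = i'(l := Suc (i' l))" using l(1) by (auto simp: i'_def)
  have m: "mdeg i' = m"
  proof -
    have "mdeg i = Suc (mdeg i')"
      unfolding mdeg_def by (subst (1 2) sum.remove[of UNIV l]) (use l(1) in \<open>auto simp: i'_def\<close>)
    then show ?thesis using Suc(2) by simp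
  qed
  let ?j = "j(l := Suc (j l))"
  let ?X = "\<lambda>j i. \<integral>x. rD j g x * complex_of_real (pexp (\<lambda>k. rodrigues (n k) (p k) (i k)) x) \<partial>orthant_measure"
  have i'p: "i' k > 0 \<Longrightarrow> i k > 0" for k by (auto simp: i'_def split: if_splits)
  have "?X j i = - ?X ?j i' - ?X j i' / 2"
    unfolding i
  proof (rule integral_by_parts_rodrigues[OF g])
    show "rpartial l (rD j g) = rD ?j g" using l(1) Suc.prems(2) by (intro r)
    show "i' l < p l" using Suc.prems(1)[of l] l(1) by (simp add: i'_def)
  qed
  then have "cmod (?X j i) \<le> cmod (?X ?j i') + cmod (?X j i' / 2)"
    using norm_triangle_ineq4[of "- ?X ?j i'" "?X j i' / 2"] by simp
  also have "\<dots> = cmod (?X ?j i') + cmod (?X j i') / 2" by (simp add: norm_divide)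
  also have "cmod (?X ?j i') \<le> (3 / 2) ^ m * N"
    unfolding m[symmetric]
  proof (rule Suc.hyps(1))
    show "m = mdeg i'" by (simp add: m)
    show "?j k + i' k \<le> p k" for k
      using Suc.prems(1)[of k] l(1) by (cases "k = l") (auto simp: i'_def)
    fix k k' assume k: "i' k > 0" "r k' < r k"
    then have "k' \<noteq> l" using l(2)[OF i'p[OF k(1)]] by auto
    then show "?j k' = 0" using Suc.prems(2)[OF i'p[OF k(1)] k(2)] by simp
  qed
  also have "cmod (?X j i') \<le> (3 / 2) ^ m * N"
    unfolding m[symmetric]
  proof (rule Suc.hyps(1))
    show "m = mdeg i'" by (simp add: m)
    show "j k + i' k \<le> p k" for k
      using Suc.prems(1)[of k] by (cases "k = l") (auto simp: i'_def)
    fix k k' assume k: "i' k > 0" "r k' < r k"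
    then show "j k' = 0" using Suc.prems(2)[OF i'p[OF k(1)] k(2)] by simp
  qed
  finally show ?case unfolding Suc(2)[symmetric] by (simp add: mult.commute[of N] mult.assoc)
qed

text \<open>
  The preceding two bounds combined, with \<open>j^j (p-j)^(p-j) \<le> p^p\<close> to make
  the estimate uniform in \<open>j \<le> p\<close>.
\<close>

lemma laguerre_coeff_G_space_bound:
  fixes g :: "real ^ 'd::finite \<Rightarrow> complex"
  assumes g: "g \<in> G_space \<alpha>" and \<alpha>: "\<alpha> \<ge> 1"
  shows "\<exists>A>0. \<exists>M>0. \<forall>n p. (\<forall>l. p l \<le> n l) \<longrightarrow>
    cmod (laguerre_coeff g n) * (\<Prod>l\<in>UNIV. fact (n l)) \<le> (3 / 2) ^ mdeg p * (M * A ^ mdeg p * self_pow (\<alpha> / 2) p * sqrt (\<Prod>l\<in>UNIV. fact (n l - p l) * fact (n l)))"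
proof -
  let ?f = "\<lambda>p k t. complex_of_real (half_weight p k t) * rD p g t"
  obtain A where A: "A > 0" "\<And>p k. ?f p k \<in> L2"
    "bdd_above (range (\<lambda>(p, k). L2_norm (?f p k) / (A ^ (mdeg p + mdeg k) * self_pow (\<alpha> / 2) k * self_pow (\<alpha> / 2) p)))"
    using g unfolding G_space_def by blast
  have S: "g \<in> schwartz_orthant" using g by (simp add: G_space_def)
  obtain r :: "'d \<Rightarrow> nat" where r: "\<And>l j f. (\<And>l'. r l' < r l \<Longrightarrow> j l' = 0) \<Longrightarrow> rpartial l (rD j f) = rD (j(l := Suc (j l))) f"
    using coordinate_rank by metis
  obtain M0 where M0: "\<And>p k. L2_norm (?f p k) / (A ^ (mdeg p + mdeg k) * self_pow (\<alpha> / 2) k * self_pow (\<alpha> / 2) p) \<le> M0"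
    using A(3) unfolding bdd_above_def by fastforce
  define M where "M = max M0 1"
  have M: "L2_norm (?f p k) \<le> M * (A ^ (mdeg p + mdeg k) * self_pow (\<alpha> / 2) k * self_pow (\<alpha> / 2) p)" for p k
  proof -
    have "A ^ (mdeg p + mdeg k) * self_pow (\<alpha> / 2) k * self_pow (\<alpha> / 2) p > 0" using A(1) by (intro mult_pos_pos self_pow_pos zero_less_power)
    moreover have "L2_norm (?f p k) / (A ^ (mdeg p + mdeg k) * self_pow (\<alpha> / 2) k * self_pow (\<alpha> / 2) p) \<le> M"
      using M0[of p k] by (simp add: M_def)
    ultimately show ?thesis by (simp only: pos_divide_le_eq)
  qed
  have M1: "M > 0" by (simp add: M_def)
  have "cmod (laguerre_coeff g n) * (\<Prod>l\<in>UNIV. fact (n l)) \<le> (3 / 2) ^ mdeg p * (M * A ^ mdeg p * self_pow (\<alpha> / 2) p * sqrt (\<Prod>l\<in>UNIV. fact (n l - p l) * fact (n l)))"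
    if pn: "\<And>l. p l \<le> n l" for n p :: "'d \<Rightarrow> nat"
  proof -
    let ?s = "sqrt (\<Prod>l\<in>UNIV. fact (n l - p l) * fact (n l))"
    have "cmod (\<integral>x. rD (\<lambda>_. 0) g x * complex_of_real (pexp (\<lambda>k. rodrigues (n k) (p k) (p k)) x) \<partial>orthant_measure)
       \<le> (3 / 2) ^ mdeg p * (M * A ^ mdeg p * self_pow (\<alpha> / 2) p * ?s)"
    proof (rule integral_rD_rodrigues_bound[OF S])
      show "rpartial l (rD j f) = rD (j(l := Suc (j l))) f" if "\<And>l'. r l' < r l \<Longrightarrow> j l' = 0" for l j f
        using that by (rule r)
      fix j assume jp: "\<And>l. j l \<le> p l"
      let ?k = "\<lambda>l. p l - j l"
      have md: "mdeg j + mdeg ?k = mdeg p" using jp by (simp add: mdeg_def flip: sum.distrib)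
      have "self_pow (\<alpha> / 2) ?k * self_pow (\<alpha> / 2) j \<le> self_pow (\<alpha> / 2) p"
        unfolding self_pow_eq prod.distrib[symmetric]
      proof (intro prod_mono conjI)
        fix l
        show "0 \<le> (real (?k l) ^ ?k l) powr (\<alpha> / 2) * (real (j l) ^ j l) powr (\<alpha> / 2)" by simp
        have "(real (?k l) ^ ?k l) powr (\<alpha> / 2) * (real (j l) ^ j l) powr (\<alpha> / 2) = (real (j l) ^ j l * real (?k l) ^ ?k l) powr (\<alpha> / 2)"
          by (simp add: powr_mult)
        also have "\<dots> \<le> (real (p l) ^ p l) powr (\<alpha> / 2)"
          using \<alpha> by (intro powr_mono2 power_split_self_le jp) auto
        finally show "(real (?k l) ^ ?k l) powr (\<alpha> / 2) * (real (j l) ^ j l) powr (\<alpha> / 2) \<le> (real (p l) ^ p l) powr (\<alpha> / 2)" .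
      qed
      then have "M * A ^ mdeg p * (self_pow (\<alpha> / 2) ?k * self_pow (\<alpha> / 2) j) \<le> M * A ^ mdeg p * self_pow (\<alpha> / 2) p"
        using M1 A(1) by (intro mult_left_mono) auto
      then have "L2_norm (?f j ?k) \<le> M * A ^ mdeg p * self_pow (\<alpha> / 2) p"
        using M[of j ?k] unfolding md by (simp add: mult.assoc)
      then have "L2_norm (?f j ?k) * ?s \<le> M * A ^ mdeg p * self_pow (\<alpha> / 2) p * ?s"
        by (rule mult_right_mono) (auto intro!: prod_nonneg)
      with integral_rD_rodrigues_0[OF A(2) jp pn]
      show "cmod (\<integral>x. rD j g x * complex_of_real (pexp (\<lambda>k. rodrigues (n k) (p k) 0) x) \<partial>orthant_measure)
        \<le> M * A ^ mdeg p * self_pow (\<alpha> / 2) p * ?s"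
        by (rule order_trans)
    qed auto
    moreover have "(\<integral>x. rD (\<lambda>_. 0) g x * complex_of_real (pexp (\<lambda>k. rodrigues (n k) (p k) (p k)) x) \<partial>orthant_measure)
      = laguerre_coeff g n * complex_of_real (\<Prod>l\<in>UNIV. fact (n l))"
    proof -
      have "foldr (\<lambda>l. rpartial l ^^ 0) ls g = g" for ls by (induction ls) auto
      then have 1: "rD (\<lambda>_. 0) g = g" by (simp add: rD_def multi_iter_def)
      have 2: "pexp (\<lambda>k. rodrigues (n k) (p k) (p k)) x = laguerre_fun n x * (\<Prod>l\<in>UNIV. fact (n l))" for x
        unfolding laguerre_fun_eq_pexp pexp_def rodrigues_final[OF pn] prod.distrib[symmetric]
        by (auto intro!: prod.cong simp: mult_ac)
      show ?thesis unfolding 1 2 laguerre_coeff_def of_real_mult mult.assoc[symmetric]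
        by (rule integral_mult_left_zero)
    qed
    ultimately show ?thesis by (simp add: norm_mult norm_of_real abs_of_nonneg prod_nonneg del: of_real_prod)
  qed
  then show ?thesis using A(1) M1 by blast
qed

lemma decays_square:
  assumes "decays \<alpha> (\<lambda>n. a n * a n)" shows "decays \<alpha> a"
proof -
  obtain C \<delta> where C: "C > 0" "\<delta> > 0" "\<And>n. cmod (a n * a n) \<le> C * (\<Prod>l\<in>UNIV. subexp \<alpha> \<delta> (n l))"
    using assms unfolding decays_def by blast
  have "cmod (a n) \<le> sqrt C * (\<Prod>l\<in>UNIV. subexp \<alpha> (\<delta> / 2) (n l))" for n
  proof (rule power2_le_imp_le)
    have "(cmod (a n))\<^sup>2 \<le> C * (\<Prod>l\<in>UNIV. subexp \<alpha> \<delta> (n l))"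
      using C(3)[of n] by (simp add: norm_mult power2_eq_square)
    also have "\<dots> = (sqrt C * (\<Prod>l\<in>UNIV. subexp \<alpha> (\<delta> / 2) (n l)))\<^sup>2"
      using C(1) by (simp add: power2_eq_square subexp_double[of \<alpha> \<delta>] prod.distrib algebra_simps)
    finally show "(cmod (a n))\<^sup>2 \<le> (sqrt C * (\<Prod>l\<in>UNIV. subexp \<alpha> (\<delta> / 2) (n l)))\<^sup>2" .
    show "0 \<le> sqrt C * (\<Prod>l\<in>UNIV. subexp \<alpha> (\<delta> / 2) (n l))"
      using C(1) by (intro mult_nonneg_nonneg prod_nonneg) (auto simp: less_imp_le subexp_pos)
  qed
  then show ?thesis unfolding decays_def using C(1,2) by (meson half_gt_zero real_sqrt_gt_zero)
qed

text \<open>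
  The bound for the coefficients contains \<open>p^(\<alpha>p/2)\<close> and the square root
  of \<open>(n-p)!/n!\<close>; its square has the form to which the optimization of the
  order applies.
\<close>

lemma decays_laguerre_coeff:
  fixes g :: "real ^ 'd::finite \<Rightarrow> complex"
  assumes g: "g \<in> G_space \<alpha>" and \<alpha>: "\<alpha> \<ge> 1"
  shows "decays \<alpha> (laguerre_coeff g)"
proof (rule decays_square)
  obtain A M where AM: "A > 0" "M > 0" and bound: "\<And>n p. (\<And>l. p l \<le> n l) \<Longrightarrow>
    cmod (laguerre_coeff g n) * (\<Prod>l\<in>UNIV. fact (n l)) \<le> (3 / 2) ^ mdeg p * (M * A ^ mdeg p * self_pow (\<alpha> / 2) p * sqrt (\<Prod>l\<in>UNIV. fact (n l - p l) * fact (n l)))"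
    using laguerre_coeff_G_space_bound[OF assms] by blast
  show "decays \<alpha> (\<lambda>n. laguerre_coeff g n * laguerre_coeff g n)"
  proof (rule decaysI_optimal_order[where B = "(3 / 2 * A)\<^sup>2" and C = "M\<^sup>2"])
    show "(3 / 2 * A)\<^sup>2 > 0" "M\<^sup>2 > 0" using AM by auto
    fix n p :: "'d \<Rightarrow> nat" assume pn: "\<And>l. p l \<le> n l"
    define F where "F = (\<Prod>l\<in>UNIV. fact (n l) :: real)"
    define E where "E = (\<Prod>l\<in>UNIV. fact (n l - p l) :: real)"
    have F: "F > 0" "E > 0" unfolding F_def E_def by (auto intro: prod_pos)
    have sp: "self_pow (\<alpha> / 2) p * self_pow (\<alpha> / 2) p = self_pow \<alpha> p"
      unfolding self_pow_eq prod.distrib[symmetric] by (simp flip: powr_add)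
    have "(cmod (laguerre_coeff g n) * F)\<^sup>2 \<le> ((3 / 2) ^ mdeg p * (M * A ^ mdeg p * self_pow (\<alpha> / 2) p * sqrt (E * F)))\<^sup>2"
      using bound[of p n, OF pn] F by (intro power_mono) (simp_all add: F_def E_def prod.distrib)
    also have "\<dots> = M\<^sup>2 * ((3 / 2 * A)\<^sup>2) ^ mdeg p * self_pow \<alpha> p * (E * F)"
    proof -
      have "(sqrt (E * F))\<^sup>2 = E * F" using F by simp
      moreover have "((3 / 2) ^ mdeg p)\<^sup>2 * (A ^ mdeg p)\<^sup>2 = ((3 / 2 * A)\<^sup>2) ^ mdeg p"
        by (simp only: power_mult_distrib power_mult[symmetric] mult.commute)
      moreover have "(self_pow (\<alpha> / 2) p)\<^sup>2 = self_pow \<alpha> p" by (simp add: power2_eq_square sp)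
      ultimately show ?thesis unfolding power_mult_distrib[of _ _ 2] by (simp only: mult_ac)
    qed
    finally have "(cmod (laguerre_coeff g n))\<^sup>2 * F * F \<le> (M\<^sup>2 * ((3 / 2 * A)\<^sup>2) ^ mdeg p * self_pow \<alpha> p * E) * F"
      by (simp add: power_mult_distrib power2_eq_square mult_ac)
    then have "(cmod (laguerre_coeff g n))\<^sup>2 * F \<le> M\<^sup>2 * ((3 / 2 * A)\<^sup>2) ^ mdeg p * self_pow \<alpha> p * E"
      using F(1) by (simp only: mult_le_cancel_right_pos)
    then have "(cmod (laguerre_coeff g n))\<^sup>2 \<le> M\<^sup>2 * ((3 / 2 * A)\<^sup>2) ^ mdeg p * self_pow \<alpha> p * E / F"
      using F(1) by (simp only: pos_le_divide_eq)
    also have "\<dots> = M\<^sup>2 * (\<Prod>l\<in>UNIV. ((3 / 2 * A)\<^sup>2) ^ p l * (real (p l) ^ p l) powr \<alpha> * (fact (n l - p l) / fact (n l)))"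
      unfolding E_def F_def power_mdeg self_pow_eq prod.distrib prod_dividef by simp
    finally show "cmod (laguerre_coeff g n * laguerre_coeff g n)
      \<le> M\<^sup>2 * (\<Prod>l\<in>UNIV. ((3 / 2 * A)\<^sup>2) ^ p l * (real (p l) ^ p l) powr \<alpha> * (fact (n l - p l) / fact (n l)))"
      by (simp add: norm_mult power2_eq_square)
  qed (use \<alpha> in auto)
qed

section \<open>The equivalence\<close>

lemma L2_diff:
  assumes "f \<in> L2" "g \<in> L2" shows "(\<lambda>t. f t - g t) \<in> L2"
proof -
  have m: "f \<in> borel_measurable orthant_measure" "g \<in> borel_measurable orthant_measure"
    and i: "integrable orthant_measure (\<lambda>t. (cmod (f t))\<^sup>2)" "integrable orthant_measure (\<lambda>t. (cmod (g t))\<^sup>2)"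
    using assms by (auto simp: L2_def)
  have "integrable orthant_measure (\<lambda>t. (cmod (f t - g t))\<^sup>2)"
  proof (rule Bochner_Integration.integrable_bound)
    show "integrable orthant_measure (\<lambda>t. 2 * (cmod (f t))\<^sup>2 + 2 * (cmod (g t))\<^sup>2)" using i by simp
    show "(\<lambda>t. (cmod (f t - g t))\<^sup>2) \<in> borel_measurable orthant_measure" using m by measurable
    have "(cmod (f t - g t))\<^sup>2 \<le> 2 * (cmod (f t))\<^sup>2 + 2 * (cmod (g t))\<^sup>2" for t
    proof -
      have "(cmod (f t - g t))\<^sup>2 \<le> (cmod (f t) + cmod (g t))\<^sup>2" by (intro power_mono norm_triangle_ineq4) auto
      also have "\<dots> = (cmod (f t))\<^sup>2 + (cmod (g t))\<^sup>2 + 2 * cmod (f t) * cmod (g t)" by (rule power2_sum)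
      also have "2 * cmod (f t) * cmod (g t) \<le> (cmod (f t))\<^sup>2 + (cmod (g t))\<^sup>2" by (rule sum_squares_bound)
      finally show ?thesis by simp
    qed
    then show "AE t in orthant_measure. norm ((cmod (f t - g t))\<^sup>2) \<le> norm (2 * (cmod (f t))\<^sup>2 + 2 * (cmod (g t))\<^sup>2)"
      by (intro AE_I2) (simp add: abs_of_nonneg)
  qed
  then show ?thesis using m by (simp add: L2_def)
qed

lemma AE_eq_iff_laguerre_coeff_eq:
  assumes f: "f \<in> L2" and g: "g \<in> L2"
  shows "(AE t in orthant_measure. f t = g t) \<longleftrightarrow> laguerre_coeff f = laguerre_coeff g"
proof
  assume "AE t in orthant_measure. f t = g t"
  moreover have "f \<in> borel_measurable orthant_measure" "g \<in> borel_measurable orthant_measure"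
    using f g by (auto simp: L2_def)
  moreover have "(\<lambda>t. complex_of_real (laguerre_fun n t)) \<in> borel_measurable orthant_measure" for n :: "'a \<Rightarrow> nat"
    unfolding laguerre_fun_eq_pexp by measurable
  ultimately show "laguerre_coeff f = laguerre_coeff g"
    unfolding laguerre_coeff_def by (intro ext integral_cong_AE borel_measurable_times) auto
next
  assume eq: "laguerre_coeff f = laguerre_coeff g"
  have "laguerre_coeff (\<lambda>t. f t - g t) n = 0" for n
  proof -
    have "laguerre_coeff (\<lambda>t. f t - g t) n = laguerre_coeff f n - laguerre_coeff g n"
      unfolding laguerre_coeff_def left_diff_distrib
      by (rule Bochner_Integration.integral_diff[OF integrable_laguerre_coeff(1)[OF f] integrable_laguerre_coeff(1)[OF g]])
    then show ?thesis by (simp add: eq)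
  qed
  from laguerre_coeff_eq_0_imp_AE_eq_0[OF L2_diff[OF f g] this]
  show "AE t in orthant_measure. f t = g t" by simp
qed

lemma decays_iff_AE_eq_G_space:
  assumes f: "f \<in> L2" and \<alpha>: "\<alpha> \<ge> 1"
  shows "decays \<alpha> (laguerre_coeff f) \<longleftrightarrow> (\<exists>g\<in>G_space \<alpha>. AE t in orthant_measure. f t = g t)"
proof
  assume d: "decays \<alpha> (laguerre_coeff f)"
  let ?g = "lser (laguerre_coeff f) (\<lambda>_. 0)"
  have g: "?g \<in> G_space \<alpha>" by (rule lser_G_space[OF d \<alpha>])
  have "laguerre_coeff f = laguerre_coeff ?g" using laguerre_coeff_lser[OF d \<alpha>] by auto
  then have "AE t in orthant_measure. f t = ?g t"
    using AE_eq_iff_laguerre_coeff_eq[OF f G_space_imp_L2[OF g]] by simp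
  with g show "\<exists>g\<in>G_space \<alpha>. AE t in orthant_measure. f t = g t" by blast
next
  assume "\<exists>g\<in>G_space \<alpha>. AE t in orthant_measure. f t = g t"
  then obtain g where g: "g \<in> G_space \<alpha>" "AE t in orthant_measure. f t = g t" by blast
  then have "laguerre_coeff f = laguerre_coeff g"
    using AE_eq_iff_laguerre_coeff_eq[OF f G_space_imp_L2[OF g(1)]] by simp
  then show "decays \<alpha> (laguerre_coeff f)" using decays_laguerre_coeff[OF g(1) \<alpha>] by simp
qed

text \<open>
  The coefficients of \<open>f\<close> are bounded and vanish along coordinate lines, so the
  general equivalence for power series applies.
\<close>

lemma decays_iff_F_disc:
  assumes f: "f \<in> L2" and \<alpha>: "\<alpha> \<ge> 1"
  shows "decays \<alpha> (laguerre_coeff f) \<longleftrightarrow>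
    (\<exists>C>0. \<exists>A>0. \<forall>p. \<forall>w\<in>polydisc. cmod (cD p (F_disc f) w) \<le> C * A ^ mdeg p * self_pow \<alpha> p) \<and>
    (F_disc f \<longlongrightarrow> 0) (at (vec 1) within polydisc)"
proof -
  have F: "F_disc f w = disc_series (laguerre_coeff f) w" if "w \<in> polydisc" for w
    using f that by (rule F_disc_eq_disc_series)
  have 1: "decays \<alpha> (laguerre_coeff f) \<longleftrightarrow>
    (\<exists>C>0. \<exists>A>0. \<forall>p. \<forall>w\<in>polydisc. cmod (cD p (F_disc f) w) \<le> C * A ^ mdeg p * self_pow \<alpha> p)"
  proof (rule decays_iff_derivative_bound[OF \<alpha>, where K = "L2_norm f"])
    show "cmod (laguerre_coeff f n) \<le> L2_norm f" for n by (rule norm_laguerre_coeff_le[OF f])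
    show "(\<lambda>j. laguerre_coeff f (n(l := j))) \<longlonglongrightarrow> 0" for l n by (rule laguerre_coeff_tendsto_0[OF f])
  qed (rule F)
  have "(F_disc f \<longlongrightarrow> 0) (at (vec 1) within polydisc)" if "decays \<alpha> (laguerre_coeff f)"
  proof (rule Lim_transform_eventually[OF disc_series_tendsto_0[OF that \<alpha>]])
    show "\<forall>\<^sub>F w in at (vec 1) within polydisc. disc_series (laguerre_coeff f) w = F_disc f w"
      using F by (auto simp: eventually_at_filter)
  qed
  with 1 show ?thesis by blast
qed

lemma finite_mdeg_le: "finite {n :: 'd::finite mindex. mdeg n \<le> N}"
proof (rule finite_subset)
  show "{n :: 'd mindex. mdeg n \<le> N} \<subseteq> UNIV \<rightarrow>\<^sub>E {..N}"
  proof (intro subsetI PiE_I)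
    fix n :: "'d mindex" and l assume "n \<in> {n. mdeg n \<le> N}"
    moreover have "n l \<le> mdeg n" unfolding mdeg_def by (rule member_le_sum) auto
    ultimately show "n l \<in> {..N}" by simp
  qed auto
qed (auto intro: finite_PiE)

text \<open>
  Only finitely many multi-indices have degree below a given number.
\<close>

lemma tendsto_mdeg_imp:
  fixes a :: "'d::finite mindex \<Rightarrow> complex"
  assumes a: "(a \<longlongrightarrow> 0) (filtercomap mdeg at_top)"
  obtains K where "\<And>n. cmod (a n) \<le> K" "\<And>l n. (\<lambda>j. a (n(l := j))) \<longlonglongrightarrow> 0"
proof -
  have "\<forall>\<^sub>F n in filtercomap mdeg at_top. dist (a n) 0 < 1" by (rule tendstoD[OF a]) simp
  then obtain N where N: "\<And>n. mdeg n \<ge> N \<Longrightarrow> cmod (a n) < 1"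
    unfolding eventually_filtercomap_at_top_linorder by auto
  have fin: "finite ((\<lambda>n. cmod (a n)) ` {n. mdeg n \<le> N})" by (intro finite_imageI finite_mdeg_le)
  have "cmod (a n) \<le> Max (insert 1 ((\<lambda>n. cmod (a n)) ` {n. mdeg n \<le> N}))" for n
  proof (cases "mdeg n \<le> N")
    case True
    then show ?thesis using fin by (intro Max_ge) auto
  next
    case False
    then have "cmod (a n) \<le> 1" using N[of n] by simp
    also have "1 \<le> Max (insert 1 ((\<lambda>n. cmod (a n)) ` {n. mdeg n \<le> N}))" using fin by (intro Max_ge) auto
    finally show ?thesis .
  qed
  moreover have "(\<lambda>j. a (n(l := j))) \<longlonglongrightarrow> 0" for l n
  proof -
    have "j \<le> mdeg (n(l := j))" for j
      using member_le_sum[of l UNIV "n(l := j)"] by (simp add: mdeg_def)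
    then have "filterlim (\<lambda>j. mdeg (n(l := j))) at_top sequentially"
      by (intro filterlim_at_top_mono[OF filterlim_ident]) (auto intro: always_eventually)
    then have "filterlim (\<lambda>j. n(l := j)) (filtercomap mdeg at_top) sequentially"
      by (simp only: filterlim_filtercomap_iff comp_def)
    from filterlim_compose[OF a this] show ?thesis .
  qed
  ultimately show ?thesis by (rule that)
qed

lemma decays_realized_in_G_space:
  fixes a :: "'d::finite mindex \<Rightarrow> complex"
  assumes "decays \<alpha> a" "\<alpha> \<ge> 1"
  shows "\<exists>f\<in>G_space \<alpha>. (\<forall>n. a n = laguerre_coeff f n) \<and> (\<forall>w\<in>polydisc. F_disc f w = disc_series a w)"
proof (intro bexI conjI allI ballI)
  let ?f = "lser a (\<lambda>_. 0)"
  show f: "?f \<in> G_space \<alpha>" by (rule lser_G_space[OF assms])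
  have c: "laguerre_coeff ?f = a" using laguerre_coeff_lser[OF assms] by auto
  show "a n = laguerre_coeff ?f n" for n by (simp add: c)
  show "F_disc ?f w = disc_series a w" if "w \<in> polydisc" for w
    using F_disc_eq_disc_series[OF G_space_imp_L2[OF f] that] by (simp add: c)
qed

theorem theorem5p7:
  fixes \<alpha> :: real
  assumes "\<alpha> \<ge> 1"
  shows
    "(\<forall>f :: real ^ 'd::finite \<Rightarrow> complex. f \<in> L2 \<longrightarrow>
        ((\<exists>c>0. \<exists>b>1. \<forall>n. cmod (laguerre_coeff f n)
              \<le> c * b powr (- (real (mdeg n) powr (1 / \<alpha>))))
          \<longleftrightarrow> (\<exists>g\<in>G_space \<alpha>. AE t in lebesgue_on pos_orthant. f t = g t)) \<and>
        ((\<exists>g\<in>G_space \<alpha>. AE t in lebesgue_on pos_orthant. f t = g t)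
          \<longleftrightarrow> (\<exists>C>0. \<exists>A>0. \<forall>p. \<forall>w\<in>polydisc. cmod (cD p (F_disc f) w)
                 \<le> C * A ^ mdeg p * self_pow \<alpha> p) \<and>
              (F_disc f \<longlongrightarrow> 0) (at (vec 1) within polydisc)))
     \<and> (\<forall>a :: 'd mindex \<Rightarrow> complex.
          (\<exists>c>0. \<exists>b>1. \<forall>n. cmod (a n) \<le> c * b powr (- (real (mdeg n) powr (1 / \<alpha>))))
          \<longrightarrow> (\<exists>f\<in>G_space \<alpha>. (\<forall>n. a n = laguerre_coeff f n) \<and>
                (\<forall>w\<in>polydisc. F_disc f w = disc_series a w)))
     \<and> (\<forall>(F :: complex ^ 'd \<Rightarrow> complex) (a :: 'd mindex \<Rightarrow> complex).
          analytic_multi_on F polydisc \<and>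
          (\<forall>w\<in>polydisc. F w = disc_series a w) \<and>
          (a \<longlongrightarrow> 0) (filtercomap mdeg at_top) \<and>
          (\<exists>C>0. \<exists>A>0. \<forall>p. \<forall>w\<in>polydisc. cmod (cD p F w) \<le> C * A ^ mdeg p * self_pow \<alpha> p)
          \<longrightarrow> (\<exists>f\<in>G_space \<alpha>. (\<forall>n. a n = laguerre_coeff f n) \<and>
                (\<forall>w\<in>polydisc. F_disc f w = F w)))"
proof (intro conjI allI impI)
  fix f :: "real ^ 'd \<Rightarrow> complex" assume f: "f \<in> L2"
  note decay = decays_iff[OF assms, of "laguerre_coeff f"]
  note G = decays_iff_AE_eq_G_space[OF f assms]
  show "(\<exists>c>0. \<exists>b>1. \<forall>n. cmod (laguerre_coeff f n) \<le> c * b powr (- (real (mdeg n) powr (1 / \<alpha>))))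
      \<longleftrightarrow> (\<exists>g\<in>G_space \<alpha>. AE t in lebesgue_on pos_orthant. f t = g t)"
    using decay G by blast
  show "(\<exists>g\<in>G_space \<alpha>. AE t in lebesgue_on pos_orthant. f t = g t)
      \<longleftrightarrow> (\<exists>C>0. \<exists>A>0. \<forall>p. \<forall>w\<in>polydisc. cmod (cD p (F_disc f) w) \<le> C * A ^ mdeg p * self_pow \<alpha> p) \<and>
          (F_disc f \<longlongrightarrow> 0) (at (vec 1) within polydisc)"
    unfolding G[symmetric] by (rule decays_iff_F_disc[OF f assms])
next
  fix a :: "'d mindex \<Rightarrow> complex"
  assume "\<exists>c>0. \<exists>b>1. \<forall>n. cmod (a n) \<le> c * b powr (- (real (mdeg n) powr (1 / \<alpha>)))"
  then have "decays \<alpha> a" unfolding decays_iff[OF assms] .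
  then show "\<exists>f\<in>G_space \<alpha>. (\<forall>n. a n = laguerre_coeff f n) \<and> (\<forall>w\<in>polydisc. F_disc f w = disc_series a w)"
    by (rule decays_realized_in_G_space[OF _ assms])
next
  fix F :: "complex ^ 'd \<Rightarrow> complex" and a :: "'d mindex \<Rightarrow> complex"
  assume "analytic_multi_on F polydisc \<and> (\<forall>w\<in>polydisc. F w = disc_series a w) \<and>
      (a \<longlongrightarrow> 0) (filtercomap mdeg at_top) \<and>
      (\<exists>C>0. \<exists>A>0. \<forall>p. \<forall>w\<in>polydisc. cmod (cD p F w) \<le> C * A ^ mdeg p * self_pow \<alpha> p)"
  then have F: "\<And>w. w \<in> polydisc \<Longrightarrow> F w = disc_series a w" and a: "(a \<longlongrightarrow> 0) (filtercomap mdeg at_top)"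
    and bound: "\<exists>C>0. \<exists>A>0. \<forall>p. \<forall>w\<in>polydisc. cmod (cD p F w) \<le> C * A ^ mdeg p * self_pow \<alpha> p"
    by blast+
  obtain K where K: "\<And>n. cmod (a n) \<le> K" "\<And>l n. (\<lambda>j. a (n(l := j))) \<longlonglongrightarrow> 0"
    using tendsto_mdeg_imp[OF a] by blast
  have "decays \<alpha> a \<longleftrightarrow> (\<exists>C>0. \<exists>A>0. \<forall>p. \<forall>w\<in>polydisc. cmod (cD p F w) \<le> C * A ^ mdeg p * self_pow \<alpha> p)"
    by (rule decays_iff_derivative_bound[OF assms, where K = K]) (use F K in blast)+
  with bound have "decays \<alpha> a" by simp
  from decays_realized_in_G_space[OF this assms]
  show "\<exists>f\<in>G_space \<alpha>. (\<forall>n. a n = laguerre_coeff f n) \<and> (\<forall>w\<in>polydisc. F_disc f w = F w)"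
    using F by fastforce
qed

end
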